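(* Let $\mathbb{F}$ be a perfect field of characteristic $p>0$ and let $L$ be a finite-dimensional, $p$-nilpotent, abelian restricted Lie algebra over $\mathbb{F}$. If $H$ is a restricted Lie algebra over $\mathbb{F}$ such that $u(L)\cong u(H)$ as associative $\mathbb{F}$-algebras, then $L\cong H$ as restricted Lie algebras.
   Context: $u(L)$ denotes the restricted enveloping algebra of a restricted Lie algebra $L$; the $p$-map is written $x\mapsto x^p$. $L$ is $p$-nilpotent if every $x\in L$ satisfies $x^{p^s}=0$ for some $s$. *)

theory Defs
  imports
    "HOL-Computational_Algebra.Polynomial"
    "HOL-Library.Poly_Mapping"
    "HOL-Algebra.QuotRing"
    "HOL-Algebra.Algebraic_Closure_Type"
begin

definition perfect_field :: "'f::field itself \<Rightarrow> bool" where
  "perfect_field _ \<longleftrightarrow> CHAR('f) = 0 \<or> surj (\<lambda>x::'f. x ^ CHAR('f))"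


section \<open>Restricted Lie algebras\<close>

locale lie_algebra = vector_space scale
  for scale :: "'f::field \<Rightarrow> 'a::ab_group_add \<Rightarrow> 'a" (infixr \<open>*s\<close> 75) +
  fixes bracket :: "'a \<Rightarrow> 'a \<Rightarrow> 'a"
  assumes bracket_add_left: "bracket (x + y) z = bracket x z + bracket y z"
    and bracket_add_right: "bracket x (y + z) = bracket x y + bracket x z"
    and bracket_scale_left: "bracket (c *s x) y = c *s bracket x y"
    and bracket_scale_right: "bracket x (c *s y) = c *s bracket x y"
    and bracket_self: "bracket x x = 0"
    and jacobi: "bracket x (bracket y z) + bracket y (bracket z x) + bracket z (bracket x y) = 0"

text \<open>
  The type \<^typ>\<open>'a poly\<close> serves here as \<open>L[t] = L \<otimes> F[t]\<close>, the polynomials in \<open>t\<close> with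
  coefficients in \<open>L\<close>. The function \<open>ad_linear bracket x y\<close> is the operator \<open>ad (t x + y)\<close> on it,
  where \<open>ad u v = [u, v]\<close> and \<^term>\<open>pCons 0\<close> is multiplication by \<open>t\<close>.
\<close>

definition ad_linear ::
  "('a \<Rightarrow> 'a \<Rightarrow> 'a) \<Rightarrow> 'a \<Rightarrow> 'a \<Rightarrow> 'a poly \<Rightarrow> 'a::ab_group_add poly" where
  "ad_linear bracket x y q = pCons 0 (map_poly (bracket x) q) + map_poly (bracket y) q"

text \<open>
  Jacobson's Lie polynomials: \<open>i s\<^sub>i(x, y)\<close> is the coefficient of \<open>t\<close> to the power \<open>i - 1\<close> in
  \<open>ad (t x + y)\<close> applied \<open>p - 1\<close> times to \<open>x\<close>, for \<open>1 \<le> i \<le> p - 1\<close>.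
\<close>

definition jacobson_poly ::
  "('f::field \<Rightarrow> 'a \<Rightarrow> 'a) \<Rightarrow> ('a \<Rightarrow> 'a \<Rightarrow> 'a) \<Rightarrow> nat \<Rightarrow> 'a \<Rightarrow> 'a \<Rightarrow> 'a::ab_group_add" where
  "jacobson_poly scale bracket i x y =
     scale (inverse (of_nat i))
       (coeff ((ad_linear bracket x y ^^ (CHAR('f) - 1)) [:x:]) (i - 1))"

locale restricted_lie_algebra = lie_algebra scale bracket
  for scale :: "'f::field \<Rightarrow> 'a::ab_group_add \<Rightarrow> 'a" (infixr \<open>*s\<close> 75)
    and bracket :: "'a \<Rightarrow> 'a \<Rightarrow> 'a" +
  fixes pmap :: "'a \<Rightarrow> 'a"
  assumes char_pos: "CHAR('f) > 0"
    and pmap_scale: "pmap (c *s x) = c ^ CHAR('f) *s pmap x"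
    and bracket_pmap: "bracket (pmap x) y = (bracket x ^^ CHAR('f)) y"
    and pmap_add: "pmap (x + y) =
      pmap x + pmap y + (\<Sum>i = 1..CHAR('f) - 1. jacobson_poly scale bracket i x y)"

definition abelian_bracket :: "('a \<Rightarrow> 'a \<Rightarrow> 'a::zero) \<Rightarrow> bool" where
  "abelian_bracket bracket \<longleftrightarrow> (\<forall>x y. bracket x y = 0)"

definition p_nilpotent :: "('a \<Rightarrow> 'a::zero) \<Rightarrow> bool" where
  "p_nilpotent pmap \<longleftrightarrow> (\<forall>x. \<exists>s. (pmap ^^ s) x = 0)"

definition restricted_lie_isomorphic ::
  "('f::field \<Rightarrow> 'a \<Rightarrow> 'a) \<Rightarrow> ('a \<Rightarrow> 'a \<Rightarrow> 'a) \<Rightarrow> ('a \<Rightarrow> 'a::ab_group_add) \<Rightarrow>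
   ('f \<Rightarrow> 'b \<Rightarrow> 'b) \<Rightarrow> ('b \<Rightarrow> 'b \<Rightarrow> 'b) \<Rightarrow> ('b \<Rightarrow> 'b::ab_group_add) \<Rightarrow> bool" where
  "restricted_lie_isomorphic scaleL bracketL pmapL scaleH bracketH pmapH \<longleftrightarrow>
     (\<exists>\<phi>. Vector_Spaces.linear scaleL scaleH \<phi> \<and> bij \<phi> \<and>
          (\<forall>x y. \<phi> (bracketL x y) = bracketH (\<phi> x) (\<phi> y)) \<and>
          (\<forall>x. \<phi> (pmapL x) = pmapH (\<phi> x)))"


section \<open>The restricted enveloping algebra\<close>

datatype 'a free_word = Word (letters: "'a list")

instantiation free_word :: (type) monoid_add
begin

definition zero_free_word :: "'a free_word" where "0 = Word []"

definition plus_free_word :: "'a free_word \<Rightarrow> 'a free_word \<Rightarrow> 'a free_word" where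
  "v + w = Word (letters v @ letters w)"

instance
  by standard (simp_all add: zero_free_word_def plus_free_word_def)

end

text \<open>
  Finite words in letters from \<^typ>\<open>'a\<close> form a monoid under concatenation, written additively
  because the convolution product of \<^theory>\<open>HOL-Library.Poly_Mapping\<close> is set up for additive
  monoids of exponents. Hence \<^typ>\<open>'a free_word \<Rightarrow>\<^sub>0 'f\<close> is the free unital associative algebra
  on the set \<^typ>\<open>'a\<close>.
\<close>

definition free_gen :: "'a \<Rightarrow> ('a free_word \<Rightarrow>\<^sub>0 'f::field)" where
  "free_gen x = Poly_Mapping.single (Word [x]) 1"

definition free_scale :: "'f::field \<Rightarrow> ('a free_word \<Rightarrow>\<^sub>0 'f) \<Rightarrow> ('a free_word \<Rightarrow>\<^sub>0 'f)" where
  "free_scale c a = Poly_Mapping.map ((*) c) a"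

text \<open>
  The first two families of relations turn the free algebra on the set \<open>L\<close> into the tensor algebra
  \<open>T(L)\<close>, the third one turns \<open>T(L)\<close> into \<open>U(L)\<close>, and the last one turns \<open>U(L)\<close> into \<open>u(L)\<close>.
\<close>

definition enveloping_relations ::
  "('f::field \<Rightarrow> 'a \<Rightarrow> 'a) \<Rightarrow> ('a \<Rightarrow> 'a \<Rightarrow> 'a) \<Rightarrow> ('a \<Rightarrow> 'a::ab_group_add) \<Rightarrow>
   ('a free_word \<Rightarrow>\<^sub>0 'f) set" where
  "enveloping_relations scale bracket pmap =
     {free_gen (x + y) - (free_gen x + free_gen y) | x y. True}
     \<union> {free_gen (scale c x) - free_scale c (free_gen x) | c x. True}
     \<union> {free_gen (bracket x y) - (free_gen x * free_gen y - free_gen y * free_gen x) | x y. True}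
     \<union> {free_gen (pmap x) - free_gen x ^ CHAR('f) | x. True}"

definition enveloping_ideal ::
  "('f::field \<Rightarrow> 'a \<Rightarrow> 'a) \<Rightarrow> ('a \<Rightarrow> 'a \<Rightarrow> 'a) \<Rightarrow> ('a \<Rightarrow> 'a::ab_group_add) \<Rightarrow>
   ('a free_word \<Rightarrow>\<^sub>0 'f) set" where
  "enveloping_ideal scale bracket pmap =
     Idl\<^bsub>ring_of_type_algebra\<^esub> (enveloping_relations scale bracket pmap)"

text \<open>
  The quotient ring is extended by scalar multiplication of cosets, so that it carries its structure
  of an \<open>F\<close>-algebra. (The locale \<open>algebra\<close> of HOL-Algebra assumes commutativity and is not used.)
\<close>

definition restricted_enveloping_algebra ::
  "('f::field \<Rightarrow> 'a \<Rightarrow> 'a) \<Rightarrow> ('a \<Rightarrow> 'a \<Rightarrow> 'a) \<Rightarrow> ('a \<Rightarrow> 'a::ab_group_add) \<Rightarrow>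
   ('f, ('a free_word \<Rightarrow>\<^sub>0 'f) set) module" where
  "restricted_enveloping_algebra scale bracket pmap =
     (let I = enveloping_ideal scale bracket pmap in
      ring.extend (ring_of_type_algebra Quot I)
        (module.fields (\<lambda>c A. \<Union>a\<in>A. I +>\<^bsub>ring_of_type_algebra\<^esub> free_scale c a)))"

text \<open>Isomorphism of unital associative algebras whose scalars are all elements of a field type.\<close>

definition algebra_isomorphic :: "('f::field, 'a) module \<Rightarrow> ('f, 'b) module \<Rightarrow> bool" where
  "algebra_isomorphic A B \<longleftrightarrow>
     (\<exists>\<phi> \<in> ring_iso A B. \<forall>c. \<forall>a \<in> carrier A. \<phi> (c \<odot>\<^bsub>A\<^esub> a) = c \<odot>\<^bsub>B\<^esub> \<phi> a)"

end

theory Submission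
  imports Defs
begin

text \<open>
  If \<open>u(H)\<close> is commutative, the adjoint representation shows that \<open>H\<close> is nilpotent of class at most
  two, and \<open>H\<close> then embeds into \<open>u(H)\<close>: it acts faithfully on a space of monomials by operators
  \<open>X\<^sub>x + D\<^sub>x\<close>, where the commuting operators \<open>X\<^sub>x\<close> realise an abelian restricted Lie algebra on the
  space \<open>H\<close> and the derivations \<open>D\<^sub>x\<close> produce the bracket. Hence \<open>H\<close> is abelian. Every isomorphism
  \<open>u(L) \<cong> u(H)\<close> preserves the augmentation ideals \<open>M\<close>, because that of \<open>u(L)\<close> is nil. Moreover
  \<open>M = H + M\<^sup>2\<close> and \<open>H \<inter> M\<^sup>2 = H\<^sup>p\<close>. Over a perfect field a nilpotent \<open>p\<close>-map splits into cyclic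
  pieces, which yields a linear retraction of \<open>M\<close> onto \<open>H\<close> that commutes with \<open>p\<close>-th powers and
  sends \<open>M\<^sup>2\<close> into \<open>H\<^sup>p\<close>. The composite \<open>L \<rightarrow> u(L) \<rightarrow> u(H) \<rightarrow> H\<close> is therefore equivariant and surjective
  modulo \<open>H\<^sup>p\<close>, hence surjective. By symmetry there is also a surjection \<open>H \<rightarrow> L\<close>, so the
  dimensions agree and the first surjection is an isomorphism.
\<close>

subsection \<open>Congruences modulo two-sided ideals\<close>

text \<open>\<open>H\<close> is an arbitrary restricted Lie algebra, so even its embedding into
  \<open>u(H)\<close> has to be proved. A full Poincare-Birkhoff-Witt theorem is avoided:
  commutativity of \<open>u(H)\<close> forces class at most two, where one explicit module suffices.
  The later obstacle is that reduction modulo M^2 yields only a linear map onto H/H^p and forgets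
  most of the p-map; the target has to be lifted to H by a map compatible with p-th powers. The
  model is the cyclic algebra with basis v, v^p, ..., v^(p^(n-1)) and v^(p^n) = 0. Its enveloping
  algebra is F[t]/(t^(p^n)), with v^(p^i) corresponding to t^(p^i), and reading off the coefficients
  at exactly these powers of t is compatible with p-th powers. Perfectness enters through p-th roots
  of scalars: they make H^p a subspace and turn semilinear coordinates into linear ones. All
  computations are congruences between elements of a free algebra, so that identities in
  \<open>u(H)\<close> and identities between operators are covered by the same lemmas.\<close>

definition two_sided_ideal :: "'r::ring_1 set \<Rightarrow> bool" where
  "two_sided_ideal J \<longleftrightarrow>
     0 \<in> J \<and> (\<forall>x\<in>J. \<forall>y\<in>J. x + y \<in> J) \<and> (\<forall>x\<in>J. \<forall>a. a * x \<in> J \<and> x * a \<in> J)"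

context
  fixes J :: "'r::ring_1 set"
  assumes J: "two_sided_ideal J"
begin

lemma two_sided_ideal_zero: "0 \<in> J"
  and two_sided_ideal_add: "x \<in> J \<Longrightarrow> y \<in> J \<Longrightarrow> x + y \<in> J"
  and two_sided_ideal_mult_left: "x \<in> J \<Longrightarrow> a * x \<in> J"
  and two_sided_ideal_mult_right: "x \<in> J \<Longrightarrow> x * a \<in> J"
  using J by (auto simp: two_sided_ideal_def)

lemma two_sided_ideal_uminus: "x \<in> J \<Longrightarrow> - x \<in> J"
  using two_sided_ideal_mult_left[of x "-1"] by simp

lemma two_sided_ideal_diff: "x \<in> J \<Longrightarrow> y \<in> J \<Longrightarrow> x - y \<in> J"
  using two_sided_ideal_add[of x "- y"] two_sided_ideal_uminus[of y] by simp

lemma two_sided_ideal_sum: "(\<And>i. i \<in> A \<Longrightarrow> f i \<in> J) \<Longrightarrow> sum f A \<in> J"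
  by (induction A rule: infinite_finite_induct) (auto intro: two_sided_ideal_add two_sided_ideal_zero)

lemma two_sided_ideal_cong_sym: "x - y \<in> J \<Longrightarrow> y - x \<in> J"
  using two_sided_ideal_uminus[of "x - y"] by simp

lemma two_sided_ideal_cong_trans: "x - y \<in> J \<Longrightarrow> y - z \<in> J \<Longrightarrow> x - z \<in> J"
  using two_sided_ideal_add[of "x - y" "y - z"] by simp

lemma two_sided_ideal_cong_mem: "x - y \<in> J \<Longrightarrow> x \<in> J \<longleftrightarrow> y \<in> J"
  using two_sided_ideal_diff[of x "x - y"] two_sided_ideal_add[of y "x - y"] by auto

lemma two_sided_ideal_cong_add: "x - x' \<in> J \<Longrightarrow> y - y' \<in> J \<Longrightarrow> (x + y) - (x' + y') \<in> J"
  using two_sided_ideal_add[of "x - x'" "y - y'"] by (simp add: algebra_simps)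

lemma two_sided_ideal_cong_sum:
  "(\<And>i. i \<in> A \<Longrightarrow> f i - g i \<in> J) \<Longrightarrow> sum f A - sum g A \<in> J"
  using two_sided_ideal_sum[of A "\<lambda>i. f i - g i"] by (simp add: sum_subtractf)

lemma two_sided_ideal_cong_mult:
  assumes "x - x' \<in> J" "y - y' \<in> J"
  shows "x * y - x' * y' \<in> J"
proof -
  have "x * y - x' * y' = (x - x') * y + x' * (y - y')"
    by (simp add: algebra_simps)
  then show ?thesis
    using assms by (auto intro: two_sided_ideal_add two_sided_ideal_mult_left two_sided_ideal_mult_right)
qed

lemma two_sided_ideal_cong_power: "x - y \<in> J \<Longrightarrow> x ^ n - y ^ n \<in> J"
  by (induction n) (auto intro: two_sided_ideal_zero two_sided_ideal_cong_mult)

lemma commute_power_mod_ideal: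
  assumes "a * b - b * a \<in> J"
  shows "a * b ^ n - b ^ n * a \<in> J"
proof (induction n)
  case (Suc n)
  have "a * b ^ Suc n - b ^ Suc n * a = (a * b - b * a) * b ^ n + b * (a * b ^ n - b ^ n * a)"
    by (simp add: algebra_simps power_commutes)
  then show ?case
    using assms Suc by (auto intro: two_sided_ideal_add two_sided_ideal_mult_left two_sided_ideal_mult_right)
qed (auto intro: two_sided_ideal_zero)

text \<open>Only moving \<open>b\<close> past \<open>a ^ k\<close> needs commutativity, and it costs
  an element of \<open>J\<close>; the rest is Pascal's rule with all powers of \<open>a\<close>
  written on the left.\<close>

lemma binomial_mod_ideal:
  assumes "a * b - b * a \<in> J"
  shows "(a + b) ^ n - (\<Sum>k\<le>n. of_nat (n choose k) * (a ^ k * b ^ (n - k))) \<in> J"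
proof (induction n)
  case (Suc n)
  let ?S = "\<lambda>n. \<Sum>k\<le>n. of_nat (n choose k) * (a ^ k * b ^ (n - k))"
  have comm: "x * (of_nat m * z) = of_nat m * (x * z)" for x z :: 'r and m
    using mult_of_nat_commute[of m x] by (simp only: mult.assoc[symmetric])
  have "b * ?S n - (\<Sum>k\<le>n. of_nat (n choose k) * (a ^ k * b ^ (Suc n - k))) \<in> J"
    unfolding sum_distrib_left
  proof (rule two_sided_ideal_cong_sum)
    fix k assume "k \<in> {..n}"
    then have "b ^ (Suc n - k) = b * b ^ (n - k)"
      by (simp add: Suc_diff_le)
    then have "b * (of_nat (n choose k) * (a ^ k * b ^ (n - k))) - of_nat (n choose k) * (a ^ k * b ^ (Suc n - k))
       = of_nat (n choose k) * ((b * a ^ k - a ^ k * b) * b ^ (n - k))"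
      by (simp only: comm right_diff_distrib left_diff_distrib mult.assoc)
    moreover have "b * a ^ k - a ^ k * b \<in> J"
      using assms by (blast intro: commute_power_mod_ideal two_sided_ideal_cong_sym[OF assms])
    ultimately show "b * (of_nat (n choose k) * (a ^ k * b ^ (n - k))) - of_nat (n choose k) * (a ^ k * b ^ (Suc n - k)) \<in> J"
      by (auto intro: two_sided_ideal_mult_left two_sided_ideal_mult_right)
  qed
  then have "(a + b) * ?S n - (a * ?S n + (\<Sum>k\<le>n. of_nat (n choose k) * (a ^ k * b ^ (Suc n - k)))) \<in> J"
    by (simp only: distrib_right add_diff_cancel_left)
  moreover have "a * ?S n + (\<Sum>k\<le>n. of_nat (n choose k) * (a ^ k * b ^ (Suc n - k))) = ?S (Suc n)"
  proof -
    have "(\<Sum>k\<le>n. of_nat (n choose k) * (a ^ k * b ^ (Suc n - k)))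
        = (\<Sum>k\<le>Suc n. of_nat (n choose k) * (a ^ k * b ^ (Suc n - k)))"
      by (simp add: binomial_eq_0)
    also have "\<dots> = b ^ Suc n + (\<Sum>k\<le>n. of_nat (n choose Suc k) * (a ^ Suc k * b ^ (n - k)))"
      by (subst sum.atMost_Suc_shift) simp
    finally have eq: "(\<Sum>k\<le>n. of_nat (n choose k) * (a ^ k * b ^ (Suc n - k)))
        = b ^ Suc n + (\<Sum>k\<le>n. of_nat (n choose Suc k) * (a ^ Suc k * b ^ (n - k)))" .
    have "a * ?S n = (\<Sum>k\<le>n. of_nat (n choose k) * (a ^ Suc k * b ^ (n - k)))"
      unfolding sum_distrib_left by (simp only: comm power_Suc mult.assoc)
    moreover have "?S (Suc n) = b ^ Suc n + (\<Sum>k\<le>n. of_nat (Suc n choose Suc k) * (a ^ Suc k * b ^ (n - k)))"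
      by (subst sum.atMost_Suc_shift) simp
    moreover have "(\<Sum>k\<le>n. of_nat (Suc n choose Suc k) * (a ^ Suc k * b ^ (n - k)))
       = (\<Sum>k\<le>n. of_nat (n choose k) * (a ^ Suc k * b ^ (n - k)))
       + (\<Sum>k\<le>n. of_nat (n choose Suc k) * (a ^ Suc k * b ^ (n - k)))"
      by (simp only: binomial_Suc_Suc of_nat_add distrib_right sum.distrib)
    ultimately show ?thesis
      unfolding eq by (simp only: ac_simps)
  qed
  moreover have "(a + b) ^ Suc n - (a + b) * ?S n \<in> J"
    using two_sided_ideal_mult_left[OF Suc, of "a + b"] by (simp only: right_diff_distrib power_Suc)
  ultimately show ?case
    by (metis two_sided_ideal_cong_trans)
qed (auto intro: two_sided_ideal_zero)

text \<open>With \<open>J\<close> the ideal of relations this is additivity of p-th powers in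
  \<open>u(H)\<close>; with \<open>J\<close> the annihilator of a module it is the same statement
  for commuting operators. The inner binomial coefficients are multiples of \<open>p\<close>, which
  is zero in the ring.\<close>

lemma freshmans_dream_mod_ideal:
  assumes comm: "a * b - b * a \<in> J" and p: "prime p" "of_nat p = (0 :: 'r)"
  shows "(a + b) ^ p - (a ^ p + b ^ p) \<in> J"
proof -
  have "(\<Sum>k\<le>p. of_nat (p choose k) * (a ^ k * b ^ (p - k)))
      = (\<Sum>k\<in>{0,p}. of_nat (p choose k) * (a ^ k * b ^ (p - k)))"
  proof (intro sum.mono_neutral_right ballI)
    fix k assume "k \<in> {..p} - {0, p}"
    then have "p dvd (p choose k)"
      using p(1) by (intro dvd_choose_prime) auto
    then show "of_nat (p choose k) * (a ^ k * b ^ (p - k)) = 0"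
      using p(2) by (auto simp: dvd_def)
  qed auto
  also have "\<dots> = a ^ p + b ^ p"
    using p(1) by (subst sum.insert) (auto simp: prime_gt_0_nat add.commute)
  finally show ?thesis
    using binomial_mod_ideal[OF comm, of p] by simp
qed

text \<open>The induction step needs commutation of the powers \<open>a ^ (p ^ n)\<close> and
  \<open>b ^ (p ^ n)\<close>, obtained by passing to powers in one factor after the other.\<close>

lemma freshmans_dream_mod_ideal_iterated:
  assumes comm: "a * b - b * a \<in> J" and p: "prime p" "of_nat p = (0 :: 'r)"
  shows "(a + b) ^ (p ^ n) - (a ^ (p ^ n) + b ^ (p ^ n)) \<in> J"
proof (induction n)
  case (Suc n)
  let ?a = "a ^ (p ^ n)" and ?b = "b ^ (p ^ n)"
  have "a * ?b - ?b * a \<in> J"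
    using comm by (rule commute_power_mod_ideal)
  then have "?b * a - a * ?b \<in> J"
    by (rule two_sided_ideal_cong_sym)
  then have "?b * ?a - ?a * ?b \<in> J"
    by (rule commute_power_mod_ideal)
  then have "(?a + ?b) ^ p - (?a ^ p + ?b ^ p) \<in> J"
    by (rule freshmans_dream_mod_ideal[OF two_sided_ideal_cong_sym p])
  moreover have "((a + b) ^ (p ^ n)) ^ p - (?a + ?b) ^ p \<in> J"
    using Suc by (rule two_sided_ideal_cong_power)
  ultimately have "((a + b) ^ (p ^ n)) ^ p - (?a ^ p + ?b ^ p) \<in> J"
    by (rule two_sided_ideal_cong_trans[rotated])
  then show ?case
    by (simp add: mult.commute[of p] flip: power_mult)
qed (auto intro: two_sided_ideal_zero)

end

lemma ring_ring_of_type_algebra: "ring (ring_of_type_algebra :: 'r::ring_1 ring)"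
proof (rule ringI)
  show "abelian_group (ring_of_type_algebra :: 'r ring)"
    by (rule abelian_groupI)
      (auto simp: ring_of_type_algebra_def add.assoc add.commute intro: exI[of _ "- _"])
  show "Group.monoid (ring_of_type_algebra :: 'r ring)"
    by (rule Group.monoidI) (auto simp: ring_of_type_algebra_def mult.assoc)
qed (auto simp: ring_of_type_algebra_def algebra_simps)

text \<open>Negation is multiplication by \<open>-1\<close>, so the closure conditions of
  \<open>two_sided_ideal\<close> already give an additive subgroup. Generated ideals of HOL-Algebra
  can thus be handled as plain sets over a ring type.\<close>

lemma ideal_ring_of_type_algebra_iff:
  "ideal J ring_of_type_algebra \<longleftrightarrow> two_sided_ideal (J :: 'r::ring_1 set)"
proof
  assume "ideal J ring_of_type_algebra"
  then interpret ideal J ring_of_type_algebra .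
  show "two_sided_ideal J"
    using additive_subgroup.a_closed[OF is_additive_subgroup] I_l_closed I_r_closed additive_subgroup.zero_closed[OF is_additive_subgroup]
    by (auto simp: two_sided_ideal_def ring_of_type_algebra_def)
next
  assume J: "two_sided_ideal J"
  interpret ring "ring_of_type_algebra :: 'r ring"
    by (rule ring_ring_of_type_algebra)
  have uminus: "\<ominus>\<^bsub>ring_of_type_algebra\<^esub> x = - x" for x :: 'r
    by (rule minus_equality) (auto simp: ring_of_type_algebra_def)
  have "subgroup J (add_monoid ring_of_type_algebra)"
    using J uminus by (intro add.subgroupI)
      (auto simp: ring_of_type_algebra_def a_inv_def two_sided_ideal_uminus two_sided_ideal_add
         dest: two_sided_ideal_zero)
  then show "ideal J ring_of_type_algebra"
    using J by (intro idealI ring_axioms)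
      (auto simp: ring_of_type_algebra_def two_sided_ideal_mult_left two_sided_ideal_mult_right)
qed

subsection \<open>Linear maps on finitely supported functions\<close>

definition pm_scale :: "'f::field \<Rightarrow> ('k \<Rightarrow>\<^sub>0 'f) \<Rightarrow> ('k \<Rightarrow>\<^sub>0 'f)" where
  "pm_scale c f = Poly_Mapping.map ((*) c) f"

lemma lookup_pm_scale [simp]: "Poly_Mapping.lookup (pm_scale c f) k = c * Poly_Mapping.lookup f k"
  by (simp add: pm_scale_def Poly_Mapping.map.rep_eq when_def)

lemma free_scale_eq_pm_scale: "free_scale = pm_scale"
  by (intro ext) (simp add: free_scale_def pm_scale_def)

lemma pm_scale_single [simp]: "pm_scale c (Poly_Mapping.single k d) = Poly_Mapping.single k (c * d)"
  by (rule poly_mapping_eqI) (simp add: lookup_single when_def)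

lemma pm_scale_eq_mult: "pm_scale c f = Poly_Mapping.single 0 c * f"
  for f :: "'k::monoid_add \<Rightarrow>\<^sub>0 'f::field"
  by (simp add: pm_scale_def mult_map_scale_conv_mult)

interpretation pm: vector_space pm_scale
  by unfold_locales (auto intro!: poly_mapping_eqI simp: lookup_add algebra_simps)

lemma pm_scale_mult_left: "pm_scale c f * g = pm_scale c (f * g)"
  for f g :: "'k::monoid_add \<Rightarrow>\<^sub>0 'f::field"
  by (simp add: pm_scale_eq_mult mult.assoc)

text \<open>The exponents need not commute with each other, but the neutral exponent commutes with
  all of them, so scalars are central.\<close>

lemma single_zero_commute: "Poly_Mapping.single 0 c * f = f * Poly_Mapping.single 0 c"
  for f :: "'k::monoid_add \<Rightarrow>\<^sub>0 'f::field"
proof (induction f rule: Poly_Mapping.update_induct)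
  case const
  then show ?case by simp
next
  case (update f a b)
  have "Poly_Mapping.update a b f = f + Poly_Mapping.single a b"
    using update(1) by (intro poly_mapping_eqI) (auto simp: lookup_update lookup_add lookup_single in_keys_iff when_def)
  then show ?case
    using update by (simp add: distrib_left distrib_right mult_single mult.commute)
qed

lemma pm_scale_mult_right: "f * pm_scale c g = pm_scale c (f * g)"
  for f g :: "'k::monoid_add \<Rightarrow>\<^sub>0 'f::field"
  by (metis pm_scale_eq_mult mult.assoc single_zero_commute)

lemma pm_scale_power: "pm_scale c f ^ n = pm_scale (c ^ n) (f ^ n)"
  for f :: "'k::monoid_add \<Rightarrow>\<^sub>0 'f::field"
  by (induction n) (simp_all add: pm_scale_mult_left pm_scale_mult_right mult.commute)

lemma sum_lookup_single: "f = (\<Sum>k\<in>Poly_Mapping.keys f. Poly_Mapping.single k (Poly_Mapping.lookup f k))"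
  by (rule poly_mapping_eqI) (auto simp: lookup_sum lookup_single when_def in_keys_iff sum.delta)

lemma span_range_single: "pm.span (range (\<lambda>k. Poly_Mapping.single k 1)) = UNIV"
proof -
  have "f \<in> pm.span (range (\<lambda>k. Poly_Mapping.single k 1))" for f :: "'a \<Rightarrow>\<^sub>0 'b"
  proof -
    have "Poly_Mapping.single k c \<in> pm.span (range (\<lambda>k. Poly_Mapping.single k 1))" for k and c :: 'b
      using pm.span_scale[OF pm.span_base[OF rangeI[of "\<lambda>k. Poly_Mapping.single k 1" k]], of c] by simp
    then show ?thesis
      by (subst sum_lookup_single) (intro pm.span_sum)
  qed
  then show ?thesis by blast
qed

lemma pm_span_induct [case_names subspace single]:
  assumes "pm.subspace {f. P f}" "\<And>k. P (Poly_Mapping.single k 1)"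
  shows "P (f :: 'k \<Rightarrow>\<^sub>0 'f::field)"
  using pm.span_induct[of f "range (\<lambda>k. Poly_Mapping.single k 1)" P] assms
  by (auto simp: span_range_single)

lemma of_nat_CHAR_poly_mapping: "of_nat CHAR('f) = (0 :: 'k::monoid_add \<Rightarrow>\<^sub>0 'f::field)"
  by (metis of_nat_CHAR single_of_nat single_zero)

definition lin_ext :: "('f::field \<Rightarrow> 't \<Rightarrow> 't) \<Rightarrow> ('k \<Rightarrow> 't) \<Rightarrow> ('k \<Rightarrow>\<^sub>0 'f) \<Rightarrow> 't::ab_group_add" where
  "lin_ext s g f = (\<Sum>k\<in>Poly_Mapping.keys f. s (Poly_Mapping.lookup f k) (g k))"

context vector_space
begin

lemma lin_ext_superset:
  assumes "finite K" "Poly_Mapping.keys f \<subseteq> K"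
  shows "lin_ext scale g f = (\<Sum>k\<in>K. scale (Poly_Mapping.lookup f k) (g k))"
  unfolding lin_ext_def using assms
  by (intro sum.mono_neutral_left) (auto simp: in_keys_iff)

lemma linear_lin_ext:
  fixes g :: "'k \<Rightarrow> 'b"
  shows "Vector_Spaces.linear pm_scale scale (lin_ext scale g)"
proof (rule Vector_Spaces.linear_iff[THEN iffD2], safe)
  fix f h :: "'k \<Rightarrow>\<^sub>0 'a" and c
  let ?K = "Poly_Mapping.keys f \<union> Poly_Mapping.keys h"
  have "lin_ext scale g (f + h) = (\<Sum>k\<in>?K. scale (Poly_Mapping.lookup (f + h) k) (g k))"
    by (rule lin_ext_superset) (auto dest: subsetD[OF Poly_Mapping.keys_add])
  also have "\<dots> = (\<Sum>k\<in>?K. scale (Poly_Mapping.lookup f k) (g k)) + (\<Sum>k\<in>?K. scale (Poly_Mapping.lookup h k) (g k))"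
    by (simp add: lookup_add scale_left_distrib sum.distrib)
  also have "\<dots> = lin_ext scale g f + lin_ext scale g h"
    by (simp add: lin_ext_superset[of ?K])
  finally show "lin_ext scale g (f + h) = lin_ext scale g f + lin_ext scale g h" .
  have "lin_ext scale g (pm_scale c f) = (\<Sum>k\<in>Poly_Mapping.keys f. scale (Poly_Mapping.lookup (pm_scale c f) k) (g k))"
    by (rule lin_ext_superset) (auto simp: in_keys_iff)
  then show "lin_ext scale g (pm_scale c f) = scale c (lin_ext scale g f)"
    by (simp add: lin_ext_def scale_sum_right)
qed (fact pm.vector_space_axioms vector_space_axioms)+

lemma lin_ext_single [simp]: "lin_ext scale g (Poly_Mapping.single k c) = scale c (g k)"
  by (simp add: lin_ext_def)

lemma lin_ext_add: "lin_ext scale g (f + h) = lin_ext scale g f + lin_ext scale g h"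
  and lin_ext_scale: "lin_ext scale g (pm_scale c f) = scale c (lin_ext scale g f)"
  using linear_lin_ext[of g] by (simp_all add: Vector_Spaces.linear_iff)

lemma lin_ext_zero [simp]: "lin_ext scale g 0 = 0"
  by (simp add: lin_ext_def)

end

subsection \<open>Representations of the free algebra\<close>

text \<open>The universal property of the free algebra, as an action: letters act by
  \<open>\<rho>\<close>, and \<open>foldr\<close> lets the last letter act first, so that products
  act as composites.\<close>

definition alg_act ::
  "('f::field \<Rightarrow> 't \<Rightarrow> 't) \<Rightarrow> ('a \<Rightarrow> 't \<Rightarrow> 't) \<Rightarrow> ('a free_word \<Rightarrow>\<^sub>0 'f) \<Rightarrow> 't \<Rightarrow> 't::ab_group_add" where
  "alg_act s \<rho> f t = lin_ext s (\<lambda>w. foldr \<rho> (letters w) t) f"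

locale free_algebra_rep = vector_space scale
  for scale :: "'f::field \<Rightarrow> 't::ab_group_add \<Rightarrow> 't" +
  fixes \<rho> :: "'a \<Rightarrow> 't \<Rightarrow> 't"
  assumes rep_add: "\<rho> x (t + u) = \<rho> x t + \<rho> x u"
    and rep_scale: "\<rho> x (scale c t) = scale c (\<rho> x t)"
begin

abbreviation act :: "('a free_word \<Rightarrow>\<^sub>0 'f) \<Rightarrow> 't \<Rightarrow> 't" where
  "act \<equiv> alg_act scale \<rho>"

lemma foldr_rep_add: "foldr \<rho> xs (t + u) = foldr \<rho> xs t + foldr \<rho> xs u"
  by (induction xs) (auto simp: rep_add)

lemma foldr_rep_scale: "foldr \<rho> xs (scale c t) = scale c (foldr \<rho> xs t)"
  by (induction xs) (auto simp: rep_scale)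

lemma act_add_left: "act (f + g) t = act f t + act g t"
  by (simp add: alg_act_def lin_ext_add)

lemma act_pm_scale_left: "act (pm_scale c f) t = scale c (act f t)"
  by (simp add: alg_act_def lin_ext_scale)

lemma act_zero_left [simp]: "act 0 t = 0"
  by (simp add: alg_act_def)

lemma act_single: "act (Poly_Mapping.single w c) t = scale c (foldr \<rho> (letters w) t)"
  by (simp add: alg_act_def)

lemma act_diff_left: "act (f - g) t = act f t - act g t"
  using act_add_left[of "f - g" g t] by simp

lemma act_add_right: "act f (t + u) = act f t + act f u"
  by (simp add: alg_act_def lin_ext_def foldr_rep_add scale_right_distrib sum.distrib)

lemma act_scale_right: "act f (scale c t) = scale c (act f t)"
  by (simp add: alg_act_def lin_ext_def foldr_rep_scale scale_sum_right mult.commute)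

lemma act_zero_right [simp]: "act f 0 = 0"
  using act_add_right[of f 0 0] by simp

lemma act_mult: "act (f * g) t = act f (act g t)"
proof (induction f arbitrary: t rule: pm_span_induct)
  case subspace
  then show ?case
    by (rule pm.subspaceI) (auto simp: act_add_left distrib_right pm_scale_mult_left act_pm_scale_left)
next
  case (single v)
  show ?case
  proof (induction g arbitrary: t rule: pm_span_induct)
    case subspace
    then show ?case
      by (rule pm.subspaceI)
        (auto simp: act_add_left act_add_right distrib_left pm_scale_mult_right act_pm_scale_left act_scale_right)
  next
    case (single w)
    then show ?case
      by (simp add: mult_single act_single plus_free_word_def)
  qed
qed

lemma act_one [simp]: "act 1 t = t"
proof -
  have "letters (0 :: 'a free_word) = []"
    by (simp add: zero_free_word_def)
  then show ?thesis
    using act_single[of 0 1 t] by simp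
qed

lemma act_power: "act (f ^ n) = act f ^^ n"
proof (induction n)
  case 0
  show ?case by (intro ext) simp
next
  case (Suc n)
  then show ?case by (intro ext) (simp add: act_mult)
qed

lemma act_free_gen [simp]: "act (free_gen x) t = \<rho> x t"
  by (simp add: free_gen_def act_single)

lemma act_in_subspace:
  assumes N: "subspace N" and stable: "\<And>x t. t \<in> N \<Longrightarrow> \<rho> x t \<in> N" and t: "t \<in> N"
  shows "act f t \<in> N"
proof (induction f rule: pm_span_induct)
  case subspace
  show ?case
    using N by (intro pm.subspaceI) (auto simp: act_add_left act_pm_scale_left subspace_0 subspace_add subspace_scale)
next
  case (single w)
  have "foldr \<rho> xs t \<in> N" for xs
    by (induction xs) (auto intro: stable t)
  then show ?case
    by (simp add: act_single)
qed

text \<open>This is the annihilator of the quotient module by \<open>N\<close>. Stability of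
  \<open>N\<close> gives closure under multiplication from the left.\<close>

lemma two_sided_ideal_annihilator:
  assumes N: "subspace N" and stable: "\<And>x t. t \<in> N \<Longrightarrow> \<rho> x t \<in> N"
  shows "two_sided_ideal {f. \<forall>t. act f t \<in> N}"
  using N act_in_subspace[OF N stable]
  by (auto simp: two_sided_ideal_def act_add_left act_mult subspace_0 subspace_add)

end

subsection \<open>The enveloping ideal\<close>

lemma ideal_enveloping: "ideal (enveloping_ideal scale bracket pmap) ring_of_type_algebra"
  unfolding enveloping_ideal_def
  by (rule ring.genideal_ideal[OF ring_ring_of_type_algebra]) (simp add: ring_of_type_algebra_def)

lemma two_sided_ideal_enveloping: "two_sided_ideal (enveloping_ideal scale bracket pmap)"
  using ideal_enveloping by (simp add: ideal_ring_of_type_algebra_iff)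

lemma enveloping_ideal_minimal:
  assumes "two_sided_ideal J" "enveloping_relations scale bracket pmap \<subseteq> J"
  shows "enveloping_ideal scale bracket pmap \<subseteq> J"
  unfolding enveloping_ideal_def
  using assms by (intro ring.genideal_minimal[OF ring_ring_of_type_algebra]) (auto simp: ideal_ring_of_type_algebra_iff)

lemma enveloping_relations_subset: "enveloping_relations scale bracket pmap \<subseteq> enveloping_ideal scale bracket pmap"
  unfolding enveloping_ideal_def
  by (rule ring.genideal_self[OF ring_ring_of_type_algebra]) (simp add: ring_of_type_algebra_def)

lemma
  fixes scale :: "'f::field \<Rightarrow> 'a::ab_group_add \<Rightarrow> 'a" and pmap :: "'a \<Rightarrow> 'a"
  shows enveloping_ideal_free_gen_add:
      "free_gen (x + y) - (free_gen x + free_gen y) \<in> enveloping_ideal scale bracket pmap"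
    and enveloping_ideal_free_gen_scale:
      "free_gen (scale c x) - pm_scale c (free_gen x) \<in> enveloping_ideal scale bracket pmap"
    and enveloping_ideal_free_gen_bracket:
      "free_gen (bracket x y) - (free_gen x * free_gen y - free_gen y * free_gen x) \<in> enveloping_ideal scale bracket pmap"
    and enveloping_ideal_free_gen_pmap:
      "free_gen (pmap x) - free_gen x ^ CHAR('f) \<in> enveloping_ideal scale bracket pmap"
  subgoal
    by (rule subsetD[OF enveloping_relations_subset], unfold enveloping_relations_def,
        rule UnI1, rule UnI1, rule UnI1) (rule CollectI, rule exI[of _ x], rule exI[of _ y], simp)
  subgoal
    by (rule subsetD[OF enveloping_relations_subset], unfold enveloping_relations_def free_scale_eq_pm_scale,
        rule UnI1, rule UnI1, rule UnI2) (rule CollectI, rule exI[of _ c], rule exI[of _ x], simp)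
  subgoal
    by (rule subsetD[OF enveloping_relations_subset], unfold enveloping_relations_def,
        rule UnI1, rule UnI2) (rule CollectI, rule exI[of _ x], rule exI[of _ y], simp)
  subgoal
    by (rule subsetD[OF enveloping_relations_subset], unfold enveloping_relations_def,
        rule UnI2) (rule CollectI, rule exI[of _ x], simp)
  done

text \<open>The relations are required only modulo a stable subspace \<open>N\<close>. Taking
  \<open>{0}\<close> gives modules over the enveloping algebra; taking the multiples of a power of t
  gives truncated polynomial rings without forming a quotient.\<close>

lemma act_enveloping_ideal:
  fixes \<rho> :: "'a::ab_group_add \<Rightarrow> 't \<Rightarrow> 't::ab_group_add" and scale :: "'f::field \<Rightarrow> 't \<Rightarrow> 't"
  assumes rep: "free_algebra_rep scale \<rho>"
    and N: "module.subspace scale N" and stable: "\<And>x t. t \<in> N \<Longrightarrow> \<rho> x t \<in> N"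
    and add: "\<And>x y t. \<rho> (x + y) t - (\<rho> x t + \<rho> y t) \<in> N"
    and scale: "\<And>c x t. \<rho> (scaleL c x) t - scale c (\<rho> x t) \<in> N"
    and bracket: "\<And>x y t. \<rho> (bracket x y) t - (\<rho> x (\<rho> y t) - \<rho> y (\<rho> x t)) \<in> N"
    and pmap: "\<And>x t. \<rho> (pmap x) t - (\<rho> x ^^ CHAR('f)) t \<in> N"
    and f: "f \<in> enveloping_ideal scaleL bracket pmap"
  shows "alg_act scale \<rho> f t \<in> N"
proof -
  interpret free_algebra_rep scale \<rho> by fact
  have gen: "act (free_gen x) = \<rho> x" for x
    by (rule ext) simp
  have "enveloping_relations scaleL bracket pmap \<subseteq> {f. \<forall>t. act f t \<in> N}"
    using add scale bracket pmap
    by (auto simp: enveloping_relations_def free_scale_eq_pm_scale act_diff_left act_add_left act_mult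
        act_pm_scale_left act_power gen)
  then have "enveloping_ideal scaleL bracket pmap \<subseteq> {f. \<forall>t. act f t \<in> N}"
    by (intro enveloping_ideal_minimal two_sided_ideal_annihilator N stable)
  with f show ?thesis by blast
qed

subsection \<open>Isomorphisms of quotients as maps on representatives\<close>

text \<open>An isomorphism of the quotients is carried by a choice of representatives, so
  \<open>\<psi>\<close> respects the operations only modulo \<open>J\<close>. Together with
  additivity, \<open>iso_mem_iff\<close> says that the induced map is well defined and
  injective.\<close>

locale quotient_iso =
  fixes I :: "('a free_word \<Rightarrow>\<^sub>0 'f::field) set" and J :: "('b free_word \<Rightarrow>\<^sub>0 'f) set"
    and \<psi> :: "('a free_word \<Rightarrow>\<^sub>0 'f) \<Rightarrow> ('b free_word \<Rightarrow>\<^sub>0 'f)"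
  assumes I: "two_sided_ideal I" and J: "two_sided_ideal J"
    and iso_add: "\<psi> (f + g) - (\<psi> f + \<psi> g) \<in> J"
    and iso_mult: "\<psi> (f * g) - \<psi> f * \<psi> g \<in> J"
    and iso_one: "\<psi> 1 - 1 \<in> J"
    and iso_scale: "\<psi> (pm_scale c f) - pm_scale c (\<psi> f) \<in> J"
    and iso_mem_iff: "\<psi> f \<in> J \<longleftrightarrow> f \<in> I"
    and iso_surj: "\<exists>f. \<psi> f - h \<in> J"
begin

lemma pm_scale_mem: "f \<in> J \<Longrightarrow> pm_scale c f \<in> J"
  using two_sided_ideal_mult_left[OF J] by (simp add: pm_scale_eq_mult)

lemma iso_diff: "\<psi> (f - g) - (\<psi> f - \<psi> g) \<in> J"
  using two_sided_ideal_uminus[OF J iso_add[of "f - g" g]] by (simp add: algebra_simps)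

lemma iso_cong_iff: "\<psi> f - \<psi> g \<in> J \<longleftrightarrow> f - g \<in> I"
  using two_sided_ideal_cong_mem[OF J iso_diff[of f g]] iso_mem_iff[of "f - g"] by simp

lemma iso_power: "\<psi> (f ^ n) - \<psi> f ^ n \<in> J"
proof (induction n)
  case (Suc n)
  have "\<psi> f * \<psi> (f ^ n) - \<psi> f * \<psi> f ^ n \<in> J"
    using two_sided_ideal_mult_left[OF J Suc, of "\<psi> f"] by (simp add: right_diff_distrib)
  then show ?case
    using two_sided_ideal_cong_trans[OF J iso_mult[of f "f ^ n"]] by simp
qed (simp add: iso_one)

text \<open>Choose preimages. By \<open>iso_cong_iff\<close> every congruence between them may be
  tested after applying \<open>\<psi>\<close>, where \<open>\<psi>\<close> and its section
  cancel.\<close>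

lemma inverse_quotient_iso: "\<exists>\<psi>'. quotient_iso J I \<psi>'"
proof -
  obtain \<psi>' where inv: "\<psi> (\<psi>' h) - h \<in> J" for h
    using iso_surj by metis
  note sym = two_sided_ideal_cong_sym[OF J] and trans = two_sided_ideal_cong_trans[OF J]
  have "quotient_iso J I \<psi>'"
  proof (unfold_locales, goal_cases)
    case (3 f g)
    have "\<psi> (\<psi>' f + \<psi>' g) - (f + g) \<in> J"
      using trans[OF iso_add two_sided_ideal_cong_add[OF J inv inv]] .
    then show ?case
      unfolding iso_cong_iff[symmetric] using trans[OF inv sym] by blast
  next
    case (4 f g)
    have "\<psi> (\<psi>' f * \<psi>' g) - f * g \<in> J"
      using trans[OF iso_mult two_sided_ideal_cong_mult[OF J inv inv]] .
    then show ?case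
      unfolding iso_cong_iff[symmetric] using trans[OF inv sym] by blast
  next
    case 5
    show ?case
      unfolding iso_cong_iff[symmetric] using trans[OF inv sym[OF iso_one]] .
  next
    case (6 c f)
    have "pm_scale c (\<psi> (\<psi>' f)) - pm_scale c f \<in> J"
      using pm_scale_mem[OF inv[of f]] by (simp add: pm.scale_right_diff_distrib)
    with iso_scale have "\<psi> (pm_scale c (\<psi>' f)) - pm_scale c f \<in> J"
      by (rule trans)
    then show ?case
      unfolding iso_cong_iff[symmetric] using trans[OF inv sym] by blast
  next
    case (7 f)
    show ?case
      using two_sided_ideal_cong_mem[OF J inv] iso_mem_iff by blast
  next
    case (8 h)
    show ?case
      unfolding iso_cong_iff[symmetric] using inv by blast
  qed (fact I J)+
  then show ?thesis by blast
qed

end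

lemma r_coset_ring_of_type_algebra:
  assumes "two_sided_ideal I"
  shows "I +>\<^bsub>ring_of_type_algebra\<^esub> f = {g. g - f \<in> I}"
  unfolding a_r_coset_def r_coset_def ring_of_type_algebra_def
  by (auto simp: algebra_simps)

lemma r_coset_eq_iff:
  assumes I: "two_sided_ideal I"
  shows "I +>\<^bsub>ring_of_type_algebra\<^esub> f = I +>\<^bsub>ring_of_type_algebra\<^esub> g \<longleftrightarrow> f - g \<in> I"
  unfolding r_coset_ring_of_type_algebra[OF I]
proof (rule iffI)
  assume eq: "{h. h - f \<in> I} = {h. h - g \<in> I}"
  have "f \<in> {h. h - f \<in> I}"
    using two_sided_ideal_zero[OF I] by simp
  then show "f - g \<in> I"
    unfolding eq by simp
next
  assume fg: "f - g \<in> I"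
  have "h - f \<in> I \<longleftrightarrow> h - g \<in> I" for h
    using two_sided_ideal_cong_mem[OF I, of "h - f" "h - g"] two_sided_ideal_cong_sym[OF I fg] by simp
  then show "{h. h - f \<in> I} = {h. h - g \<in> I}"
    by blast
qed

lemma restricted_enveloping_algebra_simps:
  fixes scale :: "'f::field \<Rightarrow> 'a::ab_group_add \<Rightarrow> 'a" and bracket :: "'a \<Rightarrow> 'a \<Rightarrow> 'a" and pmap :: "'a \<Rightarrow> 'a"
  defines "I \<equiv> enveloping_ideal scale bracket pmap"
    and "U \<equiv> restricted_enveloping_algebra scale bracket pmap"
    and "R \<equiv> (ring_of_type_algebra :: ('a free_word \<Rightarrow>\<^sub>0 'f) ring)"
  shows "carrier U = range (\<lambda>f. I +>\<^bsub>R\<^esub> f)"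
    and "(I +>\<^bsub>R\<^esub> f) \<otimes>\<^bsub>U\<^esub> (I +>\<^bsub>R\<^esub> g) = I +>\<^bsub>R\<^esub> (f * g)"
    and "(I +>\<^bsub>R\<^esub> f) \<oplus>\<^bsub>U\<^esub> (I +>\<^bsub>R\<^esub> g) = I +>\<^bsub>R\<^esub> (f + g)"
    and "\<one>\<^bsub>U\<^esub> = I +>\<^bsub>R\<^esub> 1"
    and "c \<odot>\<^bsub>U\<^esub> (I +>\<^bsub>R\<^esub> f) = I +>\<^bsub>R\<^esub> (pm_scale c f)"
proof -
  have I: "two_sided_ideal I"
    unfolding I_def by (rule two_sided_ideal_enveloping)
  interpret ideal I R
    unfolding I_def R_def by (rule ideal_enveloping)
  have R: "carrier R = UNIV" "\<one>\<^bsub>R\<^esub> = 1" "x \<otimes>\<^bsub>R\<^esub> y = x * y" "x \<oplus>\<^bsub>R\<^esub> y = x + y" for x y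
    by (simp_all add: R_def ring_of_type_algebra_def)
  have U: "carrier U = carrier (R Quot I)" "x \<otimes>\<^bsub>U\<^esub> y = x \<otimes>\<^bsub>R Quot I\<^esub> y" "x \<oplus>\<^bsub>U\<^esub> y = x \<oplus>\<^bsub>R Quot I\<^esub> y"
    "\<one>\<^bsub>U\<^esub> = \<one>\<^bsub>R Quot I\<^esub>" "c \<odot>\<^bsub>U\<^esub> A = (\<Union>a\<in>A. I +>\<^bsub>R\<^esub> free_scale c a)" for x y A c
    by (simp_all add: U_def restricted_enveloping_algebra_def Let_def ring.defs module.defs flip: I_def R_def)
  show "carrier U = range (\<lambda>f. I +>\<^bsub>R\<^esub> f)"
    by (auto simp: U FactRing_def A_RCOSETS_def RCOSETS_def R a_r_coset_def)
  show "(I +>\<^bsub>R\<^esub> f) \<otimes>\<^bsub>U\<^esub> (I +>\<^bsub>R\<^esub> g) = I +>\<^bsub>R\<^esub> (f * g)"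
    by (simp add: U FactRing_def rcoset_mult_add R)
  show "(I +>\<^bsub>R\<^esub> f) \<oplus>\<^bsub>U\<^esub> (I +>\<^bsub>R\<^esub> g) = I +>\<^bsub>R\<^esub> (f + g)"
    by (simp add: U FactRing_def a_rcos_sum R)
  show "\<one>\<^bsub>U\<^esub> = I +>\<^bsub>R\<^esub> 1"
    by (simp add: U FactRing_def R)
  \<comment> \<open>The union that defines scalar multiplication collapses: scaling is
    multiplication by a constant, so all representatives of a coset give the same scaled
    coset.\<close>
  have "I +>\<^bsub>R\<^esub> pm_scale c a = I +>\<^bsub>R\<^esub> pm_scale c f" if "a \<in> I +>\<^bsub>R\<^esub> f" for a
  proof -
    have "a - f \<in> I"
      using that unfolding R_def r_coset_ring_of_type_algebra[OF I] by simp
    then have "pm_scale c a - pm_scale c f \<in> I"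
      using two_sided_ideal_mult_left[OF I, of "a - f" "Poly_Mapping.single 0 c"]
      by (simp add: pm_scale_eq_mult right_diff_distrib)
    then show ?thesis
      unfolding R_def by (simp add: r_coset_eq_iff[OF I])
  qed
  moreover have "f \<in> I +>\<^bsub>R\<^esub> f"
    unfolding R_def r_coset_ring_of_type_algebra[OF I] by (simp add: two_sided_ideal_zero[OF I])
  ultimately show "c \<odot>\<^bsub>U\<^esub> (I +>\<^bsub>R\<^esub> f) = I +>\<^bsub>R\<^esub> (pm_scale c f)"
    unfolding U(5) free_scale_eq_pm_scale by (intro UN_constant_eq[of f]) blast+
qed

lemma algebra_isomorphic_imp_quotient_iso:
  assumes "algebra_isomorphic (restricted_enveloping_algebra scaleL bracketL pmapL)
    (restricted_enveloping_algebra scaleH bracketH pmapH)"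
  shows "\<exists>\<psi>. quotient_iso (enveloping_ideal scaleL bracketL pmapL) (enveloping_ideal scaleH bracketH pmapH) \<psi>"
proof -
  let ?A = "restricted_enveloping_algebra scaleL bracketL pmapL"
  let ?B = "restricted_enveloping_algebra scaleH bracketH pmapH"
  let ?I = "enveloping_ideal scaleL bracketL pmapL" and ?J = "enveloping_ideal scaleH bracketH pmapH"
  let ?a = "\<lambda>f. ?I +>\<^bsub>ring_of_type_algebra\<^esub> f" and ?b = "\<lambda>f. ?J +>\<^bsub>ring_of_type_algebra\<^esub> f"
  obtain \<phi> where \<phi>: "\<phi> \<in> ring_iso ?A ?B"
    and scale: "\<And>c a. a \<in> carrier ?A \<Longrightarrow> \<phi> (c \<odot>\<^bsub>?A\<^esub> a) = c \<odot>\<^bsub>?B\<^esub> \<phi> a"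
    using assms unfolding algebra_isomorphic_def by blast
  note simps = restricted_enveloping_algebra_simps
  have hom: "\<phi> \<in> ring_hom ?A ?B" and bij: "bij_betw \<phi> (range ?a) (range ?b)"
    using \<phi> by (auto simp: ring_iso_def simps(1))
  have mem: "?a f \<in> carrier ?A" for f
    by (simp add: simps)
  have "\<exists>h. \<phi> (?a f) = ?b h" for f
    using bij_betwE[OF bij] by blast
  then obtain \<psi> where \<psi>: "\<phi> (?a f) = ?b (\<psi> f)" for f
    by metis
  note b_eq = r_coset_eq_iff[OF two_sided_ideal_enveloping, symmetric]
  have "quotient_iso ?I ?J \<psi>"
  proof (unfold_locales, goal_cases)
    case (3 f g)
    show ?case
      unfolding b_eq using ring_hom_add[OF hom mem[of f] mem[of g]] by (simp add: simps \<psi>)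
  next
    case (4 f g)
    show ?case
      unfolding b_eq using ring_hom_mult[OF hom mem[of f] mem[of g]] by (simp add: simps \<psi>)
  next
    case 5
    show ?case
      unfolding b_eq using ring_hom_one[OF hom] by (simp add: simps \<psi>)
  next
    case (6 c f)
    show ?case
      unfolding b_eq using scale[OF mem[of f], of c] by (simp add: simps \<psi>)
  next
    case (7 f)
    have inj: "\<phi> (?a f) = \<phi> (?a g) \<longleftrightarrow> ?a f = ?a g" for f g
      using bij_betw_imp_inj_on[OF bij] by (auto dest: inj_onD)
    have zero: "\<psi> 0 \<in> ?J"
    proof -
      have "?b (\<psi> 0 + \<psi> 0) = ?b (\<psi> 0)"
        using ring_hom_add[OF hom mem[of 0] mem[of 0]] by (simp add: simps \<psi>)
      then show ?thesis
        unfolding b_eq[symmetric] r_coset_eq_iff[OF two_sided_ideal_enveloping] by simp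
    qed
    have "\<psi> f \<in> ?J \<longleftrightarrow> \<psi> f - \<psi> 0 \<in> ?J"
      using two_sided_ideal_diff[OF two_sided_ideal_enveloping _ zero]
        two_sided_ideal_add[OF two_sided_ideal_enveloping _ zero, of "\<psi> f - \<psi> 0"] by auto
    also have "\<dots> \<longleftrightarrow> f - 0 \<in> ?I"
      unfolding b_eq by (simp only: inj flip: \<psi>)
    finally show ?case by simp
  next
    case (8 h)
    obtain f where "\<phi> (?a f) = ?b h"
      using bij_betw_imp_surj_on[OF bij] by (metis (no_types, lifting) imageE rangeI)
    then show ?case
      unfolding b_eq \<psi> by blast
  qed (fact two_sided_ideal_enveloping)+
  then show ?thesis by blast
qed

subsection \<open>Monomial module of a Frobenius-semilinear map\<close>

locale frobenius_space = vector_space scale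
  for scale :: "'f::field \<Rightarrow> 'b::ab_group_add \<Rightarrow> 'b" (infixr \<open>*s\<close> 75) +
  fixes q :: "'b \<Rightarrow> 'b" and p :: nat
  assumes p_eq: "p = CHAR('f)" and p_pos: "p > 0"
    and q_add: "q (x + y) = q x + q y"
    and q_scale: "q (c *s x) = c ^ p *s q x"
begin

lemma prime_p: "prime p"
  using p_pos unfolding p_eq by (rule prime_CHAR_semidom)

lemma p_ge_2: "p \<ge> 2"
  using prime_p by (rule prime_ge_2_nat)

lemma q_zero [simp]: "q 0 = 0"
  using q_add[of 0 0] by simp

lemma of_nat_p: "of_nat p = (0 :: 'k::monoid_add \<Rightarrow>\<^sub>0 'f)"
  unfolding p_eq by (rule of_nat_CHAR_poly_mapping)

definition basis :: "'b set" where
  "basis = extend_basis {}"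

lemma independent_basis: "independent basis" and span_basis: "span basis = UNIV"
  by (simp_all add: basis_def independent_extend_basis[OF independent_empty] span_extend_basis[OF independent_empty])

abbreviation coord :: "'b \<Rightarrow> 'b \<Rightarrow> 'f" where
  "coord \<equiv> representation basis"

lemma finite_coord [simp]: "finite {b. coord v b \<noteq> 0}"
  by (rule finite_representation)

lemma coord_add: "coord (v + w) b = coord v b + coord w b"
  by (simp add: representation_add independent_basis span_basis)

lemma coord_scale: "coord (c *s v) b = c * coord v b"
  by (simp add: representation_scale independent_basis span_basis)

lemma sum_coord: "(\<Sum>b | coord v b \<noteq> 0. coord v b *s b) = v"
  by (rule sum_nonzero_representation_eq) (simp_all add: independent_basis span_basis)

text \<open>Multiplication of a monomial by a generator in the commutative algebra with relations
  b^p = \<open>q b\<close>, applied whenever the exponent of \<open>b\<close> would reach a multiple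
  of \<open>p\<close>. The part of a monomial made of full p-th powers never changes, so the module
  is a direct sum of copies of that algebra, and all multisets can serve as its basis.\<close>

function gen_mon :: "'b \<Rightarrow> 'b multiset \<Rightarrow> ('b multiset \<Rightarrow>\<^sub>0 'f)" where
  "gen_mon b m =
     (if count m b mod p \<noteq> p - 1 then Poly_Mapping.single (add_mset b m) 1
      else \<Sum>j | coord (q b) j \<noteq> 0. pm_scale (coord (q b) j) (gen_mon j (m - replicate_mset (p - 1) b)))"
  by pat_completeness auto
termination
proof (relation "measure (size \<circ> snd)", goal_cases)
  case (2 b m j)
  then have "count m b mod p = p - 1"
    by simp
  then have "p - 1 \<le> count m b"
    by (metis mod_less_eq_dividend)
  then have "replicate_mset (p - 1) b \<subseteq># m"
    by (simp add: count_le_replicate_mset_subset_eq)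
  then show ?case
    using p_ge_2 \<open>p - 1 \<le> count m b\<close> count_le_size[of m b] by (simp add: size_Diff_submset)
qed simp

declare gen_mon.simps [simp del]

definition gen_op :: "'b \<Rightarrow> ('b multiset \<Rightarrow>\<^sub>0 'f) \<Rightarrow> ('b multiset \<Rightarrow>\<^sub>0 'f)" where
  "gen_op b = lin_ext pm_scale (gen_mon b)"

text \<open>\<open>gen_op\<close> treats every vector as an independent symbol;
  \<open>vec_op\<close> restores linearity in the vector through coordinates, and on basis vectors
  the two agree.\<close>

definition vec_op :: "'b \<Rightarrow> ('b multiset \<Rightarrow>\<^sub>0 'f) \<Rightarrow> ('b multiset \<Rightarrow>\<^sub>0 'f)" where
  "vec_op v t = (\<Sum>j | coord v j \<noteq> 0. pm_scale (coord v j) (gen_op j t))"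

abbreviation mon :: "'b multiset \<Rightarrow> ('b multiset \<Rightarrow>\<^sub>0 'f)" where
  "mon m \<equiv> Poly_Mapping.single m 1"

lemma gen_op_add: "gen_op b (t + u) = gen_op b t + gen_op b u"
  and gen_op_scale: "gen_op b (pm_scale c t) = pm_scale c (gen_op b t)"
  by (simp_all add: gen_op_def pm.lin_ext_add pm.lin_ext_scale)

lemma gen_op_zero [simp]: "gen_op b 0 = 0"
  using gen_op_add[of b 0 0] by simp

lemma gen_op_sum: "gen_op b (sum g A) = (\<Sum>i\<in>A. gen_op b (g i))"
  by (induction A rule: infinite_finite_induct) (simp_all add: gen_op_add)

lemma vec_op_superset:
  assumes "finite K" "{j. coord v j \<noteq> 0} \<subseteq> K"
  shows "vec_op v t = (\<Sum>j\<in>K. pm_scale (coord v j) (gen_op j t))"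
  unfolding vec_op_def using assms by (intro sum.mono_neutral_left) auto

lemma vec_op_add_left: "vec_op (v + w) t = vec_op v t + vec_op w t"
proof -
  let ?K = "{j. coord v j \<noteq> 0} \<union> {j. coord w j \<noteq> 0}"
  have "vec_op (v + w) t = (\<Sum>j\<in>?K. pm_scale (coord (v + w) j) (gen_op j t))"
    by (rule vec_op_superset) (auto simp: coord_add)
  also have "\<dots> = (\<Sum>j\<in>?K. pm_scale (coord v j) (gen_op j t)) + (\<Sum>j\<in>?K. pm_scale (coord w j) (gen_op j t))"
    by (simp add: coord_add pm.scale_left_distrib sum.distrib)
  also have "\<dots> = vec_op v t + vec_op w t"
    by (simp add: vec_op_superset[of ?K])
  finally show ?thesis .
qed

lemma vec_op_scale_left: "vec_op (c *s v) t = pm_scale c (vec_op v t)"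
proof -
  have "vec_op (c *s v) t = (\<Sum>j | coord v j \<noteq> 0. pm_scale (coord (c *s v) j) (gen_op j t))"
    by (rule vec_op_superset) (auto simp: coord_scale)
  then show ?thesis
    by (simp add: vec_op_def coord_scale pm.scale_sum_right)
qed

lemma vec_op_zero_left [simp]: "vec_op 0 t = 0"
  using vec_op_add_left[of 0 0 t] by simp

lemma vec_op_diff_left: "vec_op (v - w) t = vec_op v t - vec_op w t"
  using vec_op_add_left[of "v - w" w t] by simp

lemma vec_op_sum_left: "vec_op (sum g A) t = (\<Sum>i\<in>A. vec_op (g i) t)"
  by (induction A rule: infinite_finite_induct) (simp_all add: vec_op_add_left)

lemma vec_op_add_right: "vec_op v (t + u) = vec_op v t + vec_op v u"
  by (simp add: vec_op_def gen_op_add pm.scale_right_distrib sum.distrib)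

lemma vec_op_scale_right: "vec_op v (pm_scale c t) = pm_scale c (vec_op v t)"
  by (simp add: vec_op_def gen_op_scale pm.scale_sum_right mult.commute)

lemma vec_op_zero_right [simp]: "vec_op v 0 = 0"
  using vec_op_add_right[of v 0 0] by simp

lemma vec_op_sum_right: "vec_op v (sum g A) = (\<Sum>i\<in>A. vec_op v (g i))"
  by (induction A rule: infinite_finite_induct) (simp_all add: vec_op_add_right)

lemma vec_op_basis: "b \<in> basis \<Longrightarrow> vec_op b = gen_op b"
  by (intro ext) (simp add: vec_op_def representation_basis independent_basis)

lemma gen_op_mon: "gen_op b (mon m) = gen_mon b m"
  by (simp add: gen_op_def)

lemma gen_op_mon_add:
  "count m b mod p \<noteq> p - 1 \<Longrightarrow> gen_op b (mon m) = mon (add_mset b m)"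
  by (simp add: gen_op_mon gen_mon.simps)

lemma gen_op_mon_full:
  assumes "count m b mod p = p - 1"
  shows "gen_op b (mon m) = vec_op (q b) (mon (m - replicate_mset (p - 1) b))"
  unfolding gen_op_mon by (subst gen_mon.simps) (simp add: assms vec_op_def gen_op_mon)

lemma size_diff_full:
  assumes "count m b mod p = p - 1"
  shows "size (m - replicate_mset (p - 1) b) < size m"
proof -
  have le: "p - 1 \<le> count m b"
    using assms by (metis mod_less_eq_dividend)
  then have "replicate_mset (p - 1) b \<subseteq># m"
    by (simp add: count_le_replicate_mset_subset_eq)
  then show ?thesis
    using p_ge_2 le count_le_size[of m b] by (simp add: size_Diff_submset)
qed

text \<open>The hypothesis concerns a single \<open>t\<close>, so that an induction hypothesis for
  smaller monomials can discharge it.\<close>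

lemma vec_op_gen_op_commute:
  assumes "\<And>k l. gen_op k (gen_op l t) = gen_op l (gen_op k t)"
  shows "vec_op u (gen_op j t) = gen_op j (vec_op u t)"
  by (simp add: vec_op_def gen_op_sum gen_op_scale assms[of _ j])

lemma vec_op_vec_op_commute:
  assumes "\<And>k l. gen_op k (gen_op l t) = gen_op l (gen_op k t)"
  shows "vec_op u (vec_op w t) = vec_op w (vec_op u t)"
proof -
  have "vec_op u (vec_op w t) = (\<Sum>j | coord w j \<noteq> 0. pm_scale (coord w j) (vec_op u (gen_op j t)))"
    by (simp add: vec_op_def[of w] vec_op_sum_right vec_op_scale_right)
  also have "\<dots> = (\<Sum>j | coord w j \<noteq> 0. pm_scale (coord w j) (gen_op j (vec_op u t)))"
    using assms by (simp add: vec_op_gen_op_commute)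
  finally show ?thesis
    by (simp add: vec_op_def[of w])
qed

text \<open>A generator whose exponent is full is replaced by its image under \<open>q\<close>
  acting on a smaller monomial, where all generators commute by induction on the size.\<close>

lemma gen_op_commute_mon: "gen_op i (gen_op j (mon m)) = gen_op j (gen_op i (mon m))"
proof (induction "size m" arbitrary: m i j rule: less_induct)
  case less
  have full_aux: "gen_op j (gen_op i (mon m)) = vec_op (q i) (gen_op j (mon (m - replicate_mset (p - 1) i)))"
    if "count m i mod p = p - 1" for i j
    unfolding gen_op_mon_full[OF that]
    by (rule vec_op_gen_op_commute[symmetric], rule less, rule size_diff_full, rule that)
  have full_nonfull: "gen_op j (gen_op i (mon m)) = gen_op i (gen_op j (mon m))"
    if i: "count m i mod p = p - 1" and j: "count m j mod p \<noteq> p - 1" for i j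
  proof -
    from i j have "i \<noteq> j" by auto
    then have "add_mset j m - replicate_mset (p - 1) i = add_mset j (m - replicate_mset (p - 1) i)"
      by (intro multiset_eqI) auto
    then have "gen_op i (gen_op j (mon m)) = vec_op (q i) (mon (add_mset j (m - replicate_mset (p - 1) i)))"
      using i \<open>i \<noteq> j\<close> by (simp add: gen_op_mon_add[OF j] gen_op_mon_full)
    also have "\<dots> = vec_op (q i) (gen_op j (mon (m - replicate_mset (p - 1) i)))"
      using j \<open>i \<noteq> j\<close> by (subst gen_op_mon_add) auto
    finally show ?thesis
      by (simp add: full_aux[OF i])
  qed
  show ?case
  proof (cases "i = j")
    case False
    consider "count m i mod p = p - 1" "count m j mod p = p - 1"
      | "count m i mod p = p - 1" "count m j mod p \<noteq> p - 1"
      | "count m i mod p \<noteq> p - 1" "count m j mod p = p - 1"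
      | "count m i mod p \<noteq> p - 1" "count m j mod p \<noteq> p - 1"
      by blast
    then show ?thesis
    proof cases
      case 1
      \<comment> \<open>Both orders reduce to the vectors \<open>q i\<close> and \<open>q j\<close>
        acting on this smaller monomial.\<close>
      let ?m = "m - replicate_mset (p - 1) i - replicate_mset (p - 1) j"
      have "?m = m - replicate_mset (p - 1) j - replicate_mset (p - 1) i"
        by (rule diff_right_commute)
      moreover have "size ?m < size m"
        using size_diff_full[OF 1(1)] size_diff_full[of "m - replicate_mset (p - 1) i" j] 1(2) False
        by simp
      moreover have "gen_op j (gen_op i (mon m)) = vec_op (q i) (vec_op (q j) (mon ?m))"
        unfolding full_aux[OF 1(1)] by (subst gen_op_mon_full) (use 1 False in simp_all)
      moreover have "gen_op i (gen_op j (mon m)) = vec_op (q j) (vec_op (q i) (mon (m - replicate_mset (p - 1) j - replicate_mset (p - 1) i)))"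
        unfolding full_aux[OF 1(2)] by (subst gen_op_mon_full) (use 1 False in simp_all)
      ultimately show ?thesis
        using vec_op_vec_op_commute[OF less, of ?m "q i" "q j"] by simp
    next
      case 2
      then show ?thesis
        using full_nonfull[of i j] by simp
    next
      case 3
      then show ?thesis
        using full_nonfull[of j i] by simp
    next
      case 4
      then show ?thesis
        using False by (simp add: gen_op_mon_add add_mset_commute)
    qed
  qed simp
qed

lemma gen_op_commute: "gen_op i (gen_op j t) = gen_op j (gen_op i t)"
proof (induction t rule: pm_span_induct)
  case subspace
  show ?case
    by (rule pm.subspaceI) (simp_all add: gen_op_add gen_op_scale)
qed (rule gen_op_commute_mon)

lemmas vec_op_gen_op = vec_op_gen_op_commute[OF gen_op_commute]
lemmas vec_op_commute = vec_op_vec_op_commute[OF gen_op_commute]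

text \<open>Monomials with all exponents divisible by \<open>p\<close> generate the module under the
  operators \<open>gen_op b\<close>, one for each direct summand; an identity compatible with these
  operators need only be checked there.\<close>

lemma mon_induct [case_names empty_class add]:
  assumes base: "\<And>m. (\<And>b. p dvd count m b) \<Longrightarrow> P (mon m)"
    and step: "\<And>b t. P t \<Longrightarrow> P (gen_op b t)"
  shows "P (mon m)"
proof (induction "size m" arbitrary: m rule: less_induct)
  case less
  show ?case
  proof (cases "\<forall>b. p dvd count m b")
    case False
    then obtain b where b: "\<not> p dvd count m b"
      by blast
    then have "b \<in># m"
      by (metis count_eq_zero_iff dvd_0_right)
    then obtain m' where m: "m = add_mset b m'"
      by (blast dest: multi_member_split)
    have "count m' b mod p \<noteq> p - 1"
    proof
      assume "count m' b mod p = p - 1"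
      then have "Suc (count m' b) mod p = 0"
        using p_ge_2 by (simp add: mod_Suc)
      with b show False
        by (simp add: m dvd_eq_mod_eq_0)
    qed
    then have "mon m = gen_op b (mon m')"
      by (simp add: m gen_op_mon_add)
    then show ?thesis
      using less[of m'] step by (simp add: m)
  qed (simp add: base)
qed

text \<open>On a monomial with exponents divisible by \<open>p\<close> the first
  \<open>p - 1\<close> applications raise the exponent of \<open>b\<close> and the last one triggers
  the reduction to \<open>q b\<close>. Commutation carries this to the whole module.\<close>

lemma gen_op_power: "(gen_op b ^^ p) t = vec_op (q b) t"
proof (induction t rule: pm_span_induct)
  case subspace
  have "(gen_op b ^^ n) (t + u) = (gen_op b ^^ n) t + (gen_op b ^^ n) u"
    "(gen_op b ^^ n) (pm_scale c t) = pm_scale c ((gen_op b ^^ n) t)" for n t u c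
    by (induction n) (simp_all add: gen_op_add gen_op_scale)
  moreover have "(gen_op b ^^ n) 0 = 0" for n
    by (induction n) simp_all
  ultimately show ?case
    by (intro pm.subspaceI) (simp_all add: vec_op_add_right vec_op_scale_right)
next
  case (single m)
  show ?case
  proof (induction rule: mon_induct)
    case (empty_class m)
    have "(gen_op b ^^ k) (mon m) = mon (m + replicate_mset k b)" if "k \<le> p - 1" for k
      using that
    proof (induction k)
      case (Suc k)
      have "count (m + replicate_mset k b) b mod p = k mod p"
        using empty_class[of b] by (auto simp: dvd_def)
      then have "count (m + replicate_mset k b) b mod p \<noteq> p - 1"
        using Suc.prems by simp
      then show ?case
        using Suc by (simp add: gen_op_mon_add)
    qed simp
    then have "(gen_op b ^^ Suc (p - 1)) (mon m) = gen_op b (mon (m + replicate_mset (p - 1) b))"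
      by simp
    also have "\<dots> = vec_op (q b) (mon m)"
    proof -
      obtain k where "count m b = p * k"
        using empty_class[of b] by (auto simp: dvd_def)
      then have "count (m + replicate_mset (p - 1) b) b mod p = (p - 1) mod p"
        by (simp only: count_union count_replicate_mset simp_thms if_True mod_mult_self4)
      then show ?thesis
        using p_ge_2 by (subst gen_op_mon_full) simp_all
    qed
    finally show ?case
      using p_ge_2 by simp
  next
    case (add c t)
    have "(gen_op b ^^ n) (gen_op c t) = gen_op c ((gen_op b ^^ n) t)" for n
      by (induction n) (simp_all add: gen_op_commute[of b c])
    then show ?case
      using add by (simp add: vec_op_gen_op)
  qed
qed

sublocale vec_rep: free_algebra_rep pm_scale vec_op
  by unfold_locales (simp_all add: vec_op_add_right vec_op_scale_right)

text \<open>Both sides are additive and Frobenius-semilinear in \<open>v\<close>, so the basis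
  vectors suffice. Additivity of the left side is the binomial congruence modulo the annihilator of
  the module.\<close>

lemma vec_op_power: "vec_op v ^^ p = vec_op (q v)"
proof -
  let ?J = "{f. \<forall>t. vec_rep.act f t \<in> {0}}"
  have J: "two_sided_ideal ?J"
    by (rule vec_rep.two_sided_ideal_annihilator) (auto simp: pm.subspace_def)
  have gen: "vec_rep.act (free_gen v) = vec_op v" for v
    by (rule ext) simp
  have dream: "((vec_op (v + w)) ^^ p) t = (vec_op v ^^ p) t + (vec_op w ^^ p) t" for v w t
  proof -
    have "(free_gen v * free_gen w - free_gen w * free_gen v) \<in> ?J"
      by (simp add: vec_rep.act_diff_left vec_rep.act_mult vec_op_commute[of v w])
    then have "(free_gen v + free_gen w) ^ p - (free_gen v ^ p + free_gen w ^ p) \<in> ?J"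
      by (rule freshmans_dream_mod_ideal[OF J _ prime_p of_nat_p])
    moreover have "vec_rep.act (free_gen v + free_gen w) = vec_op (v + w)"
      by (rule ext) (simp add: vec_rep.act_add_left vec_op_add_left)
    ultimately show ?thesis
      by (simp add: vec_rep.act_diff_left vec_rep.act_add_left vec_rep.act_power gen)
  qed
  have "(vec_op (c *s v) ^^ n) t = pm_scale (c ^ n) ((vec_op v ^^ n) t)" for c v n t
    by (induction n) (simp_all add: vec_op_scale_left vec_op_scale_right)
  moreover have "(vec_op 0 ^^ p) t = 0" for t
  proof -
    have "(vec_op 0 ^^ Suc (p - 1)) t = 0"
      by simp
    then show ?thesis
      using p_pos by simp
  qed
  ultimately have "subspace {v. vec_op v ^^ p = vec_op (q v)}"
    by (intro subspaceI) (auto simp: fun_eq_iff dream q_zero q_add q_scale vec_op_add_left vec_op_scale_left)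
  moreover have "basis \<subseteq> {v. vec_op v ^^ p = vec_op (q v)}"
    by (auto simp: vec_op_basis fun_eq_iff gen_op_power)
  ultimately have "span basis \<subseteq> {v. vec_op v ^^ p = vec_op (q v)}"
    by (intro span_minimal)
  then show ?thesis
    by (auto simp: span_basis)
qed

lemma vec_op_mon_empty: "vec_op v (mon {#}) = (\<Sum>j | coord v j \<noteq> 0. pm_scale (coord v j) (mon {#j#}))"
  using p_ge_2 by (simp add: vec_op_def gen_op_mon_add del: single_one)

text \<open>The coordinates of \<open>v\<close> are the coefficients of the one-letter
  monomials.\<close>

lemma vec_op_mon_empty_eq_0_iff: "vec_op v (mon {#}) = 0 \<longleftrightarrow> v = 0"
proof
  assume *: "vec_op v (mon {#}) = 0"
  have "coord v b = Poly_Mapping.lookup (vec_op v (mon {#})) {#b#}" for b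
    unfolding vec_op_mon_empty by (simp add: lookup_sum lookup_single when_def sum.delta)
  then have "coord v b = 0" for b
    using * by simp
  then show "v = 0"
    using sum_coord[of v] by simp
qed simp

end

subsection \<open>Twisting by derivations\<close>

text \<open>\<open>\<beta> x\<close> prescribes a derivation on the generators. It is compatible
  with b^p = \<open>q b\<close>, since \<open>\<beta>_q_right\<close> kills the right side and
  characteristic \<open>p\<close> kills the derivative of the left.
  \<open>\<beta>_\<beta>_right\<close> makes these derivations commute and have vanishing p-th
  power.\<close>

locale twisted_frobenius_space = frobenius_space scale q p
  for scale :: "'f::field \<Rightarrow> 'b::ab_group_add \<Rightarrow> 'b" (infixr \<open>*s\<close> 75) and q p +
  fixes \<beta> :: "'b \<Rightarrow> 'b \<Rightarrow> 'b"
  assumes \<beta>_add_left: "\<beta> (x + y) z = \<beta> x z + \<beta> y z"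
    and \<beta>_add_right: "\<beta> x (y + z) = \<beta> x y + \<beta> x z"
    and \<beta>_scale_left: "\<beta> (c *s x) y = c *s \<beta> x y"
    and \<beta>_scale_right: "\<beta> x (c *s y) = c *s \<beta> x y"
    and \<beta>_q_right: "\<beta> x (q y) = 0"
    and \<beta>_\<beta>_right: "\<beta> x (\<beta> y z) = 0"
begin

lemma \<beta>_zero_left [simp]: "\<beta> 0 x = 0"
  using \<beta>_add_left[of 0 0 x] by simp

lemma \<beta>_zero_right [simp]: "\<beta> x 0 = 0"
  using \<beta>_add_right[of x 0 0] by simp

lemma \<beta>_sum_right: "\<beta> x (sum g A) = (\<Sum>i\<in>A. \<beta> x (g i))"
  by (induction A rule: infinite_finite_induct) (simp_all add: \<beta>_add_right)

definition der_mon :: "'b \<Rightarrow> 'b multiset \<Rightarrow> ('b multiset \<Rightarrow>\<^sub>0 'f)" where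
  "der_mon x m = (\<Sum>c\<in>set_mset m. pm_scale (of_nat (count m c)) (vec_op (\<beta> x c) (mon (m - {#c#}))))"

definition der :: "'b \<Rightarrow> ('b multiset \<Rightarrow>\<^sub>0 'f) \<Rightarrow> ('b multiset \<Rightarrow>\<^sub>0 'f)" where
  "der x = lin_ext pm_scale (der_mon x)"

lemma der_add: "der x (t + u) = der x t + der x u"
  and der_scale: "der x (pm_scale c t) = pm_scale c (der x t)"
  by (simp_all add: der_def pm.lin_ext_add pm.lin_ext_scale)

lemma der_zero [simp]: "der x 0 = 0"
  using der_add[of x 0 0] by simp

lemma der_sum: "der x (sum g A) = (\<Sum>i\<in>A. der x (g i))"
  by (induction A rule: infinite_finite_induct) (simp_all add: der_add)

lemma der_mon_superset:
  assumes "finite K" "set_mset m \<subseteq> K"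
  shows "der x (mon m) = (\<Sum>c\<in>K. pm_scale (of_nat (count m c)) (vec_op (\<beta> x c) (mon (m - {#c#}))))"
proof -
  have "der x (mon m) = der_mon x m"
    by (simp add: der_def)
  also have "\<dots> = (\<Sum>c\<in>K. pm_scale (of_nat (count m c)) (vec_op (\<beta> x c) (mon (m - {#c#}))))"
    unfolding der_mon_def using assms
    by (intro sum.mono_neutral_left) (auto simp: not_in_iff)
  finally show ?thesis .
qed

lemma of_nat_mod_p: "of_nat (n mod p) = (of_nat n :: 'f)"
proof -
  have "(of_nat n :: 'f) = of_nat (n div p * p + n mod p)"
    by simp
  also have "\<dots> = of_nat (n mod p)"
    unfolding of_nat_add of_nat_mult by (simp add: p_eq)
  finally show ?thesis ..
qed

text \<open>Stated for a single \<open>t\<close>, because the induction that proves the generator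
  case already uses it on smaller monomials.\<close>

lemma der_gen_op_imp_vec_op:
  assumes "\<And>j. der x (gen_op j t) = gen_op j (der x t) + vec_op (\<beta> x j) t"
  shows "der x (vec_op v t) = vec_op v (der x t) + vec_op (\<beta> x v) t"
proof -
  have "der x (vec_op v t)
      = vec_op v (der x t) + (\<Sum>j | coord v j \<noteq> 0. vec_op (\<beta> x (coord v j *s j)) t)"
    by (simp add: vec_op_def[of v] der_sum der_scale assms pm.scale_right_distrib sum.distrib
        \<beta>_scale_right vec_op_scale_left)
  also have "(\<Sum>j | coord v j \<noteq> 0. vec_op (\<beta> x (coord v j *s j)) t) = vec_op (\<beta> x v) t"
    by (subst (3) sum_coord[symmetric]) (simp add: \<beta>_sum_right vec_op_sum_left)
  finally show ?thesis .
qed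

text \<open>Without reduction this is the Leibniz rule for one more factor \<open>b\<close>. With
  reduction the exponent of \<open>b\<close> equals -1 in the field, so differentiating that factor
  cancels the new term, in agreement with b^p having derivative zero.\<close>

lemma der_gen_op_mon: "der x (gen_op b (mon m)) = gen_op b (der x (mon m)) + vec_op (\<beta> x b) (mon m)"
proof (induction "size m" arbitrary: m b rule: less_induct)
  case less
  let ?K = "insert b (set_mset m)"
  let ?c = "\<lambda>m c. of_nat (count m c) :: 'f"
  have K: "finite ?K" "set_mset m \<subseteq> ?K" "b \<in> ?K"
    by auto
  have expand: "gen_op b (der x (mon m))
      = (\<Sum>c\<in>?K. pm_scale (?c m c) (vec_op (\<beta> x c) (gen_op b (mon (m - {#c#})))))"
    by (subst der_mon_superset[OF K(1,2)]) (simp add: gen_op_sum gen_op_scale vec_op_gen_op)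
  show ?case
  proof (cases "count m b mod p = p - 1")
    case False
    have "der x (gen_op b (mon m)) = der x (mon (add_mset b m))"
      using False by (simp add: gen_op_mon_add)
    also have "\<dots> = (\<Sum>c\<in>?K. pm_scale (?c (add_mset b m) c) (vec_op (\<beta> x c) (mon (add_mset b m - {#c#}))))"
      by (rule der_mon_superset) auto
    also have "\<dots> = (\<Sum>c\<in>?K. pm_scale (?c m c) (vec_op (\<beta> x c) (gen_op b (mon (m - {#c#}))))
        + (if c = b then vec_op (\<beta> x b) (mon m) else 0))"
    proof (rule sum.cong)
      fix c assume "c \<in> ?K"
      have "pm_scale (?c m c) (vec_op (\<beta> x c) (mon (add_mset b m - {#c#})))
          = pm_scale (?c m c) (vec_op (\<beta> x c) (gen_op b (mon (m - {#c#}))))"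
      proof (cases "?c m c = 0")
        case nz: False
        then have c: "c \<in># m"
          by (metis not_in_iff of_nat_0)
        \<comment> \<open>Removing \<open>c = b\<close> could make the exponent of \<open>b\<close>
          full only if it was divisible by \<open>p\<close>, and then the coefficient would
          vanish.\<close>
        have "count (m - {#c#}) b mod p \<noteq> p - 1"
        proof (cases "c = b")
          case True
          then have "\<not> p dvd count m b"
            using nz by (auto simp: p_eq of_nat_eq_0_iff_char_dvd)
          then have "count m b mod p \<noteq> 0"
            by (simp add: dvd_eq_mod_eq_0)
          moreover obtain k where k: "count m b = Suc k"
            using c True count_greater_zero_iff[of m b] by (cases "count m b") auto
          ultimately have "k mod p \<noteq> p - 1"
            using p_ge_2 by (auto simp: mod_Suc split: if_splits)
          then show ?thesis
            using True k by simp
        qed (use False in simp)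
        then have "gen_op b (mon (m - {#c#})) = mon (add_mset b (m - {#c#}))"
          by (rule gen_op_mon_add)
        moreover have "add_mset b (m - {#c#}) = add_mset b m - {#c#}"
          using c by (simp add: add_mset_diff_bothsides[symmetric] insert_DiffM2)
        ultimately show ?thesis
          by simp
      qed simp
      then show "pm_scale (?c (add_mset b m) c) (vec_op (\<beta> x c) (mon (add_mset b m - {#c#})))
          = pm_scale (?c m c) (vec_op (\<beta> x c) (gen_op b (mon (m - {#c#}))))
            + (if c = b then vec_op (\<beta> x b) (mon m) else 0)"
        by (auto simp: pm.scale_left_distrib)
    qed simp
    also have "\<dots> = gen_op b (der x (mon m)) + vec_op (\<beta> x b) (mon m)"
      using K unfolding expand by (simp add: sum.distrib sum.delta)
    finally show ?thesis .
  next
    case True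
    let ?r = "replicate_mset (p - 1) b"
    let ?m = "m - ?r"
    have le: "p - 1 \<le> count m b"
      using True by (metis mod_less_eq_dividend)
    have "der x (gen_op b (mon m)) = der x (vec_op (q b) (mon ?m))"
      using True by (simp add: gen_op_mon_full)
    also have "\<dots> = vec_op (q b) (der x (mon ?m))"
      using less[OF size_diff_full[OF True]] by (subst der_gen_op_imp_vec_op) (simp_all add: \<beta>_q_right)
    also have "\<dots> = (\<Sum>c\<in>?K. pm_scale (?c ?m c) (vec_op (q b) (vec_op (\<beta> x c) (mon (?m - {#c#})))))"
      by (subst der_mon_superset[OF K(1)]) (auto simp: vec_op_sum_right vec_op_scale_right dest: in_diffD)
    also have "\<dots> = (\<Sum>c\<in>?K. pm_scale (?c m c) (vec_op (\<beta> x c) (gen_op b (mon (m - {#c#}))))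
        + (if c = b then vec_op (\<beta> x b) (mon m) else 0))"
    proof (rule sum.cong)
      fix c assume "c \<in> ?K"
      show "pm_scale (?c ?m c) (vec_op (q b) (vec_op (\<beta> x c) (mon (?m - {#c#}))))
        = pm_scale (?c m c) (vec_op (\<beta> x c) (gen_op b (mon (m - {#c#}))))
            + (if c = b then vec_op (\<beta> x b) (mon m) else 0)"
      proof (cases "c = b")
        case c: True
        have "of_nat (count m b) = (of_nat (p - 1) :: 'f)"
          using of_nat_mod_p[of "count m b"] True by simp
        then have m1: "?c m b = - 1"
          using p_ge_2 of_nat_CHAR[where 'a = 'f] by (simp add: of_nat_diff p_eq)
        have m0: "?c ?m b = 0"
          using m1 le p_ge_2 of_nat_CHAR[where 'a = 'f] by (simp add: of_nat_diff p_eq)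
        have "count (m - {#b#}) b mod p \<noteq> p - 1"
        proof
          assume "count (m - {#b#}) b mod p = p - 1"
          moreover obtain k where "count m b = Suc k"
            using le p_ge_2 by (cases "count m b") auto
          ultimately have "count m b mod p = 0"
            using p_ge_2 by (simp add: mod_Suc)
          with True show False
            using p_ge_2 by simp
        qed
        then have "gen_op b (mon (m - {#b#})) = mon m"
          using le p_ge_2 by (subst gen_op_mon_add) (auto intro!: insert_DiffM simp flip: count_greater_zero_iff)
        then show ?thesis
          unfolding c m1 m0 by simp
      next
        case c: False
        then have "gen_op b (mon (m - {#c#})) = vec_op (q b) (mon (?m - {#c#}))"
          using True by (simp add: gen_op_mon_full diff_right_commute)
        then show ?thesis
          using c by (simp add: vec_op_commute)
      qed
    qed simp
    also have "\<dots> = gen_op b (der x (mon m)) + vec_op (\<beta> x b) (mon m)"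
      using K unfolding expand by (simp add: sum.distrib sum.delta)
    finally show ?thesis .
  qed
qed

lemma der_gen_op: "der x (gen_op b t) = gen_op b (der x t) + vec_op (\<beta> x b) t"
proof (induction t rule: pm_span_induct)
  case subspace
  show ?case
    by (rule pm.subspaceI)
      (simp_all add: der_add der_scale gen_op_add gen_op_scale vec_op_add_right vec_op_scale_right pm.scale_right_distrib)
qed (rule der_gen_op_mon)

lemma der_vec_op: "der x (vec_op v t) = vec_op v (der x t) + vec_op (\<beta> x v) t"
  by (rule der_gen_op_imp_vec_op) (rule der_gen_op)

lemma der_mon_dvd:
  assumes "\<And>b. p dvd count m b"
  shows "der x (mon m) = 0"
proof -
  have "(of_nat (count m c) :: 'f) = 0" for c
    using assms[of c] by (simp add: p_eq of_nat_eq_0_iff_char_dvd)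
  then show ?thesis
    by (simp add: der_mon_superset[of "set_mset m"])
qed

text \<open>Applied to a product with \<open>b\<close>, the two derivations give an expression
  symmetric in \<open>x\<close> and \<open>y\<close>, apart from the term with
  \<open>\<beta> x (\<beta> y b)\<close>, which is zero.\<close>

lemma der_commute: "der x (der y t) = der y (der x t)"
proof (induction t rule: pm_span_induct)
  case subspace
  show ?case
    by (rule pm.subspaceI) (simp_all add: der_add der_scale)
next
  case (single m)
  show ?case
    by (induction rule: mon_induct) (simp_all add: der_mon_dvd der_gen_op der_vec_op der_add \<beta>_\<beta>_right algebra_simps)
qed

lemma der_funpow_add: "(der x ^^ n) (t + u) = (der x ^^ n) t + (der x ^^ n) u"
  and der_funpow_scale: "(der x ^^ n) (pm_scale c t) = pm_scale c ((der x ^^ n) t)"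
  and der_funpow_zero: "(der x ^^ n) 0 = 0"
  by (induction n) (simp_all add: der_add der_scale)

text \<open>Since \<open>der x\<close> commutes with the vectors \<open>\<beta> x b\<close>, the
  iterated Leibniz rule for a factor \<open>b\<close> has only two terms, and after \<open>p\<close>
  steps the coefficient of the second is \<open>p\<close>.\<close>

lemma der_power_p: "(der x ^^ p) t = 0"
proof (induction t rule: pm_span_induct)
  case subspace
  show ?case
    by (rule pm.subspaceI) (simp_all add: der_funpow_add der_funpow_scale der_funpow_zero)
next
  case (single m)
  have leibniz: "(der x ^^ Suc n) (gen_op b t)
      = gen_op b ((der x ^^ Suc n) t) + pm_scale (of_nat (Suc n)) (vec_op (\<beta> x b) ((der x ^^ n) t))" for n b t
  proof (induction n)
    case (Suc n)
    let ?V = "vec_op (\<beta> x b) ((der x ^^ Suc n) t)"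
    have "(der x ^^ Suc (Suc n)) (gen_op b t)
        = der x (gen_op b ((der x ^^ Suc n) t) + pm_scale (of_nat (Suc n)) (vec_op (\<beta> x b) ((der x ^^ n) t)))"
      by (simp only: funpow.simps(2)[of "Suc n"] comp_apply Suc)
    also have "\<dots> = gen_op b ((der x ^^ Suc (Suc n)) t) + (?V + pm_scale (of_nat (Suc n)) ?V)"
      by (simp add: der_add der_gen_op der_scale der_vec_op \<beta>_\<beta>_right del: of_nat_Suc)
    also have "?V + pm_scale (of_nat (Suc n)) ?V = pm_scale (of_nat (Suc (Suc n))) ?V"
      by (simp only: of_nat_Suc[of "Suc n"] pm.scale_left_distrib pm.scale_one)
    finally show ?case .
  qed (simp add: der_gen_op)
  obtain n where n: "p = Suc n"
    using p_pos by (cases p) auto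
  have zero: "of_nat (Suc n) = (0 :: 'f)"
    unfolding n[symmetric] p_eq by simp
  show ?case
  proof (induction rule: mon_induct)
    case (empty_class m)
    then have "(der x ^^ Suc (p - 1)) (mon m) = (der x ^^ (p - 1)) 0"
      by (simp only: funpow_Suc_right comp_apply der_mon_dvd)
    then show ?case
      using p_pos by (simp add: der_funpow_zero)
  next
    case (add b t)
    have "(der x ^^ Suc n) (gen_op b t) = gen_op b ((der x ^^ Suc n) t)"
      unfolding leibniz zero by simp
    then show ?case
      using add unfolding n[symmetric] by simp
  qed
qed

lemma der_add_left: "der (x + y) t = der x t + der y t"
proof (induction t rule: pm_span_induct)
  case subspace
  show ?case
    by (rule pm.subspaceI) (simp_all add: der_add der_scale pm.scale_right_distrib)
next
  case (single m)
  show ?case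
    by (simp add: der_mon_superset[of "set_mset m"] \<beta>_add_left vec_op_add_left pm.scale_right_distrib sum.distrib)
qed

lemma der_scale_left: "der (c *s x) t = pm_scale c (der x t)"
proof (induction t rule: pm_span_induct)
  case subspace
  show ?case
    by (rule pm.subspaceI) (simp_all add: der_add der_scale pm.scale_right_distrib mult.commute)
next
  case (single m)
  show ?case
    by (simp add: der_mon_superset[of "set_mset m"] \<beta>_scale_left vec_op_scale_left pm.scale_sum_right mult.commute)
qed

lemma der_eq_0:
  assumes "\<And>y. \<beta> x y = 0"
  shows "der x t = 0"
proof (induction t rule: pm_span_induct)
  case subspace
  show ?case
    by (rule pm.subspaceI) (simp_all add: der_add der_scale)
next
  case (single m)
  show ?case
    by (simp add: der_mon_superset[of "set_mset m"] assms)
qed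

definition tw_op :: "'b \<Rightarrow> ('b multiset \<Rightarrow>\<^sub>0 'f) \<Rightarrow> ('b multiset \<Rightarrow>\<^sub>0 'f)" where
  "tw_op x t = vec_op x t + der x t"

lemma tw_op_add_left: "tw_op (x + y) t = tw_op x t + tw_op y t"
  by (simp add: tw_op_def vec_op_add_left der_add_left)

lemma tw_op_scale_left: "tw_op (c *s x) t = pm_scale c (tw_op x t)"
  by (simp add: tw_op_def vec_op_scale_left der_scale_left pm.scale_right_distrib)

text \<open>Only the cross terms survive: operators of the same kind commute, and the derivation of
  \<open>x\<close> turns the vector \<open>y\<close> into \<open>\<beta> x y\<close>.\<close>

lemma tw_op_commutator:
  "tw_op x (tw_op y t) - tw_op y (tw_op x t) = vec_op (\<beta> x y - \<beta> y x) t"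
  by (simp add: tw_op_def vec_op_add_right der_add der_vec_op vec_op_commute[of x y] der_commute[of x y]
      vec_op_diff_left)

lemma tw_op_mon_empty: "tw_op x (mon {#}) = vec_op x (mon {#})"
  by (simp add: tw_op_def der_mon_dvd del: single_one)

sublocale tw_rep: free_algebra_rep pm_scale tw_op
  by unfold_locales
    (simp_all add: tw_op_def vec_op_add_right vec_op_scale_right der_add der_scale pm.scale_right_distrib)

text \<open>
  When \<open>\<beta> x x = 0\<close> the operators \<^term>\<open>vec_op x\<close> and \<^term>\<open>der x\<close> commute; the free algebra on
  \<^typ>\<open>bool\<close> acts through them, which makes the binomial formula available.
\<close>

lemma tw_op_power_alternating:
  assumes "\<beta> x x = 0"
  shows "(tw_op x ^^ p) t = vec_op (q x) t"
proof -
  let ?\<rho> = "\<lambda>b. if b then vec_op x else der x"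
  interpret R: free_algebra_rep pm_scale ?\<rho>
    by unfold_locales
      (simp_all add: vec_op_add_right vec_op_scale_right der_add der_scale)
  let ?J = "{f. \<forall>t. R.act f t \<in> {0}}"
  have J: "two_sided_ideal ?J"
    by (rule R.two_sided_ideal_annihilator) (auto simp: pm.subspace_def)
  have gen: "R.act (free_gen b) = ?\<rho> b" for b
    by (rule ext) simp
  have "free_gen True * free_gen False - free_gen False * free_gen True \<in> ?J"
    by (simp add: R.act_diff_left R.act_mult der_vec_op assms)
  then have "(free_gen True + free_gen False) ^ p - (free_gen True ^ p + free_gen False ^ p) \<in> ?J"
    by (rule freshmans_dream_mod_ideal[OF J _ prime_p of_nat_p])
  moreover have "R.act (free_gen True + free_gen False) = tw_op x"
    by (rule ext) (simp add: R.act_add_left tw_op_def)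
  ultimately show ?thesis
    by (simp add: R.act_diff_left R.act_add_left R.act_power gen vec_op_power der_power_p)
qed

text \<open>Here \<open>vec_op x\<close> and \<open>der x\<close> need not commute. Squaring their
  sum gives the mixed product twice, which cancels, plus the commutator, which contributes
  \<open>\<beta> x x\<close>.\<close>

lemma tw_op_power_char_2:
  assumes "p = 2"
  shows "(tw_op x ^^ p) t = vec_op (q x + \<beta> x x) t"
proof -
  have sq: "(f ^^ p) u = f (f u)" for f and u :: "'b multiset \<Rightarrow>\<^sub>0 'f"
    using assms by (simp add: numeral_2_eq_2)
  have "vec_op x (vec_op x t) = vec_op (q x) t" "der x (der x t) = 0"
    using fun_cong[OF vec_op_power[of x], of t] der_power_p[of x t] by (simp_all add: sq)
  moreover have "u + u = 0" for u :: "'b multiset \<Rightarrow>\<^sub>0 'f"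
  proof -
    have "(1 + 1 :: 'f) = of_nat p"
      by (simp add: assms)
    also have "\<dots> = 0"
      by (simp add: p_eq)
    finally show ?thesis
      using pm.scale_left_distrib[of "1 :: 'f" 1 u] by simp
  qed
  then have "vec_op x (der x t) + (vec_op x (der x t) + u) = u" for u
    by (simp flip: add.assoc)
  ultimately show ?thesis
    unfolding sq by (simp add: tw_op_def vec_op_add_right der_add der_vec_op vec_op_add_left ac_simps)
qed

end

subsection \<open>Commutative restricted enveloping algebras come from abelian Lie algebras\<close>

lemma (in vector_space) span_induct2:
  assumes "span B = UNIV" and "\<And>x. subspace {y. P x y}" and "\<And>y. subspace {x. P x y}"
    and "\<And>i j. i \<in> B \<Longrightarrow> j \<in> B \<Longrightarrow> P i j"
  shows "P x y"
proof -
  have "P i y" if "i \<in> B" for i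
    using span_minimal[of B "{y. P i y}"] assms that by blast
  then show ?thesis
    using span_minimal[of B "{x. P x y}"] assms by blast
qed

context lie_algebra
begin

lemma bracket_zero_left [simp]: "bracket 0 x = 0"
  using bracket_add_left[of 0 0 x] by simp

lemma bracket_zero_right [simp]: "bracket x 0 = 0"
  using bracket_add_right[of x 0 0] by simp

lemma bracket_swap: "bracket x y = - bracket y x"
proof -
  have "bracket x y + bracket y x = 0"
    using bracket_self[of "x + y"] unfolding bracket_add_left bracket_add_right by (simp add: bracket_self add.commute)
  then show ?thesis
    by (simp add: eq_neg_iff_add_eq_0)
qed

text \<open>The Jacobi identity in the form that the adjoint action is a representation.\<close>

lemma bracket_bracket: "bracket (bracket x y) t = bracket x (bracket y t) - bracket y (bracket x t)"
proof -
  have 1: "bracket y (bracket t x) = - bracket y (bracket x t)"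
    using bracket_scale_right[of y "-1" "bracket x t"] by (subst bracket_swap) simp
  have 2: "bracket t (bracket x y) = - bracket (bracket x y) t"
    by (rule bracket_swap)
  show ?thesis
    using jacobi[of x y t] unfolding 1 2 by simp
qed

definition centre :: "'a set" where
  "centre = {z. \<forall>y. bracket z y = 0}"

lemma subspace_centre: "subspace centre"
  by (rule subspaceI) (simp_all add: centre_def bracket_add_left bracket_scale_left)

lemma bracket_centre_right: "z \<in> centre \<Longrightarrow> bracket y z = 0"
  using bracket_swap[of y z] by (simp add: centre_def)

text \<open>A bilinear form whose antisymmetrization is the bracket. Central values together with
  vanishing on the centre give \<open>\<beta> x (\<beta> y z) = 0\<close>, and also
  \<open>\<beta> x (q y) = 0\<close> once \<open>q\<close> has central values.\<close>

definition polarizes_bracket :: "('a \<Rightarrow> 'a \<Rightarrow> 'a) \<Rightarrow> bool" where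
  "polarizes_bracket \<beta> \<longleftrightarrow>
     (\<forall>x y z. \<beta> (x + y) z = \<beta> x z + \<beta> y z) \<and> (\<forall>x y z. \<beta> x (y + z) = \<beta> x y + \<beta> x z)
     \<and> (\<forall>c x y. \<beta> (c *s x) y = c *s \<beta> x y) \<and> (\<forall>c x y. \<beta> x (c *s y) = c *s \<beta> x y)
     \<and> (\<forall>x y. \<beta> x y - \<beta> y x = bracket x y) \<and> (\<forall>x y. \<beta> x y \<in> centre)
     \<and> (\<forall>z y. z \<in> centre \<longrightarrow> \<beta> z y = 0 \<and> \<beta> y z = 0)"

text \<open>
  In characteristic 2 the alternating bracket cannot be halved; instead its strictly lower triangular
  part with respect to an ordered basis adapted to the centre is used.
\<close>

lemma ex_polarizes_bracket:
  assumes class2: "\<And>x y. bracket x y \<in> centre"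
  shows "\<exists>\<beta>. polarizes_bracket \<beta>"
proof -
  obtain C where C: "C \<subseteq> centre" "independent C" "centre \<subseteq> span C"
    using maximal_independent_subset[of centre] by blast
  define B where "B = extend_basis C"
  have B: "independent B" "span B = UNIV" "C \<subseteq> B"
    using C by (simp_all add: B_def independent_extend_basis extend_basis_superset)
  obtain r where r: "well_order_on B r"
    using well_order_on by blast
  then have total: "total_on B r" and antisym: "antisym r"
    by (auto simp: well_order_on_def linear_order_on_def partial_order_on_def)
  interpret vp: vector_space_pair scale scale ..
  define \<gamma> where "\<gamma> i j = (if (j, i) \<in> r \<and> i \<noteq> j then bracket i j else 0)" for i j
  define \<beta> where "\<beta> x y = vp.construct B (\<lambda>i. vp.construct B (\<gamma> i) y) x" for x y
  note lin = vp.linear_construct[OF B(1), unfolded Vector_Spaces.linear_iff]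
  have left: "\<beta> (x + y) z = \<beta> x z + \<beta> y z" "\<beta> (c *s x) y = c *s \<beta> x y" for x y z c
    using lin by (simp_all add: \<beta>_def)
  have right: "\<beta> x (y + z) = \<beta> x y + \<beta> x z" "\<beta> x (c *s y) = c *s \<beta> x y" for x y z c
    using lin by (simp_all add: \<beta>_def vp.construct_add[OF B(1)] vp.construct_scale[OF B(1)])
  have basis: "\<beta> i j = \<gamma> i j" if "i \<in> B" "j \<in> B" for i j
    using that by (simp add: \<beta>_def vp.construct_basis[OF B(1)])
  have zero: "\<beta> 0 x = 0" "\<beta> x 0 = 0" for x
    using left(1)[of 0 0 x] right(1)[of x 0 0] by simp_all
  define \<delta> where "\<delta> x y = \<beta> x y - \<beta> y x" for x y
  have \<delta>: "\<delta> (x + y) z = \<delta> x z + \<delta> y z" "\<delta> x (y + z) = \<delta> x y + \<delta> x z"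
    "\<delta> (c *s x) y = c *s \<delta> x y" "\<delta> x (c *s y) = c *s \<delta> x y" "\<delta> 0 x = 0" "\<delta> x 0 = 0" for x y z c
    by (simp_all add: \<delta>_def left right zero scale_right_diff_distrib)
  have \<delta>_eq: "\<delta> x y = bracket x y" for x y
  proof (rule span_induct2[OF B(2), of "\<lambda>x y. \<delta> x y = bracket x y"])
    fix i j assume ij: "i \<in> B" "j \<in> B"
    \<comment> \<open>The order decides which of the two entries carries the bracket; the other one
      is zero, and antisymmetry supplies the sign.\<close>
    consider "i = j" | "i \<noteq> j" "(i, j) \<in> r" "(j, i) \<notin> r" | "i \<noteq> j" "(j, i) \<in> r" "(i, j) \<notin> r"
      using total antisym ij by (auto simp: total_on_def antisym_def)
    then show "\<delta> i j = bracket i j"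
      using bracket_swap[of i j] by cases (simp_all add: basis ij \<gamma>_def \<delta>_def bracket_self)
  next
    show "subspace {y. \<delta> x y = bracket x y}" for x
      by (rule subspaceI) (simp_all add: \<delta> bracket_add_right bracket_scale_right)
    show "subspace {x. \<delta> x y = bracket x y}" for y
      by (rule subspaceI) (simp_all add: \<delta> bracket_add_left bracket_scale_left)
  qed
  then have diff: "\<beta> x y - \<beta> y x = bracket x y" for x y
    by (simp add: \<delta>_def)
  have central: "\<beta> x y \<in> centre" for x y
  proof (rule span_induct2[OF B(2), of "\<lambda>x y. \<beta> x y \<in> centre"])
    show "\<beta> i j \<in> centre" if "i \<in> B" "j \<in> B" for i j
      using that class2[of i j] by (simp add: basis \<gamma>_def subspace_0[OF subspace_centre])
    show "subspace {y. \<beta> x y \<in> centre}" for x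
      by (rule subspaceI) (auto simp: right zero intro: subspace_0[OF subspace_centre] subspace_add[OF subspace_centre] subspace_scale[OF subspace_centre])
    show "subspace {x. \<beta> x y \<in> centre}" for y
      by (rule subspaceI) (auto simp: left zero intro: subspace_0[OF subspace_centre] subspace_add[OF subspace_centre] subspace_scale[OF subspace_centre])
  qed
  have "\<beta> z y = 0 \<and> \<beta> y z = 0" if "z \<in> centre" for z y
  proof -
    have *: "\<beta> c y = 0 \<and> \<beta> y c = 0" if "c \<in> C" for c y
    proof -
      have c: "c \<in> B" "c \<in> centre"
        using that subsetD[OF B(3)] subsetD[OF C(1)] by simp_all
      have "B \<subseteq> {y. \<beta> c y = 0 \<and> \<beta> y c = 0}"
      proof (rule subsetI)
        fix j assume j: "j \<in> B"
        have "bracket c j = 0" "bracket j c = 0"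
          using bracket_centre_right[OF c(2)] c(2) by (simp_all add: centre_def)
        then show "j \<in> {y. \<beta> c y = 0 \<and> \<beta> y c = 0}"
          by (simp add: basis j c(1) \<gamma>_def)
      qed
      moreover have "subspace {y. \<beta> c y = 0 \<and> \<beta> y c = 0}"
        by (rule subspaceI) (auto simp: left right zero)
      ultimately have "span B \<subseteq> {y. \<beta> c y = 0 \<and> \<beta> y c = 0}"
        by (rule span_minimal)
      then have "y \<in> {y. \<beta> c y = 0 \<and> \<beta> y c = 0}"
        unfolding B(2) by (rule subsetD) (rule UNIV_I)
      then show ?thesis by simp
    qed
    have "span C \<subseteq> {z. \<beta> z y = 0 \<and> \<beta> y z = 0}"
      using * by (intro span_minimal subspaceI) (auto simp: left right zero)
    then show ?thesis
      using subsetD[OF C(3) that] by (auto dest: subsetD)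
  qed
  with left right diff central have "polarizes_bracket \<beta>"
    by (simp add: polarizes_bracket_def)
  then show ?thesis by blast
qed

end

section \<open>Injectivity of H -> u(H) in nilpotency class two\<close>

context restricted_lie_algebra
begin

abbreviation env_ideal :: "('a free_word \<Rightarrow>\<^sub>0 'f) set" where
  "env_ideal \<equiv> enveloping_ideal scale bracket pmap"

lemma prime_CHAR: "prime CHAR('f)"
  using char_pos by (rule prime_CHAR_semidom)

text \<open>The first application of ad (t x + y) to x leaves the constant [y, x] and the second
  kills it. With \<open>p - 1\<close> applications only \<open>p = 2\<close> contributes.\<close>

lemma sum_jacobson_class2:
  assumes class2: "\<And>x y z. bracket x (bracket y z) = 0"
  shows "(\<Sum>i = 1..CHAR('f) - 1. jacobson_poly scale bracket i x y) = (if CHAR('f) = 2 then bracket y x else 0)"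
proof -
  have ad1: "ad_linear bracket x y [:x:] = [:bracket y x:]"
    by (simp add: ad_linear_def map_poly_pCons bracket_self)
  have ad0: "ad_linear bracket x y 0 = 0"
    by (simp add: ad_linear_def)
  have ad2: "(ad_linear bracket x y ^^ Suc (Suc n)) [:x:] = 0" for n
  proof (induction n)
    case 0
    show ?case
      by (simp add: ad1) (simp add: ad_linear_def map_poly_pCons class2)
  qed (simp add: ad0)
  show ?thesis
  proof (cases "CHAR('f) = 2")
    case True
    then show ?thesis
      by (simp add: jacobson_poly_def ad1)
  next
    case False
    then obtain n where "CHAR('f) - 1 = Suc (Suc n)"
      using prime_ge_2_nat[OF prime_CHAR] by (metis Suc_diff_Suc diff_Suc_1 le_neq_implies_less less_imp_Suc_add plus_1_eq_Suc add_2_eq_Suc numeral_2_eq_2 Suc_1)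
    then have "jacobson_poly scale bracket i x y = 0" for i
      by (simp add: jacobson_poly_def ad2 del: funpow.simps)
    then show ?thesis
      using False by simp
  qed
qed

text \<open>A special case of the Poincare-Birkhoff-Witt theorem: a generator in the ideal acts as
  zero on every module, but on the empty monomial of the twisted module \<open>v\<close> acts by its
  coordinates.\<close>

lemma free_gen_mem_enveloping_ideal_class2:
  assumes class2: "\<And>x y z. bracket x (bracket y z) = 0"
    and v: "free_gen v \<in> env_ideal"
  shows "v = 0"
proof -
  let ?p = "CHAR('f)"
  have p2: "?p \<ge> 2"
    using prime_CHAR by (rule prime_ge_2_nat)
  have bracket_centre: "bracket x y \<in> centre" for x y
    using bracket_swap[of "bracket x y"] class2 by (simp add: centre_def)
  have pmap_centre: "pmap x \<in> centre" for x
  proof -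
    \<comment> \<open>Since \<open>p \<ge> 2\<close>, the p-th power of the adjoint action contains
      a double bracket, which vanishes in class two.\<close>
    have "(bracket x ^^ ?p) y = (bracket x ^^ Suc (Suc (?p - 2))) y" for y
      using p2 by (simp flip: Suc_diff_le add: numeral_2_eq_2)
    then show ?thesis
      by (simp add: centre_def bracket_pmap class2)
  qed
  have "\<exists>\<beta>. polarizes_bracket \<beta> \<and> (?p \<noteq> 2 \<longrightarrow> (\<forall>x. \<beta> x x = 0))"
  proof (cases "?p = 2")
    case True
    then show ?thesis
      using ex_polarizes_bracket[OF bracket_centre] by simp
  next
    case False
    have two: "(2 :: 'f) \<noteq> 0"
    proof
      assume "(2 :: 'f) = 0"
      then have "?p dvd 2"
        by (metis of_nat_eq_0_iff_char_dvd of_nat_numeral)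
      with False p2 show False
        by (auto dest: dvd_imp_le)
    qed
    have half: "inverse 2 *s z + inverse 2 *s z = z" for z
      using two by (simp flip: scale_left_distrib)
    have "inverse 2 *s bracket x y - inverse 2 *s bracket y x = bracket x y" for x y
      using half[of "bracket x y"] bracket_swap[of y x] by simp
    moreover have "bracket z y = 0" "bracket y z = 0" if "z \<in> centre" for z y
      using bracket_centre_right[OF that] that by (simp_all add: centre_def)
    moreover have "inverse 2 *s bracket x y \<in> centre" for x y
      by (intro subspace_scale subspace_centre bracket_centre)
    ultimately show ?thesis
      by (intro exI[of _ "\<lambda>x y. inverse 2 *s bracket x y"])
        (simp add: polarizes_bracket_def bracket_add_left bracket_add_right bracket_scale_left bracket_scale_right bracket_self
          scale_right_distrib mult.commute)
  qed
  then obtain \<beta> where pol: "polarizes_bracket \<beta>" and alt: "?p \<noteq> 2 \<Longrightarrow> \<beta> x x = 0" for x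
    by blast
  have bil: "\<beta> (x + y) z = \<beta> x z + \<beta> y z" "\<beta> x (y + z) = \<beta> x y + \<beta> x z"
      "\<beta> (c *s x) y = c *s \<beta> x y" "\<beta> x (c *s y) = c *s \<beta> x y"
    and diff: "\<beta> x y - \<beta> y x = bracket x y" and range: "\<beta> x y \<in> centre"
    and centre: "z \<in> centre \<Longrightarrow> \<beta> z y = 0" "z \<in> centre \<Longrightarrow> \<beta> y z = 0" for x y z c
    using pol by (simp_all add: polarizes_bracket_def)
  \<comment> \<open>Subtracting \<open>\<beta> x x\<close> makes the p-map additive: in
    characteristic 2 the cross terms of this quadratic form add up to [y, x], which is Jacobson's
    term, and for odd \<open>p\<close> the form is zero.\<close>
  define q where "q x = pmap x - \<beta> x x" for x
  have q_centre: "q x \<in> centre" for x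
    unfolding q_def by (intro subspace_diff subspace_centre pmap_centre range)
  have pmap_additive: "pmap (x + y) = pmap x + pmap y + (if ?p = 2 then bracket y x else 0)" for x y
    unfolding pmap_add sum_jacobson_class2[OF class2] ..
  have q_add: "q (x + y) = q x + q y" for x y
  proof (cases "?p = 2")
    case True
    have "z + z = 0" for z :: 'a
    proof -
      have "(1 + 1 :: 'f) = of_nat ?p"
        by (simp only: True) simp
      then show ?thesis
        using scale_left_distrib[of 1 1 z] by simp
    qed
    then have "bracket y x = \<beta> y x + \<beta> x y"
      using diff[of y x] by (simp add: diff_eq_eq add.assoc)
    then show ?thesis
      by (simp add: q_def pmap_additive True bil)
  next
    case False
    then show ?thesis
      by (simp add: q_def pmap_additive alt)
  qed
  have q_scale: "q (c *s x) = c ^ ?p *s q x" for c x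
  proof (cases "?p = 2")
    case True
    then show ?thesis
      by (simp add: q_def pmap_scale bil scale_right_diff_distrib power2_eq_square)
  next
    case False
    then show ?thesis
      by (simp add: q_def pmap_scale alt)
  qed
  interpret tw: twisted_frobenius_space scale q ?p \<beta>
    by unfold_locales (simp_all add: q_add q_scale bil char_pos centre q_centre range)
  \<comment> \<open>Central elements act through \<open>vec_op\<close> alone; this turns the
    commutator and power formulas into the relations of \<open>u(H)\<close>.\<close>
  have der0: "tw.der z t = 0" if "z \<in> centre" for z t
    by (rule tw.der_eq_0) (rule centre(1)[OF that])
  have power: "(tw.tw_op x ^^ ?p) t = tw.vec_op (pmap x) t" for x t
  proof (cases "?p = 2")
    case True
    then show ?thesis
      using tw.tw_op_power_char_2[of x t] by (simp add: q_def)
  next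
    case False
    then show ?thesis
      using tw.tw_op_power_alternating[of x t] by (simp add: q_def alt)
  qed
  have "tw.tw_rep.act (free_gen v) (tw.mon {#}) \<in> {0}"
  proof (rule act_enveloping_ideal[OF tw.tw_rep.free_algebra_rep_axioms _ _ _ _ _ _ v])
    show "tw.tw_op (bracket x y) t - (tw.tw_op x (tw.tw_op y t) - tw.tw_op y (tw.tw_op x t)) \<in> {0}" for x y t
      unfolding tw.tw_op_commutator diff by (simp add: tw.tw_op_def der0 bracket_centre)
    show "tw.tw_op (pmap x) t - (tw.tw_op x ^^ ?p) t \<in> {0}" for x t
      by (simp add: power tw.tw_op_def der0 pmap_centre)
    show "tw.tw_op x t \<in> {0}" if "t \<in> {0}" for x t
      using that by (simp add: tw.tw_op_def)
  qed (simp_all add: tw.tw_op_add_left tw.tw_op_scale_left)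
  then show "v = 0"
    by (simp add: tw.tw_op_mon_empty tw.vec_op_mon_empty_eq_0_iff del: single_one)
qed

text \<open>Commutativity is used twice: in the adjoint representation it gives class two, and then
  it puts the generator of \<open>bracket x y\<close> into the ideal, where injectivity
  applies.\<close>

lemma abelian_if_commutative_enveloping:
  assumes comm: "\<And>f g. f * g - g * f \<in> env_ideal"
  shows "abelian_bracket bracket"
proof -
  interpret ad: free_algebra_rep scale bracket
    by unfold_locales (simp_all add: bracket_add_right bracket_scale_right)
  have ad: "ad.act f t \<in> {0}" if "f \<in> env_ideal" for f t
    by (rule act_enveloping_ideal[OF ad.free_algebra_rep_axioms _ _ _ _ _ _ that])
      (auto simp: bracket_add_left bracket_scale_left bracket_bracket bracket_pmap)
  have "bracket (bracket x y) z = 0" for x y z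
    using ad[OF comm[of "free_gen x" "free_gen y"], of z]
    by (simp add: bracket_bracket ad.act_diff_left ad.act_mult)
  then have class2: "bracket z (bracket x y) = 0" for x y z
    using bracket_swap[of z "bracket x y"] by simp
  have "free_gen (bracket x y) \<in> env_ideal" for x y
    using two_sided_ideal_cong_mem[OF two_sided_ideal_enveloping enveloping_ideal_free_gen_bracket] comm by blast
  then show ?thesis
    using free_gen_mem_enveloping_ideal_class2[OF class2] by (simp add: abelian_bracket_def)
qed

lemma free_gen_mem_enveloping_ideal_iff:
  assumes "abelian_bracket bracket"
  shows "free_gen v \<in> env_ideal \<longleftrightarrow> v = 0"
proof (rule iffI)
  have "bracket x (bracket y z) = 0" for x y z
    using assms by (simp add: abelian_bracket_def)
  moreover assume "free_gen v \<in> env_ideal"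
  ultimately show "v = 0"
    by (rule free_gen_mem_enveloping_ideal_class2)
next
  assume "v = 0"
  have "free_gen (0 *s v) - pm_scale 0 (free_gen v) \<in> env_ideal"
    by (rule enveloping_ideal_free_gen_scale)
  then show "free_gen v \<in> env_ideal"
    using \<open>v = 0\<close> by simp
qed

end

subsection \<open>The augmentation ideal\<close>

lemma single_Cons: "Poly_Mapping.single (Word (x # xs)) (1 :: 'f::field) = free_gen x * Poly_Mapping.single (Word xs) 1"
  by (simp add: free_gen_def mult_single plus_free_word_def)

text \<open>The last case assumes nothing about \<open>f\<close>: every nonempty word is a left
  multiple of its first letter.\<close>

lemma free_algebra_induct [case_names subspace one gen_mult]:
  assumes "pm.subspace {f. P f}" and "P 1" and "\<And>x f. P (free_gen x * f)"
  shows "P (f :: 'a free_word \<Rightarrow>\<^sub>0 'f::field)"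
proof (induction f rule: pm_span_induct)
  case subspace
  show ?case by (rule assms(1))
next
  case (single w)
  show ?case
  proof (cases w)
    case (Word xs)
    show ?thesis
    proof (cases xs)
      case Nil
      then show ?thesis
        using assms(2) by (simp add: Word zero_free_word_def[symmetric])
    next
      case (Cons y ys)
      then show ?thesis
        by (simp only: Word single_Cons assms(3))
    qed
  qed
qed

definition aug :: "('a free_word \<Rightarrow>\<^sub>0 'f::field) \<Rightarrow> 'f" where
  "aug f = Poly_Mapping.lookup f 0"

interpretation aug_rep: free_algebra_rep "(*) :: 'f::field \<Rightarrow> 'f \<Rightarrow> 'f" "\<lambda>_ _. 0"
  by unfold_locales (simp_all add: algebra_simps)

text \<open>The constant coefficient is the trivial one-dimensional representation, in which
  generators act as zero. Multiplicativity of \<open>aug\<close> and its vanishing on the ideal of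
  relations are read off from this.\<close>

lemma aug_rep_act: "alg_act (*) (\<lambda>_ _. 0) f t = aug f * t"
proof (induction f rule: pm_span_induct)
  case subspace
  show ?case
    by (rule pm.subspaceI)
      (simp_all add: aug_def aug_rep.act_add_left aug_rep.act_pm_scale_left lookup_add distrib_right)
next
  case (single w)
  show ?case
    by (cases w; cases "letters w")
      (simp_all add: aug_def aug_rep.act_single lookup_single zero_free_word_def when_def)
qed

lemma aug_add: "aug (f + g) = aug f + aug g"
  and aug_diff: "aug (f - g) = aug f - aug g"
  and aug_pm_scale: "aug (pm_scale c f) = c * aug f"
  and aug_zero [simp]: "aug 0 = 0"
  and aug_one [simp]: "aug 1 = 1"
  by (simp_all add: aug_def lookup_add lookup_minus lookup_one)

lemma aug_mult: "aug (f * g) = aug f * aug g"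
  using aug_rep.act_mult[of f g 1] by (simp add: aug_rep_act)

lemma aug_power: "aug (f ^ n) = aug f ^ n"
  by (induction n) (simp_all add: aug_mult)

lemma aug_free_gen [simp]: "aug (free_gen x) = 0"
  using aug_rep.act_free_gen[of x 1] by (simp add: aug_rep_act)

text \<open>The square of the augmentation ideal of the free algebra; its counterpart in
  \<open>u(H)\<close> is reached by adding the ideal of relations.\<close>

definition aug_square :: "('a free_word \<Rightarrow>\<^sub>0 'f::field) set" where
  "aug_square = pm.span {f * g | f g. aug f = 0 \<and> aug g = 0}"

lemma aug_square_subspace: "pm.subspace aug_square"
  by (simp add: aug_square_def)

lemma aug_square_mult: "aug f = 0 \<Longrightarrow> aug g = 0 \<Longrightarrow> f * g \<in> aug_square"
  unfolding aug_square_def by (rule pm.span_base) blast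

lemma aug_square_induct [consumes 1, case_names subspace mult]:
  assumes "f \<in> aug_square" and "pm.subspace {f. P f}"
    and "\<And>f g. aug f = 0 \<Longrightarrow> aug g = 0 \<Longrightarrow> P (f * g)"
  shows "P f"
proof -
  have "aug_square \<subseteq> {f. P f}"
    unfolding aug_square_def using assms(2,3) by (intro pm.span_minimal) auto
  then show ?thesis
    using assms(1) by auto
qed

lemma pm_scale_mem_ideal:
  fixes J :: "('k::monoid_add \<Rightarrow>\<^sub>0 'f::field) set"
  shows "two_sided_ideal J \<Longrightarrow> f \<in> J \<Longrightarrow> pm_scale c f \<in> J"
  by (simp add: pm_scale_eq_mult two_sided_ideal_mult_left)

lemma mult_power_mod_ideal:
  assumes J: "two_sided_ideal J" and ab: "a * b - b * a \<in> J"
  shows "(a * b) ^ n - a ^ n * b ^ n \<in> J"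
proof (induction n)
  case 0
  show ?case using J by (simp add: two_sided_ideal_zero)
next
  case (Suc n)
  have "(a * b) ^ Suc n - a ^ Suc n * b ^ Suc n
      = a * b * ((a * b) ^ n - a ^ n * b ^ n) + a * (b * a ^ n - a ^ n * b) * b ^ n"
    by (simp add: algebra_simps)
  moreover have "b * a ^ n - a ^ n * b \<in> J"
    using commute_power_mod_ideal[OF J two_sided_ideal_cong_sym[OF J ab]] .
  ultimately show ?case
    using Suc J
    by (simp only: two_sided_ideal_add two_sided_ideal_mult_left two_sided_ideal_mult_right)
qed

section \<open>Commutative enveloping algebras over a perfect field\<close>

locale abelian_restricted_lie_algebra = restricted_lie_algebra +
  assumes bracket_eq_0: "bracket x y = 0"
    and perfect: "surj (\<lambda>x::'a. x ^ CHAR('a))"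
begin

lemma two_sided_enveloping: "two_sided_ideal env_ideal"
  by (rule two_sided_ideal_enveloping)

lemma pmap_additive: "pmap (x + y) = pmap x + pmap y"
  unfolding pmap_add by (subst sum_jacobson_class2) (simp_all add: bracket_eq_0)

sublocale frobenius_space scale pmap "CHAR('a)"
  by unfold_locales (simp_all add: char_pos pmap_additive pmap_scale)

text \<open>The elements commuting with a fixed \<open>g\<close> modulo the relations form a
  subalgebra, so testing generators suffices; this is applied once in each argument.\<close>

lemma commute_mod_enveloping: "f * g - g * f \<in> env_ideal"
proof -
  have comm_mult: "(a * b) * c - c * (a * b) \<in> env_ideal"
    if "a * c - c * a \<in> env_ideal" "b * c - c * b \<in> env_ideal" for a b c
  proof -
    have "(a * b) * c - c * (a * b) = a * (b * c - c * b) + (a * c - c * a) * b"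
      by (simp add: algebra_simps)
    then show ?thesis
      using that by (simp only: two_sided_ideal_add[OF two_sided_enveloping] two_sided_ideal_mult_left[OF two_sided_enveloping] two_sided_ideal_mult_right[OF two_sided_enveloping])
  qed
  have sub: "pm.subspace {f. f * g - g * f \<in> env_ideal}" for g
  proof (rule pm.subspaceI)
    fix a b c
    assume a: "a \<in> {f. f * g - g * f \<in> env_ideal}"
    then show "pm_scale c a \<in> {f. f * g - g * f \<in> env_ideal}"
      using pm_scale_mem_ideal[OF two_sided_enveloping, of "a * g - g * a" c]
      by (simp add: pm_scale_mult_left pm_scale_mult_right pm.scale_right_diff_distrib)
    assume "b \<in> {f. f * g - g * f \<in> env_ideal}"
    with a have "(a * g - g * a) + (b * g - g * b) \<in> env_ideal"
      by (intro two_sided_ideal_add[OF two_sided_enveloping]) simp_all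
    then show "a + b \<in> {f. f * g - g * f \<in> env_ideal}"
      by (simp add: algebra_simps)
  qed (simp add: two_sided_ideal_zero[OF two_sided_enveloping])
  have gen: "free_gen x * free_gen y - free_gen y * free_gen x \<in> env_ideal" for x y
  proof -
    have "free_gen (bracket x y) \<in> env_ideal"
      using free_gen_mem_enveloping_ideal_iff bracket_eq_0 by (simp add: abelian_bracket_def)
    then show ?thesis
      using two_sided_ideal_cong_mem[OF two_sided_enveloping enveloping_ideal_free_gen_bracket] by blast
  qed
  have word: "Poly_Mapping.single (Word xs) 1 * g - g * Poly_Mapping.single (Word xs) 1 \<in> env_ideal"
    if "\<And>x. free_gen x * g - g * free_gen x \<in> env_ideal" for g xs
  proof (induction xs)
    case Nil
    show ?case
      by (simp add: zero_free_word_def[symmetric] two_sided_ideal_zero[OF two_sided_enveloping])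
  next
    case (Cons x xs)
    then show ?case
      unfolding single_Cons by (intro comm_mult that)
  qed
  have all: "f * g - g * f \<in> env_ideal"
    if "\<And>x. free_gen x * g - g * free_gen x \<in> env_ideal" for f g
  proof (induction f rule: pm_span_induct)
    case (single w)
    show ?case
      using word[OF that, of "letters w"] by simp
  qed (rule sub)
  show ?thesis
    by (rule all, rule two_sided_ideal_cong_sym[OF two_sided_enveloping], rule all, rule gen)
qed

lemma dream_mod_enveloping: "(f + g) ^ (CHAR('a) ^ n) - (f ^ (CHAR('a) ^ n) + g ^ (CHAR('a) ^ n)) \<in> env_ideal"
  by (rule freshmans_dream_mod_ideal_iterated[OF two_sided_enveloping commute_mod_enveloping prime_p of_nat_p])

lemma aug_mem_enveloping:
  assumes "f \<in> env_ideal"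
  shows "aug f = 0"
proof -
  have "alg_act (*) (\<lambda>_ _. 0) f 1 \<in> {0 :: 'a}"
    by (rule act_enveloping_ideal[OF aug_rep.free_algebra_rep_axioms _ _ _ _ _ _ assms])
      (use char_pos in \<open>auto simp: aug_rep.subspace_def gr0_conv_Suc\<close>)
  then show ?thesis
    by (simp add: aug_rep_act)
qed

lemma free_gen_power_mod_enveloping:
  "free_gen x ^ (CHAR('a) ^ n) - free_gen ((pmap ^^ n) x) \<in> env_ideal"
proof (induction n)
  case 0
  show ?case by (simp add: two_sided_ideal_zero[OF two_sided_enveloping])
next
  case (Suc n)
  have "(free_gen x ^ (CHAR('a) ^ n)) ^ CHAR('a) - free_gen ((pmap ^^ n) x) ^ CHAR('a) \<in> env_ideal"
    using Suc by (rule two_sided_ideal_cong_power[OF two_sided_enveloping])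
  moreover have "free_gen ((pmap ^^ n) x) ^ CHAR('a) - free_gen (pmap ((pmap ^^ n) x)) \<in> env_ideal"
    by (rule two_sided_ideal_cong_sym[OF two_sided_enveloping], rule enveloping_ideal_free_gen_pmap)
  ultimately have "(free_gen x ^ (CHAR('a) ^ n)) ^ CHAR('a) - free_gen (pmap ((pmap ^^ n) x)) \<in> env_ideal"
    by (rule two_sided_ideal_cong_trans[OF two_sided_enveloping])
  then show ?case
    by (simp add: mult.commute flip: power_mult)
qed

text \<open>Both sides are additive in \<open>f\<close> and scale by the \<open>p ^ n\<close>-th
  power, so \<open>1\<close> and left multiples of generators suffice; the \<open>p ^ n\<close>-th
  power of a generator lies in the ideal by nilpotency. Hence the augmentation ideal is nil with a
  bound independent of \<open>f\<close>.\<close>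

lemma power_mod_enveloping_nilpotent:
  assumes nil: "\<And>x. (pmap ^^ n) x = 0"
  shows "f ^ (CHAR('a) ^ n) - pm_scale (aug f ^ (CHAR('a) ^ n)) 1 \<in> env_ideal"
proof (induction f rule: free_algebra_induct)
  case subspace
  let ?P = "CHAR('a) ^ n"
  show ?case
  proof (rule pm.subspaceI)
    fix a b c
    assume a: "a \<in> {f. f ^ ?P - pm_scale (aug f ^ ?P) 1 \<in> env_ideal}"
    then show "pm_scale c a \<in> {f. f ^ ?P - pm_scale (aug f ^ ?P) 1 \<in> env_ideal}"
      using pm_scale_mem_ideal[OF two_sided_enveloping, of "a ^ ?P - pm_scale (aug a ^ ?P) 1" "c ^ ?P"]
      by (simp add: pm_scale_power aug_pm_scale pm.scale_right_diff_distrib power_mult_distrib)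
    assume b: "b \<in> {f. f ^ ?P - pm_scale (aug f ^ ?P) 1 \<in> env_ideal}"
    have "(a ^ ?P + b ^ ?P) - (pm_scale (aug a ^ ?P) 1 + pm_scale (aug b ^ ?P) 1) \<in> env_ideal"
      using a b by (intro two_sided_ideal_cong_add[OF two_sided_enveloping]) simp_all
    with dream_mod_enveloping have "(a + b) ^ ?P - (pm_scale (aug a ^ ?P) 1 + pm_scale (aug b ^ ?P) 1) \<in> env_ideal"
      by (rule two_sided_ideal_cong_trans[OF two_sided_enveloping])
    then show "a + b \<in> {f. f ^ ?P - pm_scale (aug f ^ ?P) 1 \<in> env_ideal}"
      by (simp add: aug_add freshmans_dream'[OF prime_p refl] pm.scale_left_distrib)
  qed (use char_pos in \<open>simp add: zero_power two_sided_ideal_zero[OF two_sided_enveloping]\<close>)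
next
  case one
  show ?case by (simp add: two_sided_ideal_zero[OF two_sided_enveloping])
next
  case (gen_mult x f)
  let ?P = "CHAR('a) ^ n"
  have "free_gen ((pmap ^^ n) x) \<in> env_ideal"
    using free_gen_mem_enveloping_ideal_iff bracket_eq_0 nil by (simp add: abelian_bracket_def)
  then have "free_gen x ^ ?P \<in> env_ideal"
    using two_sided_ideal_cong_mem[OF two_sided_enveloping free_gen_power_mod_enveloping] by blast
  then have "free_gen x ^ ?P * f ^ ?P \<in> env_ideal"
    by (rule two_sided_ideal_mult_right[OF two_sided_enveloping])
  then have "(free_gen x * f) ^ ?P \<in> env_ideal"
    using two_sided_ideal_cong_mem[OF two_sided_enveloping mult_power_mod_ideal[OF two_sided_enveloping commute_mod_enveloping]] by blast
  then show ?case
    using char_pos by (simp add: aug_mult zero_power)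
qed

text \<open>A multiple of a generator splits as \<open>x * f = x * aug f + x * (f - aug f)\<close>,
  with \<open>aug f\<close> read as a scalar; the second summand is a product of two elements of
  augmentation zero.\<close>

lemma free_gen_decomposition:
  "\<exists>v m. m \<in> aug_square \<and> f - (pm_scale (aug f) 1 + free_gen v + m) \<in> env_ideal"
proof (induction f rule: free_algebra_induct)
  case subspace
  have zero: "free_gen 0 \<in> env_ideal"
    using free_gen_mem_enveloping_ideal_iff bracket_eq_0 by (simp add: abelian_bracket_def)
  show ?case
  proof (rule pm.subspaceI, goal_cases)
    case 1
    show ?case
      using two_sided_ideal_uminus[OF two_sided_enveloping zero] pm.subspace_0[OF aug_square_subspace]
      by (intro CollectI exI[of _ 0]) simp
  next
    case (2 f g)
    then obtain v m w k where m: "m \<in> aug_square" and k: "k \<in> aug_square"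
      and f: "f - (pm_scale (aug f) 1 + free_gen v + m) \<in> env_ideal"
      and g: "g - (pm_scale (aug g) 1 + free_gen w + k) \<in> env_ideal"
      by blast
    let ?a = "(pm_scale (aug f) 1 + free_gen v + m) + (pm_scale (aug g) 1 + free_gen w + k)"
    let ?b = "pm_scale (aug (f + g)) 1 + free_gen (v + w) + (m + k)"
    have "f + g - ?a \<in> env_ideal"
      by (rule two_sided_ideal_cong_add[OF two_sided_enveloping f g])
    moreover have "?a - ?b = - (free_gen (v + w) - (free_gen v + free_gen w))"
      by (simp add: aug_add pm.scale_left_distrib)
    then have "?a - ?b \<in> env_ideal"
      by (simp only: two_sided_ideal_uminus[OF two_sided_enveloping enveloping_ideal_free_gen_add])
    ultimately have "f + g - ?b \<in> env_ideal"
      by (rule two_sided_ideal_cong_trans[OF two_sided_enveloping])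
    moreover have "m + k \<in> aug_square"
      using m k by (rule pm.subspace_add[OF aug_square_subspace])
    ultimately show ?case by blast
  next
    case (3 c f)
    then obtain v m where m: "m \<in> aug_square"
      and f: "f - (pm_scale (aug f) 1 + free_gen v + m) \<in> env_ideal"
      by blast
    let ?a = "pm_scale c (pm_scale (aug f) 1 + free_gen v + m)"
    let ?b = "pm_scale (aug (pm_scale c f)) 1 + free_gen (scale c v) + pm_scale c m"
    have "pm_scale c f - ?a \<in> env_ideal"
      using pm_scale_mem_ideal[OF two_sided_enveloping f, of c] by (simp add: pm.scale_right_diff_distrib)
    moreover have "?a - ?b = - (free_gen (scale c v) - pm_scale c (free_gen v))"
      by (simp add: aug_pm_scale pm.scale_right_distrib)
    then have "?a - ?b \<in> env_ideal"
      by (simp only: two_sided_ideal_uminus[OF two_sided_enveloping enveloping_ideal_free_gen_scale])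
    ultimately have "pm_scale c f - ?b \<in> env_ideal"
      by (rule two_sided_ideal_cong_trans[OF two_sided_enveloping])
    moreover have "pm_scale c m \<in> aug_square"
      using m by (rule pm.subspace_scale[OF aug_square_subspace])
    ultimately show ?case by blast
  qed
next
  case one
  have "free_gen 0 \<in> env_ideal"
    using free_gen_mem_enveloping_ideal_iff bracket_eq_0 by (simp add: abelian_bracket_def)
  then show ?case
    using two_sided_ideal_uminus[OF two_sided_enveloping] pm.subspace_0[OF aug_square_subspace]
    by (intro exI[of _ 0]) simp
next
  case (gen_mult x f)
  let ?m = "free_gen x * (f - pm_scale (aug f) 1)"
  have "?m \<in> aug_square"
    by (rule aug_square_mult) (simp_all add: aug_diff aug_pm_scale)
  moreover have "free_gen x * f - (pm_scale (aug (free_gen x * f)) 1 + free_gen (scale (aug f) x) + ?m)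
      = - (free_gen (scale (aug f) x) - pm_scale (aug f) (free_gen x))"
    by (simp add: aug_mult right_diff_distrib pm_scale_mult_right)
  then have "free_gen x * f - (pm_scale (aug (free_gen x * f)) 1 + free_gen (scale (aug f) x) + ?m) \<in> env_ideal"
    by (simp only: two_sided_ideal_uminus[OF two_sided_enveloping enveloping_ideal_free_gen_scale])
  ultimately show ?case by blast
qed

end

subsection \<open>Retractions of the augmentation ideal\<close>

interpretation poly_vs: vector_space "smult :: 'f::field \<Rightarrow> 'f poly \<Rightarrow> 'f poly"
  by unfold_locales (simp_all add: smult_add_right smult_add_left)

lemma coeff_eq_0_if_monom_dvd:
  fixes f :: "'f::field poly"
  assumes "monom 1 d dvd f" "i < d"
  shows "coeff f i = 0"
  using assms by (auto simp: monom_1_dvd_iff')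

lemma poly_power_CHAR:
  fixes c :: "'f::field poly"
  assumes "prime CHAR('f)"
  shows "c ^ CHAR('f) = (\<Sum>i\<le>degree c. monom (coeff c i ^ CHAR('f)) (CHAR('f) * i))"
proof -
  have "c ^ CHAR('f) = (\<Sum>i\<le>degree c. monom (coeff c i) i) ^ CHAR('f)"
    by (simp add: poly_as_sum_of_monoms)
  also have "\<dots> = (\<Sum>i\<le>degree c. monom (coeff c i) i ^ CHAR('f))"
    using assms by (intro freshmans_dream_sum) simp_all
  finally show ?thesis
    by (simp add: monom_power mult.commute)
qed

lemma coeff_power_CHAR:
  fixes c :: "'f::field poly"
  assumes "prime CHAR('f)"
  shows "coeff (c ^ CHAR('f)) (CHAR('f) * i) = coeff c i ^ CHAR('f)"
    and "\<not> CHAR('f) dvd k \<Longrightarrow> coeff (c ^ CHAR('f)) k = 0"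
proof -
  have p: "CHAR('f) > 0"
    using assms by (rule prime_gt_0_nat)
  have "coeff (c ^ CHAR('f)) (CHAR('f) * i) = (\<Sum>j\<le>degree c. if j = i then coeff c j ^ CHAR('f) else 0)"
    unfolding poly_power_CHAR[OF assms] coeff_sum using p by (intro sum.cong) auto
  also have "\<dots> = coeff c i ^ CHAR('f)"
    using p by (simp add: coeff_eq_0 zero_power)
  finally show "coeff (c ^ CHAR('f)) (CHAR('f) * i) = coeff c i ^ CHAR('f)" .
  show "coeff (c ^ CHAR('f)) k = 0" if "\<not> CHAR('f) dvd k"
    unfolding poly_power_CHAR[OF assms] coeff_sum using that by (intro sum.neutral) auto
qed

lemma (in vector_space) ex_linear_functional:
  assumes "w \<notin> span S"
  obtains \<phi> :: "'b \<Rightarrow> 'a" where "\<And>x y. \<phi> (x + y) = \<phi> x + \<phi> y" "\<And>c x. \<phi> (scale c x) = c * \<phi> x"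
    "\<phi> w = 1" "\<And>s. s \<in> S \<Longrightarrow> \<phi> s = 0"
proof -
  interpret vp: vector_space_pair scale "(*) :: 'a \<Rightarrow> 'a \<Rightarrow> 'a"
    by unfold_locales (simp_all add: algebra_simps)
  obtain B where B: "B \<subseteq> S" "independent B" "S \<subseteq> span B"
    using maximal_independent_subset[of S] by blast
  have w: "w \<notin> span B"
    using assms span_mono[OF B(1)] by blast
  then have ind: "independent (insert w B)"
    using B(2) by (rule independent_insertI)
  define \<phi> where "\<phi> = vp.construct (insert w B) (\<lambda>b. if b = w then 1 else 0)"
  have lin: "Vector_Spaces.linear scale (*) \<phi>"
    unfolding \<phi>_def using ind by (rule vp.linear_construct)
  then have add: "\<phi> (x + y) = \<phi> x + \<phi> y" and scale: "\<phi> (scale c x) = c * \<phi> x" for c x y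
    by (simp_all add: Vector_Spaces.linear_iff)
  have "b \<noteq> w" if "b \<in> B" for b
    using that w span_base by blast
  then have "\<phi> b = 0" if "b \<in> B" for b
    using that by (simp add: \<phi>_def vp.construct_basis[OF ind])
  then have "span B \<subseteq> {x. \<phi> x = 0}"
    using scale[of 0 0] by (intro span_minimal subspaceI) (auto simp: add scale)
  then have "\<phi> s = 0" if "s \<in> S" for s
    using that B(3) by blast
  moreover have "\<phi> w = 1"
    by (simp add: \<phi>_def vp.construct_basis[OF ind])
  ultimately show thesis
    using add scale by (intro that[of \<phi>]) simp_all
qed

section \<open>Homomorphisms to truncated polynomial rings\<close>

context abelian_restricted_lie_algebra
begin

text \<open>The homomorphism to polynomials with values \<open>g\<close> on the generators, obtained
  by letting generators act by multiplication and evaluating at \<open>1\<close>. If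
  \<open>g\<close> is linear and respects p-th powers modulo t^d, it induces a homomorphism from
  \<open>u(H)\<close> to F[t]/(t^d).\<close>

definition poly_hom :: "('b \<Rightarrow> 'a poly) \<Rightarrow> ('b free_word \<Rightarrow>\<^sub>0 'a) \<Rightarrow> 'a poly" where
  "poly_hom g f = alg_act smult (\<lambda>v t. g v * t) f 1"

context
  fixes g :: "'b \<Rightarrow> 'a poly" and d :: nat
  assumes g_add: "g (x + y) = g x + g y" and g_scale: "g (scale c x) = smult c (g x)"
    and g_pmap: "monom 1 d dvd g (pmap x) - g x ^ CHAR('a)"
begin

interpretation g_rep: free_algebra_rep smult "\<lambda>v t. g v * t"
  by unfold_locales (simp_all add: algebra_simps)

lemma poly_hom_act: "g_rep.act f t = poly_hom g f * t"
proof (induction f rule: pm_span_induct)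
  case subspace
  show ?case
    by (rule pm.subspaceI)
      (simp_all add: poly_hom_def g_rep.act_add_left g_rep.act_pm_scale_left distrib_right)
next
  case (single w)
  have "foldr (\<lambda>v t. g v * t) xs t = foldr (\<lambda>v t. g v * t) xs 1 * t" for xs
    by (induction xs) (simp_all add: mult.assoc)
  from this[of "letters w"] show ?case
    by (simp add: poly_hom_def g_rep.act_single)
qed

lemma poly_hom_add: "poly_hom g (f + h) = poly_hom g f + poly_hom g h"
  and poly_hom_pm_scale: "poly_hom g (pm_scale c f) = smult c (poly_hom g f)"
  and poly_hom_zero: "poly_hom g 0 = 0"
  by (simp_all add: poly_hom_def g_rep.act_add_left g_rep.act_pm_scale_left)

lemma poly_hom_free_gen: "poly_hom g (free_gen v) = g v"
  by (simp add: poly_hom_def)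

lemma poly_hom_mult: "poly_hom g (f * h) = poly_hom g f * poly_hom g h"
  unfolding poly_hom_def[of g "f * h"] g_rep.act_mult by (simp add: poly_hom_act)

lemma poly_hom_power: "poly_hom g (f ^ n) = poly_hom g f ^ n"
  by (induction n) (simp_all add: poly_hom_mult, simp add: poly_hom_def)

lemma poly_hom_mem_enveloping:
  assumes "f \<in> env_ideal"
  shows "monom 1 d dvd poly_hom g f"
proof -
  have g0: "g 0 = 0"
    using g_scale[of 0 0] by simp
  have pow: "((\<lambda>t. g x * t) ^^ n) t = g x ^ n * t" for x t n
    by (induction n) (simp_all add: mult.assoc)
  have "g_rep.act f 1 \<in> {t. monom 1 d dvd t}"
  proof (rule act_enveloping_ideal[OF g_rep.free_algebra_rep_axioms _ _ _ _ _ _ assms])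
    show "poly_vs.subspace {t. monom 1 d dvd t}"
      by (rule poly_vs.subspaceI) (simp_all add: dvd_smult)
    show "g (pmap x) * t - ((*) (g x) ^^ CHAR('a)) t \<in> {t. monom 1 d dvd t}" for x t
      using dvd_mult2[OF g_pmap[of x], of t] by (simp add: pow algebra_simps)
  qed (simp_all add: g_add g_scale g0 bracket_eq_0 algebra_simps)
  then show ?thesis
    by (simp add: poly_hom_def)
qed

lemma poly_hom_aug:
  assumes "\<And>v. monom 1 1 dvd g v" and "aug f = 0"
  shows "monom 1 1 dvd poly_hom g f"
proof -
  have "monom 1 1 dvd poly_hom g (f - pm_scale (aug f) 1)" for f
  proof (induction f rule: free_algebra_induct)
    case subspace
    show ?case
    proof (rule pm.subspaceI)
      fix a b c
      assume a: "a \<in> {f. monom 1 1 dvd poly_hom g (f - pm_scale (aug f) 1)}"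
      have "poly_hom g (pm_scale c a - pm_scale (aug (pm_scale c a)) 1) = smult c (poly_hom g (a - pm_scale (aug a) 1))"
        by (simp add: aug_pm_scale pm.scale_right_diff_distrib flip: poly_hom_pm_scale)
      with a show "pm_scale c a \<in> {f. monom 1 1 dvd poly_hom g (f - pm_scale (aug f) 1)}"
        by (simp add: dvd_smult)
      assume b: "b \<in> {f. monom 1 1 dvd poly_hom g (f - pm_scale (aug f) 1)}"
      have "poly_hom g (a + b - pm_scale (aug (a + b)) 1)
          = poly_hom g (a - pm_scale (aug a) 1) + poly_hom g (b - pm_scale (aug b) 1)"
        by (simp add: aug_add pm.scale_left_distrib add_diff_add flip: poly_hom_add)
      with a b show "a + b \<in> {f. monom 1 1 dvd poly_hom g (f - pm_scale (aug f) 1)}"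
        by (simp add: dvd_add)
    qed (simp add: poly_hom_zero)
  next
    case one
    show ?case by (simp add: poly_hom_zero)
  next
    case (gen_mult x f)
    show ?case
      using assms(1)[of x] by (simp add: aug_mult poly_hom_mult poly_hom_free_gen dvd_mult2)
  qed
  from this[of f] show ?thesis
    using assms(2) by simp
qed

lemma poly_hom_mult_aug:
  assumes "\<And>v. monom 1 1 dvd g v" and "aug f = 0" "aug h = 0"
  shows "monom 1 2 dvd poly_hom g (f * h)"
proof -
  have "monom 1 1 * monom 1 1 dvd poly_hom g f * poly_hom g h"
    using assms by (intro mult_dvd_mono poly_hom_aug)
  then show ?thesis
    by (simp add: poly_hom_mult mult_monom numeral_2_eq_2)
qed

end

section \<open>Roots of scalars and the image of the p-map\<close>

lemma pmap_funpow_add: "(pmap ^^ n) (x + y) = (pmap ^^ n) x + (pmap ^^ n) y"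
  by (induction n) (simp_all add: pmap_additive)

lemma pmap_funpow_scale: "(pmap ^^ n) (scale c x) = scale (c ^ (CHAR('a) ^ n)) ((pmap ^^ n) x)"
  by (induction n) (simp_all add: pmap_scale mult.commute flip: power_mult)

lemma pmap_funpow_zero [simp]: "(pmap ^^ n) 0 = 0"
  by (induction n) simp_all

definition frob_root :: "'a \<Rightarrow> 'a" where
  "frob_root = inv_into UNIV (\<lambda>x. x ^ CHAR('a))"

lemma frob_root_power [simp]: "frob_root x ^ CHAR('a) = x"
  unfolding frob_root_def using surj_f_inv_f[OF perfect] .

lemma power_CHAR_inj:
  fixes x y :: 'a
  assumes eq: "x ^ CHAR('a) = y ^ CHAR('a)"
  shows "x = y"
proof -
  have "(x - y + y) ^ CHAR('a) = (x - y) ^ CHAR('a) + y ^ CHAR('a)"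
    by (rule freshmans_dream[OF prime_p refl])
  then show "x = y"
    using eq char_pos by simp
qed

lemma frob_root_add: "frob_root (x + y) = frob_root x + frob_root y"
  by (rule power_CHAR_inj) (simp add: freshmans_dream[OF prime_p refl])

lemma frob_root_mult: "frob_root (x * y) = frob_root x * frob_root y"
  by (rule power_CHAR_inj) (simp add: power_mult_distrib)

lemma frob_root_power_right [simp]: "frob_root (x ^ CHAR('a)) = x"
  by (rule power_CHAR_inj) simp

text \<open>The image of a semilinear map is closed under scalars here because a scalar can be moved
  inside after extracting its p-th root.\<close>

lemma subspace_range_pmap: "subspace (range pmap)"
proof (rule subspaceI)
  show "0 \<in> range pmap"
    by (rule range_eqI[of _ _ 0]) simp
  fix x y c
  assume "x \<in> range pmap"
  then obtain u where u: "x = pmap u" by blast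
  show "scale c x \<in> range pmap"
    by (rule range_eqI[of _ _ "scale (frob_root c) u"]) (simp add: u pmap_scale)
  assume "y \<in> range pmap"
  then obtain w where "y = pmap w" by blast
  then show "x + y \<in> range pmap"
    by (intro range_eqI[of _ _ "u + w"]) (simp add: u pmap_additive)
qed

text \<open>A functional \<open>\<phi>\<close> that vanishes on the image of the p-map but not at
  \<open>w\<close> gives a map \<open>v\<close> to \<open>\<phi> v\<close> times t into F[t]/(t^2),
  compatible with p-th powers because t^p = 0 there. It kills \<open>aug_square\<close> but not
  \<open>w\<close>.\<close>

lemma free_gen_aug_square_imp_range_pmap:
  assumes m: "m \<in> aug_square" and w: "free_gen w - m \<in> env_ideal"
  shows "w \<in> range pmap"
proof (rule ccontr)
  assume "w \<notin> range pmap"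
  moreover have "span (range pmap) = range pmap"
    by (simp only: span_eq_iff subspace_range_pmap)
  ultimately have "w \<notin> span (range pmap)"
    by (simp del: span_eq_iff)
  then obtain \<phi> :: "'b \<Rightarrow> 'a" where \<phi>: "\<And>x y. \<phi> (x + y) = \<phi> x + \<phi> y" "\<And>c x. \<phi> (scale c x) = c * \<phi> x"
    "\<phi> w = 1" "\<And>s. s \<in> range pmap \<Longrightarrow> \<phi> s = 0"
    by (rule ex_linear_functional) blast
  define g where "g v = monom (\<phi> v) 1" for v
  have g_add: "g (x + y) = g x + g y" and g_scale: "g (scale c x) = smult c (g x)" for x y c
    by (simp_all add: g_def \<phi> add_monom smult_monom)
  have g1: "monom 1 1 dvd g v" for v
    by (simp add: g_def monom_1_dvd_iff')
  have g_pmap: "monom 1 2 dvd g (pmap x) - g x ^ CHAR('a)" for x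
    using p_ge_2 by (auto simp: g_def \<phi> monom_power monom_1_dvd_iff')
  note hom = poly_hom_add[OF g_add g_scale g_pmap] poly_hom_pm_scale[OF g_add g_scale g_pmap]
    poly_hom_zero[OF g_add g_scale g_pmap] poly_hom_free_gen[OF g_add g_scale g_pmap]
  have "monom 1 2 dvd poly_hom g m"
    using m
  proof (induction rule: aug_square_induct)
    case subspace
    show ?case
      by (rule pm.subspaceI) (simp_all add: hom dvd_smult)
  next
    case (mult f h)
    then show ?case
      by (intro poly_hom_mult_aug[OF g_add g_scale g_pmap] g1)
  qed
  moreover have "monom 1 2 dvd poly_hom g (free_gen w - m)"
    by (rule poly_hom_mem_enveloping[OF g_add g_scale g_pmap w])
  ultimately have "monom 1 2 dvd poly_hom g (free_gen w - m + m)"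
    unfolding hom(1) by (rule dvd_add[rotated])
  then have "monom 1 2 dvd g w"
    by (simp add: hom)
  then have "coeff (g w) 1 = 0"
    by (rule coeff_eq_0_if_monom_dvd) simp
  then show False
    by (simp add: g_def \<phi>)
qed

end

section \<open>Cyclic summands of a nilpotent p-map\<close>

context abelian_restricted_lie_algebra
begin

lemma frob_root_zero [simp]: "frob_root 0 = 0"
  by (rule power_CHAR_inj) (use char_pos in simp)

lemma frob_root_one [simp]: "frob_root 1 = 1"
  by (rule power_CHAR_inj) simp

lemma frob_root_funpow_add: "(frob_root ^^ n) (x + y) = (frob_root ^^ n) x + (frob_root ^^ n) y"
  by (induction n) (simp_all add: frob_root_add)

lemma frob_root_funpow_mult: "(frob_root ^^ n) (c ^ (CHAR('a) ^ n) * x) = c * (frob_root ^^ n) x"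
proof (induction n arbitrary: c)
  case (Suc n)
  have "c ^ (CHAR('a) ^ Suc n) = (c ^ CHAR('a)) ^ (CHAR('a) ^ n)"
    by (simp flip: power_mult)
  then show ?case
    by (simp only: funpow.simps comp_apply Suc frob_root_mult frob_root_power_right)
qed simp

lemma frob_root_funpow_zero [simp]: "(frob_root ^^ n) 0 = 0"
  by (induction n) simp_all

lemma frob_root_funpow_one [simp]: "(frob_root ^^ n) 1 = 1"
  by (induction n) simp_all

lemma pmap_sum: "pmap (sum g A) = (\<Sum>i\<in>A. pmap (g i))"
  by (induction A rule: infinite_finite_induct) (simp_all add: pmap_additive)

lemma pmap_funpow_eq_0_mono: "(pmap ^^ m) v = 0 \<Longrightarrow> m \<le> n \<Longrightarrow> (pmap ^^ n) v = 0"
  by (metis funpow_add comp_apply le_add_diff_inverse2 pmap_funpow_zero)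

text \<open>The span is enlarged by one lower iterate of \<open>v\<close> at a time. Applying the
  p-map \<open>Suc m\<close> times sends the new iterate to the top one and all iterates above it in
  the span to zero, so the new coefficient vanishes.\<close>

lemma pmap_funpow_notin_span:
  assumes v: "(pmap ^^ k) v \<noteq> 0" "(pmap ^^ Suc k) v = 0"
  shows "(pmap ^^ k) v \<notin> span ((\<lambda>j. (pmap ^^ j) v) ` {..<k})"
proof -
  have "(pmap ^^ k) v \<notin> span ((\<lambda>j. (pmap ^^ j) v) ` {k - m..<k})" if "m \<le> k" for m
    using that
  proof (induction m)
    case 0
    then show ?case using v by simp
  next
    case (Suc m)
    let ?S = "(\<lambda>j. (pmap ^^ j) v) ` {k - m..<k}" and ?y = "(pmap ^^ (k - Suc m)) v"
    have "{k - Suc m..<k} = insert (k - Suc m) {k - m..<k}"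
      using Suc.prems by auto
    then have ins: "(\<lambda>j. (pmap ^^ j) v) ` {k - Suc m..<k} = insert ?y ?S"
      by simp
    have comp: "(pmap ^^ i) ((pmap ^^ j) v) = (pmap ^^ (i + j)) v" for i j
      by (simp add: funpow_add)
    have "subspace {y. (pmap ^^ Suc m) y = 0}"
      by (rule subspaceI) (simp_all only: mem_Collect_eq pmap_funpow_add pmap_funpow_scale pmap_funpow_zero, simp_all)
    moreover have "?S \<subseteq> {y. (pmap ^^ Suc m) y = 0}"
      using pmap_funpow_eq_0_mono[OF v(2)] by (auto simp only: mem_Collect_eq comp) (auto simp del: funpow.simps)
    ultimately have kill: "span ?S \<subseteq> {y. (pmap ^^ Suc m) y = 0}"
      by (intro span_minimal)
    show ?case
    proof
      assume "(pmap ^^ k) v \<in> span ((\<lambda>j. (pmap ^^ j) v) ` {k - Suc m..<k})"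
      then obtain c where c: "(pmap ^^ k) v - scale c ?y \<in> span ?S"
        unfolding ins span_breakdown_eq by blast
      have "(pmap ^^ Suc m) ((pmap ^^ k) v) = (pmap ^^ Suc m) (((pmap ^^ k) v - scale c ?y) + scale c ?y)"
        by simp
      also have "\<dots> = (pmap ^^ Suc m) (scale c ?y)"
        using subsetD[OF kill c] by (simp only: pmap_funpow_add mem_Collect_eq add_0)
      also have "\<dots> = scale (c ^ (CHAR('a) ^ Suc m)) ((pmap ^^ k) v)"
        using Suc.prems by (simp only: pmap_funpow_scale comp) (simp del: funpow.simps)
      also have "(pmap ^^ Suc m) ((pmap ^^ k) v) = 0"
        unfolding comp using v(2) by (rule pmap_funpow_eq_0_mono) simp
      finally have "c = 0"
        using v(1) by (simp del: funpow.simps)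
      then show False
        using c Suc by simp
    qed
  qed
  from this[of k] show ?thesis
    by (simp add: lessThan_atLeast0)
qed

text \<open>Formulated relative to a projection \<open>\<pi>\<close> of \<open>H\<close>, so that
  the maps belonging to complementary summands can be added up; the identity is the projection of
  interest.\<close>

definition aug_retract :: "('b \<Rightarrow> 'b) \<Rightarrow> (('b free_word \<Rightarrow>\<^sub>0 'a) \<Rightarrow> 'b) \<Rightarrow> bool" where
  "aug_retract \<pi> r \<longleftrightarrow>
     (\<forall>f g. r (f + g) = r f + r g) \<and> (\<forall>c f. r (pm_scale c f) = scale c (r f))
     \<and> (\<forall>f\<in>env_ideal. r f = 0) \<and> (\<forall>f. r (f ^ CHAR('a)) = pmap (r f))
     \<and> (\<forall>v. r (free_gen v) = \<pi> v)
     \<and> (\<forall>f g. aug f = 0 \<longrightarrow> aug g = 0 \<longrightarrow> r (f * g) \<in> range pmap)"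

definition pmap_projection :: "('b \<Rightarrow> 'b) \<Rightarrow> bool" where
  "pmap_projection \<pi> \<longleftrightarrow>
     (\<forall>x y. \<pi> (x + y) = \<pi> x + \<pi> y) \<and> (\<forall>c x. \<pi> (scale c x) = scale c (\<pi> x))
     \<and> (\<forall>x. \<pi> (pmap x) = pmap (\<pi> x)) \<and> (\<forall>x. \<pi> (\<pi> x) = \<pi> x)"

text \<open>
  The cyclic subspace generated by a vector of maximal nilpotency order splits off equivariantly: the
  projection is read off from an equivariant map to \<open>F[t]/(t^(p^n))\<close>, and this map extends to the free
  algebra.
\<close>

lemma cyclic_aug_retract:
  assumes \<pi>: "pmap_projection \<pi>"
    and nil: "\<And>u. (pmap ^^ Suc k) (\<pi> u) = 0" and v: "\<pi> v = v" "(pmap ^^ k) v \<noteq> 0"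
  shows "\<exists>e r. pmap_projection e \<and> aug_retract e r \<and> e v = v \<and> (\<forall>u. \<pi> (e u) = e u \<and> e (\<pi> u) = e u)"
proof -
  let ?p = "CHAR('a)"
  let ?v = "\<lambda>i. (pmap ^^ i) v"
  have \<pi>_add: "\<pi> (x + y) = \<pi> x + \<pi> y" and \<pi>_scale: "\<pi> (scale c x) = scale c (\<pi> x)"
    and \<pi>_pmap: "\<pi> (pmap x) = pmap (\<pi> x)" and \<pi>_\<pi>: "\<pi> (\<pi> x) = \<pi> x" for x y c
    using \<pi> by (simp_all add: pmap_projection_def)
  have nil_v: "?v (Suc k) = 0"
    using nil[of v] unfolding v(1) .
  \<comment> \<open>A coordinate function for the top iterate of \<open>v\<close>; the other
    coordinates are derived from it.\<close>
  obtain \<phi> :: "'b \<Rightarrow> 'a" where \<phi>: "\<And>x y. \<phi> (x + y) = \<phi> x + \<phi> y" "\<And>c x. \<phi> (scale c x) = c * \<phi> x"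
    "\<phi> (?v k) = 1" "\<And>s. s \<in> ?v ` {..<k} \<Longrightarrow> \<phi> s = 0"
    by (rule ex_linear_functional[OF pmap_funpow_notin_span[OF v(2) nil_v]]) blast
  have \<phi>_zero: "\<phi> 0 = 0"
    using \<phi>(2)[of 0 0] by simp
  \<comment> \<open>The \<open>j\<close>-fold p-th root undoes the semilinearity of the
    \<open>j\<close>-th iterate, so that each \<open>h j\<close> is linear.\<close>
  define h where "h j u = (frob_root ^^ j) (\<phi> ((pmap ^^ j) u))" for j u
  have h_add: "h j (x + y) = h j x + h j y" and h_scale: "h j (scale c x) = c * h j x" for j x y c
    by (simp_all add: h_def pmap_funpow_add pmap_funpow_scale \<phi>(1,2) frob_root_funpow_add frob_root_funpow_mult)
  have h_pmap: "h j (pmap u) = h (Suc j) u ^ ?p" for j u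
    by (simp add: h_def funpow_swap1[of pmap])
  have h_Suc_k: "h (Suc k) (\<pi> u) = 0" for u
    unfolding h_def nil by (simp add: \<phi>_zero del: funpow.simps)
  \<comment> \<open>The coordinate at the \<open>i\<close>-th iterate of \<open>v\<close> is read
    off after \<open>k - i\<close> further applications of the p-map, which move that iterate to the
    top.\<close>
  define G where "G i u = h (k - i) (\<pi> u)" for i u
  have G_add: "G i (x + y) = G i x + G i y" and G_scale: "G i (scale c x) = c * G i x" for i x y c
    by (simp_all add: G_def \<pi>_add \<pi>_scale h_add h_scale)
  have G_0: "G 0 (pmap u) = 0" for u
    using char_pos by (simp add: G_def \<pi>_pmap h_pmap h_Suc_k)
  have G_Suc: "G (Suc i) (pmap u) = G i u ^ ?p" if "i < k" for i u
    using that by (simp add: G_def \<pi>_pmap h_pmap Suc_diff_Suc)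
  have G_\<pi>: "G i (\<pi> u) = G i u" for i u
    by (simp add: G_def \<pi>_\<pi>)
  have G_v: "G i v = (if i = 0 then 1 else 0)" if "i \<le> k" for i
    using that \<phi>(3) \<phi>(4)[of "?v (k - i)"] by (auto simp: G_def h_def v)
  define e where "e u = (\<Sum>i<Suc k. scale (G i u) (?v i))" for u
  have e_add: "e (x + y) = e x + e y" and e_scale: "e (scale c x) = scale c (e x)" for x y c
    by (simp_all only: e_def G_add G_scale scale_left_distrib sum.distrib scale_sum_right scale_scale)
  have pmap_expand: "pmap (\<Sum>i<Suc k. scale (a i) (?v i)) = (\<Sum>i<k. scale (a i ^ ?p) (?v (Suc i)))" for a
    using nil_v by (simp add: pmap_sum pmap_additive pmap_scale)
  have e_pmap: "e (pmap u) = pmap (e u)" for u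
    unfolding e_def pmap_expand by (subst sum.lessThan_Suc_shift) (simp add: G_0 G_Suc)
  have \<pi>_v: "\<pi> (?v i) = ?v i" for i
    by (induction i) (simp_all add: v(1) \<pi>_pmap)
  have \<pi>_zero: "\<pi> 0 = 0"
    using \<pi>_scale[of 0 0] by simp
  have \<pi>_sum: "\<pi> (sum a A) = (\<Sum>i\<in>A. \<pi> (a i))" for a :: "nat \<Rightarrow> 'b" and A
    by (induction A rule: infinite_finite_induct) (simp_all add: \<pi>_add \<pi>_zero)
  have \<pi>_e: "\<pi> (e u) = e u" for u
    unfolding e_def by (simp only: \<pi>_sum \<pi>_scale \<pi>_v)
  have e_\<pi>: "e (\<pi> u) = e u" for u
    by (simp only: e_def G_\<pi>)
  have e_v: "e v = v"
    unfolding e_def by (subst sum.lessThan_Suc_shift) (simp add: G_v)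
  have e_zero: "e 0 = 0"
    using e_scale[of 0 0] by simp
  have e_sum: "e (sum a A) = (\<Sum>i\<in>A. e (a i))" for a :: "nat \<Rightarrow> 'b" and A
    by (induction A rule: infinite_finite_induct) (simp_all add: e_add e_zero)
  have "e (?v i) = ?v i" for i
    by (induction i) (simp_all add: e_v e_pmap)
  then have e_e: "e (e u) = e u" for u
    by (subst (1 2) e_def) (simp only: e_sum e_scale)
  \<comment> \<open>The same coordinates with the \<open>i\<close>-th iterate of \<open>v\<close>
    replaced by t^(p^i). The p-th power of the last term is the only discrepancy, and it vanishes
    modulo t^(p^(k+1)).\<close>
  define g where "g u = (\<Sum>i<Suc k. monom (G i u) (?p ^ i))" for u
  have g_add: "g (x + y) = g x + g y" and g_scale: "g (scale c x) = smult c (g x)" for x y c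
    by (simp_all only: g_def G_add G_scale add_monom[symmetric] smult_monom[symmetric] sum.distrib poly_vs.scale_sum_right)
  have g_pmap: "monom 1 (?p ^ Suc k) dvd g (pmap x) - g x ^ ?p" for x
  proof -
    have "g x ^ ?p = (\<Sum>i<Suc k. monom (G i x) (?p ^ i) ^ ?p)"
      unfolding g_def using prime_p by (intro freshmans_dream_sum) simp_all
    also have "\<dots> = (\<Sum>i<Suc k. monom (G i x ^ ?p) (?p ^ Suc i))"
      by (simp only: monom_power power_Suc2)
    finally have "g x ^ ?p = (\<Sum>i<k. monom (G i x ^ ?p) (?p ^ Suc i)) + monom (G k x ^ ?p) (?p ^ Suc k)"
      by simp
    moreover have "g (pmap x) = (\<Sum>i<k. monom (G i x ^ ?p) (?p ^ Suc i))"
      unfolding g_def by (subst sum.lessThan_Suc_shift) (simp add: G_0 G_Suc)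
    ultimately show ?thesis
      by (simp add: monom_1_dvd_iff')
  qed
  note ctx = g_add g_scale g_pmap
  have g1: "monom 1 1 dvd g u" for u
    unfolding g_def using char_pos by (intro dvd_sum) (simp add: monom_1_dvd_iff')
  \<comment> \<open>Only the coefficients at t^(p^i) are read, which is where \<open>g\<close>
    places the generators.\<close>
  define r where "r f = (\<Sum>i<Suc k. scale (coeff (poly_hom g f) (?p ^ i)) (?v i))" for f
  have "r (f + f') = r f + r f'" "r (pm_scale c f) = scale c (r f)" for f f' c
    by (simp_all only: r_def poly_hom_add[OF ctx] poly_hom_pm_scale[OF ctx] coeff_add coeff_smult
        scale_left_distrib sum.distrib scale_sum_right scale_scale)
  moreover have "r f = 0" if "f \<in> env_ideal" for f
    unfolding r_def
  proof (rule sum.neutral, rule ballI)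
    fix i assume "i \<in> {..<Suc k}"
    then have "?p ^ i < ?p ^ Suc k"
      using p_ge_2 by (intro power_strict_increasing) auto
    then have "coeff (poly_hom g f) (?p ^ i) = 0"
      by (rule coeff_eq_0_if_monom_dvd[OF poly_hom_mem_enveloping[OF ctx that]])
    then show "scale (coeff (poly_hom g f) (?p ^ i)) (?v i) = 0"
      by simp
  qed
  \<comment> \<open>In a p-th power the coefficient at t^(p^(i+1)) is the p-th power of the one at
    t^(p^i), and the coefficient at t is zero because \<open>p\<close> does not divide 1.\<close>
  moreover have "r (f ^ ?p) = pmap (r f)" for f
  proof -
    have "\<not> ?p dvd 1"
      using p_ge_2 by simp
    then show ?thesis
      unfolding r_def pmap_expand
      by (subst sum.lessThan_Suc_shift)
        (simp add: poly_hom_power[OF ctx] coeff_power_CHAR[OF prime_p] del: funpow.simps)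
  qed
  moreover have "r (free_gen u) = e u" for u
  proof -
    have "coeff (g u) (?p ^ i) = G i u" if "i < Suc k" for i
    proof -
      have "coeff (g u) (?p ^ i) = (\<Sum>j<Suc k. if j = i then G j u else 0)"
        unfolding g_def coeff_sum using p_ge_2 by (intro sum.cong) auto
      then show ?thesis
        using that by (simp del: sum.lessThan_Suc)
    qed
    then show ?thesis
      unfolding r_def e_def poly_hom_free_gen[OF ctx] by (intro sum.cong) auto
  qed
  \<comment> \<open>Such a product maps to a multiple of t^2, so the summand for t^(p^0) = t drops
    out and only positive iterates of \<open>v\<close> remain.\<close>
  moreover have "r (f * f') \<in> range pmap" if "aug f = 0" "aug f' = 0" for f f'
  proof -
    have "coeff (poly_hom g (f * f')) 1 = 0"
      by (rule coeff_eq_0_if_monom_dvd[OF poly_hom_mult_aug[OF ctx g1 that]]) simp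
    then have "r (f * f') = (\<Sum>i<k. scale (coeff (poly_hom g (f * f')) (?p ^ Suc i)) (?v (Suc i)))"
      unfolding r_def by (subst sum.lessThan_Suc_shift) simp
    also have "\<dots> \<in> range pmap"
      by (intro subspace_sum[OF subspace_range_pmap] subspace_scale[OF subspace_range_pmap]) simp
    finally show ?thesis .
  qed
  ultimately have "aug_retract e r"
    by (simp add: aug_retract_def)
  moreover have "pmap_projection e"
    by (simp add: pmap_projection_def e_add e_scale e_pmap e_e)
  ultimately show ?thesis
    using e_v \<pi>_e e_\<pi> by blast
qed

lemma aug_retract_add:
  assumes "aug_retract \<pi> r" "aug_retract e s"
  shows "aug_retract (\<lambda>u. \<pi> u + e u) (\<lambda>f. r f + s f)"
  using assms subspace_add[OF subspace_range_pmap]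
  by (simp add: aug_retract_def scale_right_distrib pmap_additive algebra_simps)

end

context abelian_restricted_lie_algebra
begin

text \<open>Induction on the rank of the projection: a vector of maximal nilpotency order in its
  image generates a cyclic summand, and the map for the remaining part is added to the one for this
  summand.\<close>

lemma ex_aug_retract:
  assumes fd: "finite_dimensional_vector_space scale B" and nil: "\<And>x. (pmap ^^ N) x = 0"
    and \<pi>: "pmap_projection \<pi>"
  shows "\<exists>r. aug_retract \<pi> r"
proof -
  interpret fd: finite_dimensional_vector_space scale B by fact
  show ?thesis
    using \<pi>
  proof (induction "dim (range \<pi>)" arbitrary: \<pi> rule: less_induct)
    case less
    show ?case
    proof (cases "\<forall>u. \<pi> u = 0")
      case True
      have "0 \<in> range pmap"
        by (rule subspace_0[OF subspace_range_pmap])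
      then have "aug_retract \<pi> (\<lambda>_. 0)"
        using True by (simp add: aug_retract_def)
      then show ?thesis by blast
    next
      case False
      have \<pi>: "\<pi> (x + y) = \<pi> x + \<pi> y" "\<pi> (scale c x) = scale c (\<pi> x)"
        "\<pi> (pmap x) = pmap (\<pi> x)" "\<pi> (\<pi> x) = \<pi> x" for x y c
        using less.prems by (simp_all add: pmap_projection_def)
      define n where "n = (LEAST n. \<forall>u. (pmap ^^ n) (\<pi> u) = 0)"
      have n: "\<forall>u. (pmap ^^ n) (\<pi> u) = 0"
        unfolding n_def by (rule LeastI[of _ N]) (simp add: nil)
      with False have "n \<noteq> 0"
        by (metis funpow_0)
      then obtain k where k: "n = Suc k"
        by (cases n) auto
      then have "\<not> (\<forall>u. (pmap ^^ k) (\<pi> u) = 0)"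
        unfolding n_def by (intro not_less_Least) simp
      then obtain u where u: "(pmap ^^ k) (\<pi> u) \<noteq> 0"
        by blast
      have nil_k: "(pmap ^^ Suc k) (\<pi> x) = 0" for x
        using n unfolding k by blast
      obtain e r where e: "pmap_projection e" and r: "aug_retract e r" and ev: "e (\<pi> u) = \<pi> u"
        and \<pi>e: "\<And>x. \<pi> (e x) = e x" and e\<pi>: "\<And>x. e (\<pi> x) = e x"
        using cyclic_aug_retract[OF less.prems nil_k \<pi>(4) u] by blast
      have e': "e (x + y) = e x + e y" "e (scale c x) = scale c (e x)"
        "e (pmap x) = pmap (e x)" "e (e x) = e x" for x y c
        using e by (simp_all add: pmap_projection_def)
      have \<pi>_diff: "\<pi> (x - y) = \<pi> x - \<pi> y" and e_diff: "e (x - y) = e x - e y" for x y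
        using \<pi>(1)[of "x - y" y] e'(1)[of "x - y" y] by simp_all
      have pmap_diff: "pmap (x - y) = pmap x - pmap y" for x y
        using pmap_additive[of "x - y" y] by simp
      \<comment> \<open>Because \<open>e\<close> is absorbed by \<open>\<pi>\<close> on both sides,
        the difference is again an equivariant idempotent.\<close>
      let ?\<pi> = "\<lambda>x. \<pi> x - e x"
      have proj: "pmap_projection ?\<pi>"
        by (simp add: pmap_projection_def \<pi> e' \<pi>_diff e_diff pmap_diff \<pi>e e\<pi> scale_right_diff_distrib)
      have sub: "subspace (range f)" if "pmap_projection f" for f
      proof (rule subspaceI)
        have f: "f (x + y) = f x + f y" "f (scale c x) = scale c (f x)" for x y c
          using that by (simp_all add: pmap_projection_def)
        show "0 \<in> range f"
          using f(2)[of 0 0] by (intro range_eqI[of _ _ 0]) simp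
        show "x + y \<in> range f" if "x \<in> range f" "y \<in> range f" for x y
          using that by (auto simp flip: f(1))
        show "scale c x \<in> range f" if "x \<in> range f" for x c
          using that by (auto simp flip: f(2))
      qed
      have "range ?\<pi> \<subset> range \<pi>"
      proof
        show "range ?\<pi> \<subseteq> range \<pi>"
        proof (rule image_subsetI)
          fix x
          have "\<pi> x - e x = \<pi> (x - e x)"
            by (simp add: \<pi>_diff \<pi>e)
          then show "\<pi> x - e x \<in> range \<pi>"
            by (rule range_eqI)
        qed
        \<comment> \<open>\<open>e\<close> fixes this nonzero vector but kills the image of the new
          projection, so the rank drops.\<close>
        have "\<pi> u \<notin> range ?\<pi>"
        proof
          assume "\<pi> u \<in> range ?\<pi>"
          then obtain x where x: "\<pi> u = ?\<pi> x" by blast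
          have "e (?\<pi> x) = 0"
            by (simp add: e_diff e\<pi> e')
          then have "\<pi> u = 0"
            using ev x by simp
          then show False
            using u by simp
        qed
        then show "range ?\<pi> \<noteq> range \<pi>"
          by blast
      qed
      then have "span (range ?\<pi>) \<subset> span (range \<pi>)"
        using span_eq_iff[THEN iffD2, OF sub[OF proj]] span_eq_iff[THEN iffD2, OF sub[OF less.prems]]
        by (simp del: span_eq_iff)
      then have "dim (range ?\<pi>) < dim (range \<pi>)"
        by (rule fd.dim_psubset)
      then obtain s where "aug_retract ?\<pi> s"
        using less.hyps proj by blast
      from aug_retract_add[OF this r] show ?thesis
        by auto
    qed
  qed
qed

text \<open>A version of Nakayama's lemma: feeding the hypothesis into itself gives every
  \<open>h\<close> in \<open>W\<close> modulo the image of the \<open>n\<close>-th iterate, and the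
  \<open>N\<close>-th iterate is zero.\<close>

lemma nilpotent_generation:
  assumes nil: "\<And>x. (pmap ^^ N) x = 0" and W: "subspace W" and stable: "\<And>w. w \<in> W \<Longrightarrow> pmap w \<in> W"
    and gen: "\<And>h. \<exists>w\<in>W. h - w \<in> range pmap"
  shows "W = UNIV"
proof -
  have "\<exists>w\<in>W. h - w \<in> range (pmap ^^ n)" for n h
  proof (induction n)
    case 0
    show ?case
      using subspace_0[OF W] by (intro bexI[of _ 0]) simp_all
  next
    case (Suc n)
    then obtain w u where w: "w \<in> W" "h - w = (pmap ^^ n) u"
      by blast
    obtain w' y where w': "w' \<in> W" "u - w' = pmap y"
      using gen[of u] by blast
    have "u = w' + pmap y"
      using w'(2) by (simp add: algebra_simps)
    then have "h - (w + (pmap ^^ n) w') = (pmap ^^ Suc n) y"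
      using w(2) by (simp add: pmap_funpow_add algebra_simps funpow_swap1)
    moreover have "(pmap ^^ n) w' \<in> W"
      by (induction n) (simp_all add: w' stable)
    then have "w + (pmap ^^ n) w' \<in> W"
      using w(1) by (intro subspace_add[OF W])
    ultimately show ?case
      by (intro bexI[of _ "w + (pmap ^^ n) w'"]) simp_all
  qed
  from this[of _ N] have "h \<in> W" for h
    by (auto simp: nil)
  then show ?thesis by blast
qed

text \<open>The maximum over a basis works, because the kernel of an iterate of the semilinear p-map
  is a subspace.\<close>

lemma ex_uniform_nilpotency:
  assumes "finite_dimensional_vector_space scale B" and nil: "p_nilpotent pmap"
  obtains N where "\<And>x. (pmap ^^ N) x = 0"
proof -
  interpret fd: finite_dimensional_vector_space scale B by fact
  obtain s where s: "(pmap ^^ s x) x = 0" for x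
    using nil by (metis p_nilpotent_def)
  define N where "N = Max (insert 0 (s ` B))"
  have "(pmap ^^ N) b = 0" if "b \<in> B" for b
    using that fd.finite_Basis by (intro pmap_funpow_eq_0_mono[OF s]) (simp add: N_def)
  then have "span B \<subseteq> {x. (pmap ^^ N) x = 0}"
    by (intro span_minimal subspaceI) (auto simp: pmap_funpow_add pmap_funpow_scale)
  then show thesis
    using that[of N] fd.span_Basis by blast
qed

end

subsection \<open>Transport along an isomorphism of enveloping algebras\<close>

lemma (in quotient_iso) commute_transfer:
  assumes "\<And>f g. f * g - g * f \<in> I"
  shows "f * g - g * f \<in> J"
proof -
  obtain a b where a: "\<psi> a - f \<in> J" and b: "\<psi> b - g \<in> J"
    using iso_surj by blast
  note trans = two_sided_ideal_cong_trans[OF J] and sym = two_sided_ideal_cong_sym[OF J]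
  have "f * g - \<psi> (a * b) \<in> J" and "\<psi> (b * a) - g * f \<in> J"
    using trans[OF two_sided_ideal_cong_mult[OF J sym[OF a] sym[OF b]] sym[OF iso_mult]]
      trans[OF iso_mult two_sided_ideal_cong_mult[OF J b a]] .
  moreover have "\<psi> (a * b) - \<psi> (b * a) \<in> J"
    unfolding iso_cong_iff by (rule assms)
  ultimately show ?thesis
    using trans by blast
qed

text \<open>The bound \<open>N\<close> is assumed on the side of \<open>L\<close> and then proved
  for \<open>H\<close>; this allows the locale to be used again in the opposite direction with the
  same \<open>N\<close>.\<close>

locale isomorphic_enveloping =
  L: abelian_restricted_lie_algebra scaleL bracketL pmapL +
  H: abelian_restricted_lie_algebra scaleH bracketH pmapH +
  quotient_iso L.env_ideal H.env_ideal \<psi>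
  for scaleL :: "'f::field \<Rightarrow> 'a::ab_group_add \<Rightarrow> 'a" and bracketL pmapL
    and scaleH :: "'f \<Rightarrow> 'b::ab_group_add \<Rightarrow> 'b" and bracketH pmapH \<psi> +
  fixes N :: nat
  assumes nil: "(pmapL ^^ N) x = 0"
begin

lemma aug_cong: "f - g \<in> H.env_ideal \<Longrightarrow> aug f = aug g"
  using H.aug_mem_enveloping[of "f - g"] by (simp add: aug_diff)

text \<open>In \<open>u(L)\<close> the element \<open>f\<close> minus its augmentation is nilpotent,
  hence so is its image, and a nilpotent element has augmentation zero in the field.\<close>

lemma iso_aug: "aug (\<psi> f) = aug f"
proof -
  let ?P = "CHAR('f) ^ N" and ?f = "f - pm_scale (aug f) 1"
  have "?f ^ ?P - pm_scale (aug ?f ^ ?P) 1 \<in> L.env_ideal"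
    by (rule L.power_mod_enveloping_nilpotent[OF nil])
  then have "?f ^ ?P \<in> L.env_ideal"
    using L.char_pos by (simp add: aug_diff aug_pm_scale zero_power)
  then have "\<psi> (?f ^ ?P) \<in> H.env_ideal"
    by (simp only: iso_mem_iff)
  then have "\<psi> ?f ^ ?P \<in> H.env_ideal"
    using two_sided_ideal_cong_mem[OF J iso_power] by blast
  then have "aug (\<psi> ?f ^ ?P) = 0"
    by (rule H.aug_mem_enveloping)
  then have "aug (\<psi> ?f) = 0"
    using L.char_pos by (simp add: aug_power)
  moreover have "aug (\<psi> ?f) = aug (\<psi> f) - aug (\<psi> (pm_scale (aug f) 1))"
    using aug_cong[OF iso_diff] by (simp add: aug_diff)
  moreover have "aug (\<psi> (pm_scale (aug f) 1)) = aug f"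
    using aug_cong[OF iso_scale] aug_cong[OF iso_one] by (simp add: aug_pm_scale)
  ultimately show ?thesis
    by simp
qed

text \<open>A generator \<open>h\<close> is the image of an element of augmentation zero, whose
  \<open>p ^ N\<close>-th power vanishes; injectivity of H -> u(H) turns this into a statement about
  the p-map.\<close>

lemma iso_nilpotent: "(pmapH ^^ N) h = 0"
proof -
  let ?P = "CHAR('f) ^ N"
  obtain f where f: "\<psi> f - free_gen h \<in> H.env_ideal"
    using iso_surj by blast
  have "aug f = 0"
    using aug_cong[OF f] by (simp add: iso_aug)
  then have "f ^ ?P \<in> L.env_ideal"
    using L.power_mod_enveloping_nilpotent[OF nil, of f] L.char_pos by (simp add: zero_power)
  then have "\<psi> (f ^ ?P) \<in> H.env_ideal"
    by (simp only: iso_mem_iff)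
  then have "\<psi> f ^ ?P \<in> H.env_ideal"
    using two_sided_ideal_cong_mem[OF J iso_power] by blast
  then have "free_gen h ^ ?P \<in> H.env_ideal"
    using two_sided_ideal_cong_mem[OF J two_sided_ideal_cong_power[OF J f]] by blast
  then have "free_gen ((pmapH ^^ N) h) \<in> H.env_ideal"
    using two_sided_ideal_cong_mem[OF J H.free_gen_power_mod_enveloping] by blast
  then show ?thesis
    using H.free_gen_mem_enveloping_ideal_iff H.bracket_eq_0 by (simp add: abelian_bracket_def)
qed

text \<open>The preimage of M^2 in the free algebra over \<open>H\<close>, so that arguments modulo
  M^2 become membership in one subspace.\<close>

definition decomposable :: "('b free_word \<Rightarrow>\<^sub>0 'f) set" where
  "decomposable = {f. \<exists>m\<in>aug_square. f - m \<in> H.env_ideal}"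

lemma decomposable_subspace: "pm.subspace decomposable"
proof (rule pm.subspaceI)
  show "0 \<in> decomposable"
    using two_sided_ideal_zero[OF J] pm.subspace_0[OF aug_square_subspace]
    by (auto simp: decomposable_def intro!: bexI[of _ 0])
  fix f g c
  assume "f \<in> decomposable"
  then obtain m where m: "m \<in> aug_square" "f - m \<in> H.env_ideal"
    by (auto simp: decomposable_def)
  have "pm_scale c f - pm_scale c m \<in> H.env_ideal"
    using pm_scale_mem[OF m(2)] by (simp add: pm.scale_right_diff_distrib)
  then show "pm_scale c f \<in> decomposable"
    using pm.subspace_scale[OF aug_square_subspace m(1)] by (auto simp: decomposable_def)
  assume "g \<in> decomposable"
  then obtain k where k: "k \<in> aug_square" "g - k \<in> H.env_ideal"
    by (auto simp: decomposable_def)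
  have "f + g - (m + k) \<in> H.env_ideal"
    using m k by (intro two_sided_ideal_cong_add[OF J])
  then show "f + g \<in> decomposable"
    using pm.subspace_add[OF aug_square_subspace m(1) k(1)] by (auto simp: decomposable_def)
qed

lemma decomposable_ideal: "f \<in> H.env_ideal \<Longrightarrow> f \<in> decomposable"
  using pm.subspace_0[OF aug_square_subspace] by (auto simp: decomposable_def intro!: bexI[of _ 0])

lemma decomposable_cong: "f - g \<in> H.env_ideal \<Longrightarrow> f \<in> decomposable \<longleftrightarrow> g \<in> decomposable"
  using pm.subspace_diff[OF decomposable_subspace _ decomposable_ideal, of f "f - g"]
    pm.subspace_add[OF decomposable_subspace _ decomposable_ideal, of g "f - g"] by auto

lemma iso_aug_square:
  assumes "m \<in> aug_square"
  shows "\<psi> m \<in> decomposable"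
  using assms
proof (induction rule: aug_square_induct)
  case subspace
  show ?case
  proof (rule pm.subspaceI)
    show "0 \<in> {m. \<psi> m \<in> decomposable}"
      using two_sided_ideal_zero[OF I] iso_mem_iff[of 0] decomposable_ideal by simp
    fix f g c
    assume f: "f \<in> {m. \<psi> m \<in> decomposable}"
    then show "pm_scale c f \<in> {m. \<psi> m \<in> decomposable}"
      using decomposable_cong[OF iso_scale] pm.subspace_scale[OF decomposable_subspace] by simp
    assume "g \<in> {m. \<psi> m \<in> decomposable}"
    with f show "f + g \<in> {m. \<psi> m \<in> decomposable}"
      using decomposable_cong[OF iso_add] pm.subspace_add[OF decomposable_subspace] by simp
  qed
next
  case (mult f g)
  then have "\<psi> f * \<psi> g \<in> aug_square"
    by (intro aug_square_mult) (simp_all add: iso_aug)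
  then show ?case
    unfolding decomposable_cong[OF iso_mult] by (auto simp: decomposable_def two_sided_ideal_zero[OF J] intro!: bexI)
qed

text \<open>The decomposition is applied in \<open>u(L)\<close>: a preimage of \<open>h\<close> has
  augmentation zero, so it is a generator plus an element of \<open>aug_square\<close>, and
  \<open>\<psi>\<close> makes the latter decomposable.\<close>

lemma iso_free_gen: "\<exists>l. \<psi> (free_gen l) - free_gen h \<in> decomposable"
proof -
  obtain f where f: "\<psi> f - free_gen h \<in> H.env_ideal"
    using iso_surj by blast
  then have "aug f = 0"
    using aug_cong[OF f] by (simp add: iso_aug)
  then obtain l m where m: "m \<in> aug_square" and l: "f - (free_gen l + m) \<in> L.env_ideal"
    using L.free_gen_decomposition[of f] by auto
  have "\<psi> f - (\<psi> (free_gen l) + \<psi> m) \<in> H.env_ideal"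
    using l unfolding iso_cong_iff[symmetric] by (rule two_sided_ideal_cong_trans[OF J _ iso_add])
  then have "(\<psi> f - free_gen h) - (\<psi> f - (\<psi> (free_gen l) + \<psi> m)) - \<psi> m \<in> decomposable"
    by (rule pm.subspace_diff[OF decomposable_subspace pm.subspace_diff[OF decomposable_subspace
          decomposable_ideal[OF f] decomposable_ideal] iso_aug_square[OF m]])
  then have "\<psi> (free_gen l) - free_gen h \<in> decomposable"
    by (simp add: algebra_simps)
  then show ?thesis by blast
qed

lemma decomposable_free_gen: "free_gen h \<in> decomposable \<Longrightarrow> h \<in> range pmapH"
  using H.free_gen_aug_square_imp_range_pmap by (auto simp: decomposable_def)

lemma free_gen_diff_mod: "free_gen (x - y) - (free_gen x - free_gen y) \<in> H.env_ideal"
  using two_sided_ideal_uminus[OF J enveloping_ideal_free_gen_add[of "x - y" y scaleH bracketH pmapH]]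
  by (simp add: algebra_simps)

text \<open>Take representatives in \<open>H\<close> of the images of a basis of \<open>L\<close>
  modulo M^2, with their iterates under the p-map below \<open>N\<close>. The span is stable under
  the p-map and covers \<open>H\<close> modulo the image of the p-map, so it is everything.\<close>

lemma iso_finite_dimensional:
  assumes "finite_dimensional_vector_space scaleL B"
  shows "\<exists>C. finite_dimensional_vector_space scaleH C"
proof -
  interpret fd: finite_dimensional_vector_space scaleL B by fact
  have "\<exists>h. \<psi> (free_gen b) - free_gen h \<in> decomposable" for b
  proof -
    obtain v m where m: "m \<in> aug_square"
      and v: "\<psi> (free_gen b) - (pm_scale (aug (\<psi> (free_gen b))) 1 + free_gen v + m) \<in> H.env_ideal"
      using H.free_gen_decomposition by blast
    then have "\<psi> (free_gen b) - free_gen v - m \<in> H.env_ideal"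
      by (simp add: iso_aug algebra_simps)
    then show ?thesis
      using m by (auto simp: decomposable_def)
  qed
  then obtain \<eta> where \<eta>: "\<psi> (free_gen b) - free_gen (\<eta> b) \<in> decomposable" for b
    by metis
  define S where "S = (\<lambda>(i, b). (pmapH ^^ i) (\<eta> b)) ` ({..<N} \<times> B)"
  have S: "finite S"
    using fd.finite_Basis by (simp add: S_def)
  \<comment> \<open>For \<open>N = 0\<close> the index set of \<open>S\<close> is empty, but then
    \<open>H\<close> is zero.\<close>
  have N: "N \<noteq> 0" if "h \<noteq> 0" for h :: 'b
    using iso_nilpotent[of h] that by (metis funpow_0)
  have \<eta>_span: "\<eta> b \<in> H.span S" if "b \<in> B" for b
  proof (cases "\<eta> b = 0")
    case False
    then have "(\<lambda>(i, b). (pmapH ^^ i) (\<eta> b)) (0, b) \<in> S"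
      using that N unfolding S_def by (intro imageI) auto
    then show ?thesis
      by (intro H.span_base) simp
  qed (simp add: H.span_zero)
  have "L.span B \<subseteq> {l. \<exists>s\<in>H.span S. \<psi> (free_gen l) - free_gen s \<in> decomposable}"
  proof (rule L.span_minimal)
    show "B \<subseteq> {l. \<exists>s\<in>H.span S. \<psi> (free_gen l) - free_gen s \<in> decomposable}"
      using \<eta> \<eta>_span by blast
    show "L.subspace {l. \<exists>s\<in>H.span S. \<psi> (free_gen l) - free_gen s \<in> decomposable}"
    proof (rule L.subspaceI)
      have "free_gen 0 \<in> L.env_ideal" "free_gen 0 \<in> H.env_ideal"
        using L.free_gen_mem_enveloping_ideal_iff H.free_gen_mem_enveloping_ideal_iff L.bracket_eq_0 H.bracket_eq_0
        by (simp_all add: abelian_bracket_def)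
      then have "\<psi> (free_gen 0) - free_gen 0 \<in> H.env_ideal"
        by (intro two_sided_ideal_diff[OF J]) (simp_all only: iso_mem_iff)
      then show "0 \<in> {l. \<exists>s\<in>H.span S. \<psi> (free_gen l) - free_gen s \<in> decomposable}"
        using H.span_zero decomposable_ideal by blast
      fix x y c
      assume "x \<in> {l. \<exists>s\<in>H.span S. \<psi> (free_gen l) - free_gen s \<in> decomposable}"
      then obtain s where s: "s \<in> H.span S" "\<psi> (free_gen x) - free_gen s \<in> decomposable"
        by blast
      have "\<psi> (free_gen (scaleL c x)) - \<psi> (pm_scale c (free_gen x)) \<in> H.env_ideal"
        unfolding iso_cong_iff by (rule enveloping_ideal_free_gen_scale)
      then have "\<psi> (free_gen (scaleL c x)) - pm_scale c (\<psi> (free_gen x)) \<in> H.env_ideal"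
        by (rule two_sided_ideal_cong_trans[OF J _ iso_scale])
      moreover have "free_gen (scaleH c s) - pm_scale c (free_gen s) \<in> H.env_ideal"
        by (rule enveloping_ideal_free_gen_scale)
      ultimately have "(\<psi> (free_gen (scaleL c x)) - pm_scale c (\<psi> (free_gen x)))
          - (free_gen (scaleH c s) - pm_scale c (free_gen s)) \<in> H.env_ideal"
        by (rule two_sided_ideal_diff[OF J])
      then have "(\<psi> (free_gen (scaleL c x)) - free_gen (scaleH c s)) - pm_scale c (\<psi> (free_gen x) - free_gen s) \<in> H.env_ideal"
        by (simp add: algebra_simps pm.scale_right_diff_distrib)
      then have "\<psi> (free_gen (scaleL c x)) - free_gen (scaleH c s) \<in> decomposable"
        using decomposable_cong pm.subspace_scale[OF decomposable_subspace s(2)] by blast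
      then show "scaleL c x \<in> {l. \<exists>s\<in>H.span S. \<psi> (free_gen l) - free_gen s \<in> decomposable}"
        using H.span_scale[OF s(1)] by blast
      assume "y \<in> {l. \<exists>s\<in>H.span S. \<psi> (free_gen l) - free_gen s \<in> decomposable}"
      then obtain t where t: "t \<in> H.span S" "\<psi> (free_gen y) - free_gen t \<in> decomposable"
        by blast
      have "\<psi> (free_gen (x + y)) - \<psi> (free_gen x + free_gen y) \<in> H.env_ideal"
        unfolding iso_cong_iff by (rule enveloping_ideal_free_gen_add)
      then have "\<psi> (free_gen (x + y)) - (\<psi> (free_gen x) + \<psi> (free_gen y)) \<in> H.env_ideal"
        by (rule two_sided_ideal_cong_trans[OF J _ iso_add])
      moreover have "free_gen (s + t) - (free_gen s + free_gen t) \<in> H.env_ideal"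
        by (rule enveloping_ideal_free_gen_add)
      ultimately have "(\<psi> (free_gen (x + y)) - (\<psi> (free_gen x) + \<psi> (free_gen y)))
          - (free_gen (s + t) - (free_gen s + free_gen t)) \<in> H.env_ideal"
        by (rule two_sided_ideal_diff[OF J])
      then have "(\<psi> (free_gen (x + y)) - free_gen (s + t)) - ((\<psi> (free_gen x) - free_gen s) + (\<psi> (free_gen y) - free_gen t)) \<in> H.env_ideal"
        by (simp add: algebra_simps)
      then have "\<psi> (free_gen (x + y)) - free_gen (s + t) \<in> decomposable"
        using decomposable_cong pm.subspace_add[OF decomposable_subspace s(2) t(2)] by blast
      then show "x + y \<in> {l. \<exists>s\<in>H.span S. \<psi> (free_gen l) - free_gen s \<in> decomposable}"
        using H.span_add[OF s(1) t(1)] by blast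
    qed
  qed
  then have lift: "\<exists>s\<in>H.span S. \<psi> (free_gen l) - free_gen s \<in> decomposable" for l
    using fd.span_Basis by blast
  have "H.span S = UNIV"
  proof (rule H.nilpotent_generation[OF iso_nilpotent])
    have "S \<subseteq> {s. pmapH s \<in> H.span S}"
    proof
      fix x assume "x \<in> S"
      then obtain i b where ib: "i < N" "b \<in> B" "x = (pmapH ^^ i) (\<eta> b)"
        by (auto simp: S_def)
      show "x \<in> {s. pmapH s \<in> H.span S}"
      proof (cases "Suc i < N")
        case True
        then have "(\<lambda>(i, b). (pmapH ^^ i) (\<eta> b)) (Suc i, b) \<in> S"
          using ib unfolding S_def by (intro imageI) auto
        then show ?thesis
          by (simp add: ib H.span_base)
      next
        case False
        then have "Suc i = N"
          using ib by simp
        then have "pmapH x = (pmapH ^^ N) (\<eta> b)"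
          by (auto simp: ib)
        then show ?thesis
          by (simp add: iso_nilpotent H.span_zero)
      qed
    qed
    moreover have "H.subspace {s. pmapH s \<in> H.span S}"
      by (rule H.subspaceI) (simp_all add: H.pmap_additive H.pmap_scale H.span_zero H.span_add H.span_scale)
    ultimately have "H.span S \<subseteq> {s. pmapH s \<in> H.span S}"
      by (rule H.span_minimal)
    then show "pmapH w \<in> H.span S" if "w \<in> H.span S" for w
      using that by blast
    fix h
    obtain l where l: "\<psi> (free_gen l) - free_gen h \<in> decomposable"
      using iso_free_gen by blast
    obtain s where s: "s \<in> H.span S" "\<psi> (free_gen l) - free_gen s \<in> decomposable"
      using lift by blast
    have "(\<psi> (free_gen l) - free_gen s) - (\<psi> (free_gen l) - free_gen h) \<in> decomposable"
      by (rule pm.subspace_diff[OF decomposable_subspace s(2) l])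
    then have "free_gen (h - s) \<in> decomposable"
      unfolding decomposable_cong[OF free_gen_diff_mod] by (simp add: algebra_simps)
    then show "\<exists>w\<in>H.span S. h - w \<in> range pmapH"
      using s(1) decomposable_free_gen by blast
  qed simp
  obtain C where C: "C \<subseteq> S" "H.independent C" "S \<subseteq> H.span C"
    using H.maximal_independent_subset[of S] by blast
  have "H.span C = UNIV"
    using H.span_minimal[OF C(3) H.subspace_span] \<open>H.span S = UNIV\<close> by blast
  then have "finite_dimensional_vector_space scaleH C"
    using C finite_subset[OF C(1) S] by unfold_locales auto
  then show ?thesis by blast
qed

lemma equivariant_surjection:
  assumes fd: "finite_dimensional_vector_space scaleH C"
  shows "\<exists>\<theta>. Vector_Spaces.linear scaleL scaleH \<theta> \<and> surj \<theta> \<and> (\<forall>x. \<theta> (pmapL x) = pmapH (\<theta> x))"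
proof -
  have "H.pmap_projection (\<lambda>h. h)"
    by (simp add: H.pmap_projection_def)
  then obtain r where "H.aug_retract (\<lambda>h. h) r"
    using H.ex_aug_retract[OF fd iso_nilpotent] by blast
  then have r: "r (f + g) = r f + r g" "r (pm_scale c f) = scaleH c (r f)"
    "f \<in> H.env_ideal \<Longrightarrow> r f = 0" "r (f ^ CHAR('f)) = pmapH (r f)" "r (free_gen h) = h"
    "aug f = 0 \<Longrightarrow> aug g = 0 \<Longrightarrow> r (f * g) \<in> range pmapH" for f g c h
    by (simp_all add: H.aug_retract_def)
  have r_diff: "r (f - g) = r f - r g" for f g
    using r(1)[of "f - g" g] by simp
  have r_cong: "r f = r g" if "f - g \<in> H.env_ideal" for f g
    using r(3)[OF that] by (simp add: r_diff)
  have r_zero: "r 0 = 0"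
    using r_diff[of 0 0] by simp
  have r_aug_square: "r m \<in> range pmapH" if "m \<in> aug_square" for m
    using that
  proof (induction rule: aug_square_induct)
    case subspace
    show ?case
      by (rule pm.subspaceI)
        (simp_all only: mem_Collect_eq r r_zero H.subspace_0[OF H.subspace_range_pmap]
          H.subspace_add[OF H.subspace_range_pmap] H.subspace_scale[OF H.subspace_range_pmap])
  qed (rule r(6))
  have r_decomposable: "r f \<in> range pmapH" if f: "f \<in> decomposable" for f
  proof -
    obtain m where "m \<in> aug_square" "f - m \<in> H.env_ideal"
      using f by (auto simp: decomposable_def)
    then show ?thesis
      using r_aug_square r_cong[of f m] by simp
  qed
  define \<theta> where "\<theta> l = r (\<psi> (free_gen l))" for l
  have add: "\<theta> (x + y) = \<theta> x + \<theta> y" for x y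
  proof -
    have "\<psi> (free_gen (x + y)) - \<psi> (free_gen x + free_gen y) \<in> H.env_ideal"
      unfolding iso_cong_iff by (rule enveloping_ideal_free_gen_add)
    then show ?thesis
      using r_cong[OF iso_add] by (simp add: \<theta>_def r_cong r(1))
  qed
  have scale: "\<theta> (scaleL c x) = scaleH c (\<theta> x)" for x c
  proof -
    have "\<psi> (free_gen (scaleL c x)) - \<psi> (pm_scale c (free_gen x)) \<in> H.env_ideal"
      unfolding iso_cong_iff by (rule enveloping_ideal_free_gen_scale)
    then show ?thesis
      using r_cong[OF iso_scale] by (simp add: \<theta>_def r_cong r(2))
  qed
  have pmap: "\<theta> (pmapL x) = pmapH (\<theta> x)" for x
  proof -
    have "\<psi> (free_gen (pmapL x)) - \<psi> (free_gen x ^ CHAR('f)) \<in> H.env_ideal"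
      unfolding iso_cong_iff by (rule enveloping_ideal_free_gen_pmap)
    then show ?thesis
      using r_cong[OF iso_power] by (simp add: \<theta>_def r_cong r(4))
  qed
  have lin: "Vector_Spaces.linear scaleL scaleH \<theta>"
    by (simp add: Vector_Spaces.linear_iff add scale L.vector_space_axioms H.vector_space_axioms)
  have "range \<theta> = UNIV"
  proof (rule H.nilpotent_generation[OF iso_nilpotent])
    show "H.subspace (range \<theta>)"
    proof (rule H.subspaceI)
      show "0 \<in> range \<theta>"
        using scale[of 0 0] by (intro range_eqI[of _ _ 0]) simp
      show "x + y \<in> range \<theta>" if "x \<in> range \<theta>" "y \<in> range \<theta>" for x y
        using that by (auto simp flip: add)
      show "scaleH c x \<in> range \<theta>" if "x \<in> range \<theta>" for x c
        using that by (auto simp flip: scale)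
    qed
    show "pmapH w \<in> range \<theta>" if "w \<in> range \<theta>" for w
      using that by (auto simp flip: pmap)
    fix h
    obtain l where "\<psi> (free_gen l) - free_gen h \<in> decomposable"
      using iso_free_gen by blast
    \<comment> \<open>The retraction fixes the generator \<open>h\<close> and sends the decomposable
      difference into the image of the p-map.\<close>
    then have "\<theta> l - h \<in> range pmapH"
      using r_decomposable by (auto simp: \<theta>_def r_diff r(5) dest!: r_decomposable)
    then have "- (\<theta> l - h) \<in> range pmapH"
      by (rule H.subspace_neg[OF H.subspace_range_pmap])
    then have "h - \<theta> l \<in> range pmapH"
      by simp
    then show "\<exists>w\<in>range \<theta>. h - w \<in> range pmapH"
      by blast
  qed
  with lin pmap show ?thesis
    by blast
qed

end

theorem proposition2p5:
  fixes scaleL :: "'f::field \<Rightarrow> 'a::ab_group_add \<Rightarrow> 'a"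
    and bracketL :: "'a \<Rightarrow> 'a \<Rightarrow> 'a"
    and pmapL :: "'a \<Rightarrow> 'a"
    and scaleH :: "'f \<Rightarrow> 'b::ab_group_add \<Rightarrow> 'b"
    and bracketH :: "'b \<Rightarrow> 'b \<Rightarrow> 'b"
    and pmapH :: "'b \<Rightarrow> 'b"
  assumes "CHAR('f) > 0"
    and "perfect_field TYPE('f)"
    and "restricted_lie_algebra scaleL bracketL pmapL"
    and "\<exists>B. finite_dimensional_vector_space scaleL B"
    and "p_nilpotent pmapL"
    and "abelian_bracket bracketL"
    and "restricted_lie_algebra scaleH bracketH pmapH"
    and "algebra_isomorphic
           (restricted_enveloping_algebra scaleL bracketL pmapL)
           (restricted_enveloping_algebra scaleH bracketH pmapH)"
  shows "restricted_lie_isomorphic scaleL bracketL pmapL scaleH bracketH pmapH"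
proof -
  interpret RL: restricted_lie_algebra scaleL bracketL pmapL by fact
  interpret RH: restricted_lie_algebra scaleH bracketH pmapH by fact
  have perfect: "surj (\<lambda>x::'f. x ^ CHAR('f))"
    using assms(1,2) by (simp add: perfect_field_def)
  interpret L: abelian_restricted_lie_algebra scaleL bracketL pmapL
    using assms(6) perfect by unfold_locales (simp_all add: abelian_bracket_def)
  obtain \<psi> where "quotient_iso RL.env_ideal RH.env_ideal \<psi>"
    using algebra_isomorphic_imp_quotient_iso[OF assms(8)] by blast
  then interpret iso: quotient_iso RL.env_ideal RH.env_ideal \<psi> .
  have "abelian_bracket bracketH"
    by (rule RH.abelian_if_commutative_enveloping, rule iso.commute_transfer, rule L.commute_mod_enveloping)
  then interpret H: abelian_restricted_lie_algebra scaleH bracketH pmapH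
    using perfect by unfold_locales (simp_all add: abelian_bracket_def)
  obtain B where B: "finite_dimensional_vector_space scaleL B"
    using assms(4) by blast
  obtain N where N: "\<And>x. (pmapL ^^ N) x = 0"
    by (rule L.ex_uniform_nilpotency[OF B assms(5)]) blast
  interpret LH: isomorphic_enveloping scaleL bracketL pmapL scaleH bracketH pmapH \<psi> N
    by unfold_locales (rule N)
  obtain \<psi>' where "quotient_iso RH.env_ideal RL.env_ideal \<psi>'"
    using iso.inverse_quotient_iso by blast
  then interpret iso': quotient_iso RH.env_ideal RL.env_ideal \<psi>' .
  interpret HL: isomorphic_enveloping scaleH bracketH pmapH scaleL bracketL pmapL \<psi>' N
    by unfold_locales (rule LH.iso_nilpotent)
  obtain C where C: "finite_dimensional_vector_space scaleH C"
    using LH.iso_finite_dimensional[OF B] by blast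
  obtain \<theta> where \<theta>: "Vector_Spaces.linear scaleL scaleH \<theta>" "surj \<theta>" "\<And>x. \<theta> (pmapL x) = pmapH (\<theta> x)"
    using LH.equivariant_surjection[OF C] by blast
  obtain \<theta>' where \<theta>': "Vector_Spaces.linear scaleH scaleL \<theta>'" "surj \<theta>'"
    using HL.equivariant_surjection[OF B] by blast
  interpret fdL: finite_dimensional_vector_space scaleL B by fact
  interpret fdH: finite_dimensional_vector_space scaleH C by fact
  interpret LHp: finite_dimensional_vector_space_pair scaleL B scaleH C ..
  interpret HLp: finite_dimensional_vector_space_pair scaleH C scaleL B ..
  have "RH.dim UNIV \<le> RL.dim UNIV" "RL.dim UNIV \<le> RH.dim UNIV"
    using LHp.dim_image_le[OF \<theta>(1), of UNIV] HLp.dim_image_le[OF \<theta>'(1), of UNIV] \<theta>(2) \<theta>'(2) by simp_all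
  then have "inj \<theta>"
    using LHp.linear_surjective_imp_injective[OF \<theta>(1,2)] by simp
  then have "bij \<theta>"
    using \<theta>(2) by (simp add: bij_def)
  moreover have "\<theta> (bracketL x y) = bracketH (\<theta> x) (\<theta> y)" for x y
    using module_hom.zero[OF \<theta>(1)[unfolded linear_iff_module_hom]] by (simp add: L.bracket_eq_0 H.bracket_eq_0)
  ultimately show ?thesis
    using \<theta> by (auto simp: restricted_lie_isomorphic_def)
qed

end
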